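(* Let $K$ be a field and $\mathcal{G}$ an ultragraph. Then $\mathcal{G}$ satisfies Condition (K) if and only if every prime ideal of $L_K(\mathcal{G})$ is graded.
   Context: An ultragraph $\mathcal{G}=(G^0,\mathcal{G}^1,r,s)$ consists of a countable set $G^0$ of vertices, a countable set $\mathcal{G}^1$ of edges, and maps $s:\mathcal{G}^1\to G^0$, $r:\mathcal{G}^1\to\mathcal{P}(G^0)\setminus\{\varnothing\}$. A vertex $v$ is regular if $0<|s^{-1}(v)|<\infty$. $\mathcal{G}^0$ denotes the smallest subset of $\mathcal{P}(G^0)$ that contains $\{v\}$ for all $v\in G^0$, contains $r(e)$ for all $e\in\mathcal{G}^1$, and is closed under relative complements, finite unions and finite intersections. A finite path is either an element $A\in\mathcal{G}^0$ (of length $0$, with $s(A)=r(A)=A$) or a sequence $\alpha=\alpha_1\cdots\alpha_n$ of edges with $s(\alpha_{i+1})\in r(\alpha_i)$ for $1\le i\le n-1$ (of length $|\alpha|=n$, with $s(\alpha)=s(\alpha_1)$, $r(\alpha)=r(\alpha_n)$). $\mathcal{G}^*$ is the set of finite paths. A closed path based at $v$ is a path $\alpha$ with $|\alpha|\ge1$ and $v=s(\alpha)\in r(\alpha)$. Condition (K): for every vertex $v\in G^0$, either there is no closed path based at $v$, or there are at least two distinct closed paths $\alpha=\alpha_1\cdots\alpha_n$ based at $v$ that are first-return, i.e. with $s(\alpha_i)\ne v$ for all $2\le i\le n$. For a field $K$, $L_K(\mathcal{G})$ is the (associative, not necessarily unital) $K$-algebra generated by $\{s_e,s_e^*\mid e\in\mathcal{G}^1\}\cup\{p_A\mid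 A\in\mathcal{G}^0\}$ subject to the relations, for all $A,B\in\mathcal{G}^0$, $e,f\in\mathcal{G}^1$: (1) $p_\varnothing=0$, $p_Ap_B=p_{A\cap B}$, $p_{A\cup B}=p_A+p_B-p_{A\cap B}$; (2) $p_{s(e)}s_e=s_e=s_ep_{r(e)}$ and $p_{r(e)}s_e^*=s_e^*=s_e^*p_{s(e)}$; (3) $s_e^*s_f=\delta_{e,f}p_{r(e)}$; (4) $p_v=\sum_{s(e)=v}s_es_e^*$ for every regular vertex $v$. Here $p_v:=p_{\{v\}}$; $s_A:=p_A=:s_A^*$ for $A\in\mathcal{G}^0$, and $s_\alpha:=s_{\alpha_1}\cdots s_{\alpha_n}$, $s_\alpha^*:=s_{\alpha_n}^*\cdots s_{\alpha_1}^*$. $L_K(\mathcal{G})$ is $\mathbb{Z}$-graded with degree-$n$ component $\mathrm{Span}_K\{s_\alpha p_As_\beta^*\mid\alpha,\beta\in\mathcal{G}^*,A\in\mathcal{G}^0,|\alpha|-|\beta|=n\}$; graded ideals are with respect to this grading. *)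

theory Defs
  imports "HOL-Algebra.Ideal_Product" "HOL-Algebra.QuotRing" "HOL-Algebra.Module" "HOL-Library.Poly_Mapping" "HOL-Library.Countable_Set"
begin

section \<open>Ultragraphs, paths and Condition (K)\<close>

record ('v, 'e) pre_ultragraph =
  verts :: "'v set"
  edges :: "'e set"
  src :: "'e \<Rightarrow> 'v"
  rng :: "'e \<Rightarrow> 'v set"

locale ultragraph =
  fixes G :: "('v, 'e) pre_ultragraph"
  assumes countable_verts: "countable (verts G)"
    and countable_edges: "countable (edges G)"
    and src_in_verts: "e \<in> edges G \<Longrightarrow> src G e \<in> verts G"
    and rng_subset_verts: "e \<in> edges G \<Longrightarrow> rng G e \<subseteq> verts G"
    and rng_nonempty: "e \<in> edges G \<Longrightarrow> rng G e \<noteq> {}"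

definition regular_vertex :: "('v, 'e) pre_ultragraph \<Rightarrow> 'v \<Rightarrow> bool" where
  "regular_vertex G v \<longleftrightarrow>
     v \<in> verts G \<and> finite {e \<in> edges G. src G e = v} \<and> {e \<in> edges G. src G e = v} \<noteq> {}"

text \<open>The empty set is listed explicitly as the empty finite union; this matters only for the
  ultragraph without vertices.\<close>

inductive_set gen_verts :: "('v, 'e) pre_ultragraph \<Rightarrow> 'v set set"
  for G :: "('v, 'e) pre_ultragraph" where
  empty: "{} \<in> gen_verts G"
| vertex: "v \<in> verts G \<Longrightarrow> {v} \<in> gen_verts G"
| range: "e \<in> edges G \<Longrightarrow> rng G e \<in> gen_verts G"
| diff: "A \<in> gen_verts G \<Longrightarrow> B \<in> gen_verts G \<Longrightarrow> A - B \<in> gen_verts G"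
| union: "A \<in> gen_verts G \<Longrightarrow> B \<in> gen_verts G \<Longrightarrow> A \<union> B \<in> gen_verts G"
| inter: "A \<in> gen_verts G \<Longrightarrow> B \<in> gen_verts G \<Longrightarrow> A \<inter> B \<in> gen_verts G"

definition edge_path :: "('v, 'e) pre_ultragraph \<Rightarrow> 'e list \<Rightarrow> bool" where
  "edge_path G es \<longleftrightarrow> es \<noteq> [] \<and> set es \<subseteq> edges G \<and>
     (\<forall>i. Suc i < length es \<longrightarrow> src G (es ! Suc i) \<in> rng G (es ! i))"

datatype ('v, 'e) upath = VPath "'v set" | EPath "'e list"

fun finite_path :: "('v, 'e) pre_ultragraph \<Rightarrow> ('v, 'e) upath \<Rightarrow> bool" where
  "finite_path G (VPath A) \<longleftrightarrow> A \<in> gen_verts G"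
| "finite_path G (EPath es) \<longleftrightarrow> edge_path G es"

fun path_length :: "('v, 'e) upath \<Rightarrow> nat" where
  "path_length (VPath A) = 0"
| "path_length (EPath es) = length es"

definition closed_path_at :: "('v, 'e) pre_ultragraph \<Rightarrow> 'v \<Rightarrow> 'e list \<Rightarrow> bool" where
  "closed_path_at G v es \<longleftrightarrow> edge_path G es \<and> src G (hd es) = v \<and> v \<in> rng G (last es)"

definition first_return_path_at :: "('v, 'e) pre_ultragraph \<Rightarrow> 'v \<Rightarrow> 'e list \<Rightarrow> bool" where
  "first_return_path_at G v es \<longleftrightarrow>
     closed_path_at G v es \<and> (\<forall>i. 1 \<le> i \<and> i < length es \<longrightarrow> src G (es ! i) \<noteq> v)"

definition condition_K :: "('v, 'e) pre_ultragraph \<Rightarrow> bool" where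
  "condition_K G \<longleftrightarrow> (\<forall>v \<in> verts G.
     (\<nexists>es. closed_path_at G v es) \<or>
     (\<exists>es fs. es \<noteq> fs \<and> first_return_path_at G v es \<and> first_return_path_at G v fs))"


section \<open>Ideals of not necessarily unital algebras\<close>

text \<open>An algebra over a field of type \<open>'k\<close> is represented by a \<^type>\<open>module\<close> record (carrier,
  addition, multiplication and scalar multiplication). Its \<open>one\<close> field carries no meaning here,
  and need not lie in the carrier. For the same reason the locale \<^locale>\<open>ideal\<close>, which assumes
  a unital ring, is not applicable. A \<open>two_sided_ideal\<close> is a ring ideal. The Leavitt path algebra
  below has local units, so its ring ideals are automatically closed under scalars; free
  non-unital algebras lack them, so closure under scalars is required in
  \<open>algebra_ideal_generated\<close>.\<close>

definition two_sided_ideal :: "('a, 'm) ring_scheme \<Rightarrow> 'a set \<Rightarrow> bool" where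
  "two_sided_ideal R I \<longleftrightarrow> additive_subgroup I R \<and>
     (\<forall>a \<in> I. \<forall>x \<in> carrier R. x \<otimes>\<^bsub>R\<^esub> a \<in> I \<and> a \<otimes>\<^bsub>R\<^esub> x \<in> I)"

definition prime_two_sided_ideal :: "('a, 'm) ring_scheme \<Rightarrow> 'a set \<Rightarrow> bool" where
  "prime_two_sided_ideal R P \<longleftrightarrow> two_sided_ideal R P \<and> P \<noteq> carrier R \<and>
     (\<forall>I J. two_sided_ideal R I \<longrightarrow> two_sided_ideal R J \<longrightarrow>
        ideal_prod R I J \<subseteq> P \<longrightarrow> I \<subseteq> P \<or> J \<subseteq> P)"

definition linear_subspace :: "('k, 'a, 'm) module_scheme \<Rightarrow> 'a set \<Rightarrow> bool" where
  "linear_subspace M U \<longleftrightarrow> additive_subgroup U M \<and> (\<forall>c. \<forall>x \<in> U. c \<odot>\<^bsub>M\<^esub> x \<in> U)"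

definition linear_span :: "('k, 'a, 'm) module_scheme \<Rightarrow> 'a set \<Rightarrow> 'a set" where
  "linear_span M S = \<Inter>{U. linear_subspace M U \<and> S \<subseteq> U}"

definition algebra_ideal_generated :: "('k, 'a, 'm) module_scheme \<Rightarrow> 'a set \<Rightarrow> 'a set" where
  "algebra_ideal_generated M S = \<Inter>{I. two_sided_ideal M I \<and> linear_subspace M I \<and> S \<subseteq> I}"

definition quotient_algebra :: "('k, 'a) module \<Rightarrow> 'a set \<Rightarrow> ('k, 'a set) module" where
  "quotient_algebra M I = ring.extend (M Quot I)
     \<lparr>smult = (\<lambda>c C. \<Union>x \<in> C. I +>\<^bsub>M\<^esub> (c \<odot>\<^bsub>M\<^esub> x))\<rparr>"

text \<open>For a grading by independent components \<open>Gr n\<close>, the condition below says that \<open>I\<close> is the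
  direct sum of the intersections \<open>I \<inter> Gr n\<close>.\<close>

definition graded_ideal :: "('a, 'm) ring_scheme \<Rightarrow> (int \<Rightarrow> 'a set) \<Rightarrow> 'a set \<Rightarrow> bool" where
  "graded_ideal R Gr I \<longleftrightarrow> two_sided_ideal R I \<and>
     (\<forall>x \<in> I. \<exists>N f. finite N \<and> (\<forall>n \<in> N. f n \<in> I \<inter> Gr n) \<and> x = finsum R f N)"


section \<open>Free non-unital algebras\<close>

datatype 'x free_word = FWord "'x list"

instantiation free_word :: (type) monoid_add
begin

definition zero_free_word :: "'a free_word" where
  "zero_free_word = FWord []"

fun plus_free_word :: "'a free_word \<Rightarrow> 'a free_word \<Rightarrow> 'a free_word" where
  "plus_free_word (FWord xs) (FWord ys) = FWord (xs @ ys)"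

instance
proof
  fix a b c :: "'a free_word"
  show "a + b + c = a + (b + c)"
    by (cases a; cases b; cases c) simp
  show "0 + a = a" "a + 0 = a"
    by (cases a; simp add: zero_free_word_def)+
qed

end

text \<open>On finitely supported functions from words to \<open>'k\<close>, \<^const>\<open>times\<close> is convolution, that is,
  the bilinear extension of concatenation of words. Excluding the empty word from the support
  yields the free algebra without unit.\<close>

definition free_algebra :: "'x set \<Rightarrow> ('k::field, 'x free_word \<Rightarrow>\<^sub>0 'k) module" where
  "free_algebra A =
    \<lparr>carrier = {f. Poly_Mapping.keys f \<subseteq> FWord ` {xs. xs \<noteq> [] \<and> set xs \<subseteq> A}},
     mult = (*), one = 1, zero = 0, add = (+),
     smult = (\<lambda>c. Poly_Mapping.map (\<lambda>a. c * a))\<rparr>"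

definition free_var :: "'x \<Rightarrow> ('x free_word \<Rightarrow>\<^sub>0 'k::field)" where
  "free_var x = Poly_Mapping.single (FWord [x]) 1"


section \<open>Leavitt path algebras of ultragraphs\<close>

datatype ('v, 'e) lpa_gen = GenP "'v set" | GenS 'e | GenSstar 'e

type_synonym ('v, 'e, 'k) lpa_free = "('v, 'e) lpa_gen free_word \<Rightarrow>\<^sub>0 'k"

abbreviation pp :: "'v set \<Rightarrow> ('v, 'e, 'k::field) lpa_free" where
  "pp A \<equiv> free_var (GenP A)"

abbreviation ss :: "'e \<Rightarrow> ('v, 'e, 'k::field) lpa_free" where
  "ss e \<equiv> free_var (GenS e)"

abbreviation ss_star :: "'e \<Rightarrow> ('v, 'e, 'k::field) lpa_free" where
  "ss_star e \<equiv> free_var (GenSstar e)"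

definition lpa_gens :: "('v, 'e) pre_ultragraph \<Rightarrow> ('v, 'e) lpa_gen set" where
  "lpa_gens G = GenP ` gen_verts G \<union> GenS ` edges G \<union> GenSstar ` edges G"

inductive_set lpa_relators :: "('v, 'e) pre_ultragraph \<Rightarrow> ('v, 'e, 'k::field) lpa_free set"
  for G :: "('v, 'e) pre_ultragraph" where
  p_empty: "pp {} \<in> lpa_relators G"
| p_inter: "A \<in> gen_verts G \<Longrightarrow> B \<in> gen_verts G \<Longrightarrow>
    pp A * pp B - pp (A \<inter> B) \<in> lpa_relators G"
| p_union: "A \<in> gen_verts G \<Longrightarrow> B \<in> gen_verts G \<Longrightarrow>
    pp (A \<union> B) - (pp A + pp B - pp (A \<inter> B)) \<in> lpa_relators G"
| src_s: "e \<in> edges G \<Longrightarrow> pp {src G e} * ss e - ss e \<in> lpa_relators G"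
| s_rng: "e \<in> edges G \<Longrightarrow> ss e * pp (rng G e) - ss e \<in> lpa_relators G"
| rng_star: "e \<in> edges G \<Longrightarrow> pp (rng G e) * ss_star e - ss_star e \<in> lpa_relators G"
| star_src: "e \<in> edges G \<Longrightarrow> ss_star e * pp {src G e} - ss_star e \<in> lpa_relators G"
| star_s: "e \<in> edges G \<Longrightarrow> f \<in> edges G \<Longrightarrow>
    ss_star e * ss f - (if e = f then pp (rng G e) else 0) \<in> lpa_relators G"
| regular: "regular_vertex G v \<Longrightarrow>
    pp {v} - (\<Sum>e \<in> {e \<in> edges G. src G e = v}. ss e * ss_star e) \<in> lpa_relators G"

definition lpa_ideal :: "('v, 'e) pre_ultragraph \<Rightarrow> ('v, 'e, 'k::field) lpa_free set" where
  "lpa_ideal G = algebra_ideal_generated (free_algebra (lpa_gens G)) (lpa_relators G)"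

definition leavitt_path_algebra ::
    "('v, 'e) pre_ultragraph \<Rightarrow> ('k::field, ('v, 'e, 'k) lpa_free set) module" where
  "leavitt_path_algebra G = quotient_algebra (free_algebra (lpa_gens G)) (lpa_ideal G)"

definition lpa_class ::
    "('v, 'e) pre_ultragraph \<Rightarrow> ('v, 'e, 'k::field) lpa_free \<Rightarrow> ('v, 'e, 'k) lpa_free set" where
  "lpa_class G x = lpa_ideal G +>\<^bsub>free_algebra (lpa_gens G)\<^esub> x"

text \<open>The elements attached to paths are formed in the free algebra and then mapped to the quotient
  by \<^const>\<open>lpa_class\<close>. The path \<open>EPath []\<close> is excluded by \<^const>\<open>finite_path\<close>.\<close>

fun path_elem :: "('v, 'e) upath \<Rightarrow> ('v, 'e, 'k::field) lpa_free" where
  "path_elem (VPath A) = pp A"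
| "path_elem (EPath es) = prod_list (map ss es)"

fun path_elem_star :: "('v, 'e) upath \<Rightarrow> ('v, 'e, 'k::field) lpa_free" where
  "path_elem_star (VPath A) = pp A"
| "path_elem_star (EPath es) = prod_list (map ss_star (rev es))"

definition lpa_component ::
    "('v, 'e) pre_ultragraph \<Rightarrow> int \<Rightarrow> ('v, 'e, 'k::field) lpa_free set set" where
  "lpa_component G n = linear_span (leavitt_path_algebra G)
     {lpa_class G (path_elem \<alpha> * pp A * path_elem_star \<beta>) | \<alpha> A \<beta>.
        finite_path G \<alpha> \<and> A \<in> gen_verts G \<and> finite_path G \<beta> \<and>
        int (path_length \<alpha>) - int (path_length \<beta>) = n}"

end

theory Submission
  imports Defs "HOL.Vector_Spaces"
begin

text \<open>
  \<^bold>\<open>Condition (K) implies graded.\<close> Let \<open>I\<close> be an ideal and divide by the ideal generated by its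
  homogeneous elements, so that \<open>I\<close> contains no nonzero homogeneous element. An idempotent \<open>u\<close> of
  degree \<open>0\<close> annihilated by all edges satisfies \<open>u x u = u x\<^sub>0 u\<close> for all \<open>x\<close>, so it is not the
  component \<open>x\<^sub>0\<close> of any \<open>x \<in> I\<close>. If \<open>I \<noteq> 0\<close>, this lets one multiply an element of \<open>I\<close> by
  \<open>s\<^sub>\<mu>\<^sup>*\<close> and \<open>s\<^sub>\<nu>\<close> such that \<open>x\<^sub>0 = p\<^sub>v\<close>, and then to follow edges from \<open>v\<close> forever. If no closed path
  is met, \<open>s\<^sub>\<gamma>\<^sup>* x s\<^sub>\<gamma> = p\<^bsub>r(\<gamma>)\<^esub>\<close> for long \<open>\<gamma>\<close>; otherwise there are two first-return paths \<open>\<alpha> \<noteq> \<beta>\<close>, whose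
  isometries are orthogonal, and conjugation by \<open>s\<^sub>\<alpha>\<^sup>m s\<^sub>\<beta>\<close> kills all components of nonzero degree.

  \<^bold>\<open>Failure of (K) yields a nongraded prime.\<close> Let \<open>c\<close> be the only first-return path at \<open>v\<close>. The
  annihilator of the Chen module on the tail class of \<open>c c c \<dots>\<close> is prime. It contains \<open>p\<^sub>v - s\<^sub>c\<close>,
  since \<open>c c c \<dots>\<close> is the only path from \<open>v\<close> in the class, but not \<open>p\<^sub>v\<close>.
\<close>

section \<open>Paths and monomials\<close>

text \<open>The algebra has no unit and exists only as a set of cosets. Computations are therefore
  moved to a unital ring of linear endomorphisms that contains a copy of any quotient of the free
  algebra, while ideals are handled as ideals of the free algebra containing the relators, where
  degrees can be read off words. Reaching a vertex projection in degree 0 is the delicate point. A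
  degree-0 element \<open>y\<close> is compressed to \<open>t e * y * s f\<close>, which lowers the
  lengths of its monomials, but all these compressions might vanish although \<open>y\<close> does
  not. In that case, with \<open>P\<close> a finite sum of elements \<open>s e * t e\<close>,
  suitable cutting shows that \<open>y\<close> is made of scalar multiples of
  \<open>p A - P * p A\<close>. These are idempotents annihilated by every nonzero edge, the very
  kind that is excluded, so the compression never gets stuck. Nonzero degrees are brought to degree
  0 by removing edges on one side. Tail classes enter the other direction because two paths of one
  class differ only in a finite beginning. A single word can then move one path to the other, which
  is what primeness needs, and uniqueness of the first return leaves one path of the class at the
  vertex.\<close>

inductive_set lspan :: "('k \<Rightarrow> 'b::ring_1) \<Rightarrow> 'b set \<Rightarrow> 'b set"
  for \<kappa> :: "'k \<Rightarrow> 'b::ring_1" and X :: "'b set" where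
  zero: "0 \<in> lspan \<kappa> X"
| step: "x \<in> X \<Longrightarrow> y \<in> lspan \<kappa> X \<Longrightarrow> \<kappa> c * x + y \<in> lspan \<kappa> X"

lemma lspan_add:
  assumes "x \<in> lspan \<kappa> X" "y \<in> lspan \<kappa> X"
  shows "x + y \<in> lspan \<kappa> X"
  using assms(1)
proof induction
  case zero
  then show ?case using assms(2) by simp
next
  case (step x z c)
  then show ?case using lspan.step[OF step(1) step(3), of c] by (simp add: add.assoc)
qed

lemma lspan_mono: "X \<subseteq> Y \<Longrightarrow> x \<in> lspan \<kappa> X \<Longrightarrow> x \<in> lspan \<kappa> Y"
  by (rotate_tac 1, induction rule: lspan.induct) (auto intro: lspan.intros)

lemma lspan_sum: "(\<And>i. i \<in> A \<Longrightarrow> f i \<in> lspan \<kappa> X) \<Longrightarrow> sum f A \<in> lspan \<kappa> X"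
  by (induction A rule: infinite_finite_induct) (auto intro: lspan.zero lspan_add)

section \<open>Edge paths, closed paths and their powers\<close>

lemma edge_path_Cons:
  "edge_path G (e # es) \<longleftrightarrow>
    e \<in> edges G \<and> (es = [] \<or> (src G (hd es) \<in> rng G e \<and> edge_path G es))"
proof (cases es)
  case Nil
  then show ?thesis by (simp add: edge_path_def)
next
  case (Cons f fs)
  have "(\<forall>i. Suc i < length (e # es) \<longrightarrow> src G ((e # es) ! Suc i) \<in> rng G ((e # es) ! i)) \<longleftrightarrow>
    src G f \<in> rng G e \<and> (\<forall>i. Suc i < length es \<longrightarrow> src G (es ! Suc i) \<in> rng G (es ! i))"
    (is "?l = ?r")
  proof
    assume l: ?l
    show ?r
    proof (intro conjI allI impI)
      show "src G f \<in> rng G e" using l[rule_format, of 0] Cons by simp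
      show "src G (es ! Suc i) \<in> rng G (es ! i)" if "Suc i < length es" for i
        using l[rule_format, of "Suc i"] that by simp
    qed
  next
    assume r: ?r
    show ?l
    proof (intro allI impI)
      fix i assume "Suc i < length (e # es)"
      then show "src G ((e # es) ! Suc i) \<in> rng G ((e # es) ! i)"
        using r Cons by (cases i) auto
    qed
  qed
  then show ?thesis using Cons by (auto simp: edge_path_def)
qed

lemma edge_path_append:
  "xs \<noteq> [] \<Longrightarrow> ys \<noteq> [] \<Longrightarrow> edge_path G (xs @ ys) \<longleftrightarrow>
    edge_path G xs \<and> edge_path G ys \<and> src G (hd ys) \<in> rng G (last xs)"
  by (induction xs) (auto simp: edge_path_Cons)

lemma edge_path_edges: "edge_path G es \<Longrightarrow> set es \<subseteq> edges G"
  by (simp add: edge_path_def)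

lemma edge_path_nonempty: "edge_path G es \<Longrightarrow> es \<noteq> []"
  by (simp add: edge_path_def)

lemma edge_path_take: "edge_path G es \<Longrightarrow> 0 < i \<Longrightarrow> edge_path G (take i es)"
  by (cases "i < length es")
    (use edge_path_append[of "take i es" "drop i es" G] edge_path_nonempty[of G es] in auto)

lemma edge_path_drop: "edge_path G es \<Longrightarrow> i < length es \<Longrightarrow> edge_path G (drop i es)"
  by (cases "i = 0")
    (use edge_path_append[of "take i es" "drop i es" G] edge_path_nonempty[of G es] in auto)

lemma closed_path_at_append:
  "closed_path_at G v xs \<Longrightarrow> closed_path_at G v ys \<Longrightarrow> closed_path_at G v (xs @ ys)"
  unfolding closed_path_at_def
  by (subst edge_path_append) (auto dest: edge_path_nonempty)

lemma closed_path_at_power: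
  assumes "closed_path_at G v xs" "0 < m"
  shows "closed_path_at G v (concat (replicate m xs))"
  using assms(2)
proof (induction m)
  case (Suc m)
  then show ?case
    using assms(1) by (cases m) (auto intro!: closed_path_at_append)
qed simp

text \<open>The segment from the first occurrence of a repeated edge \<open>e\<close> to just before
  the second one ends in a range containing \<open>src G e\<close>.\<close>

lemma closed_path_of_repeated_edge:
  assumes "edge_path G es" "\<not> distinct es"
  shows "\<exists>e\<in>set es. \<exists>fs. closed_path_at G (src G e) fs"
proof -
  obtain xs ys zs e where es: "es = xs @ [e] @ ys @ [e] @ zs"
    using not_distinct_decomp[OF assms(2)] by auto
  have "edge_path G (e # ys @ e # zs)"
    using assms(1) unfolding es by (cases "xs = []") (auto simp: edge_path_append)
  then have "edge_path G ((e # ys) @ e # zs)" by simp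
  then have "closed_path_at G (src G e) (e # ys)"
    unfolding closed_path_at_def by (subst (asm) edge_path_append) auto
  then show ?thesis using es by auto
qed

text \<open>Within one copy of \<open>es\<close> only the initial edge starts at \<open>v\<close>;
  the induction strips one copy at a time. This determines which suffixes of a power begin at the
  base vertex.\<close>

lemma first_return_power_source:
  assumes "first_return_path_at G v es" "i < m * length es"
    and "src G (concat (replicate m es) ! i) = v"
  shows "length es dvd i"
  using assms(2,3)
proof (induction m arbitrary: i)
  case (Suc m)
  show ?case
  proof (cases "i < length es")
    case True
    then have "src G (es ! i) = v" using Suc.prems by (simp add: nth_append)
    then have "i = 0"
      using assms(1) True unfolding first_return_path_at_def by (metis One_nat_def Suc_leI gr0I)
    then show ?thesis by simp
  next
    case False
    then have "length es dvd i - length es"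
      using Suc.prems by (intro Suc.IH) (auto simp: nth_append)
    then show ?thesis using False by (metis dvd_diffD dvd_refl not_less)
  qed
qed simp

lemma drop_power: "drop (k * length xs) (concat (replicate m xs)) = concat (replicate (m - k) xs)"
proof (induction k arbitrary: m)
  case (Suc k)
  then show ?case by (cases m) auto
qed simp

lemma length_power: "length (concat (replicate m xs)) = m * length xs"
  by (induction m) auto

text \<open>The relations are studied in a unital ring so that empty products make sense; \<kappa>
  is a central copy of the field. The unit of the ring need not lie in the algebra generated by the
  family.\<close>

locale leavitt_family = ultragraph G
  for G :: "('v, 'e) pre_ultragraph" +
  fixes \<kappa> :: "'k::field \<Rightarrow> 'b::ring_1" and p :: "'v set \<Rightarrow> 'b" and s t :: "'e \<Rightarrow> 'b"
  assumes \<kappa>_add: "\<kappa> (a + b) = \<kappa> a + \<kappa> b"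
    and \<kappa>_mult: "\<kappa> (a * b) = \<kappa> a * \<kappa> b"
    and \<kappa>_one: "\<kappa> 1 = 1"
    and \<kappa>_comm: "x * \<kappa> a = \<kappa> a * x"
    and p_empty: "p {} = 0"
    and p_mult: "A \<in> gen_verts G \<Longrightarrow> B \<in> gen_verts G \<Longrightarrow> p A * p B = p (A \<inter> B)"
    and p_un: "A \<in> gen_verts G \<Longrightarrow> B \<in> gen_verts G \<Longrightarrow> p (A \<union> B) = p A + p B - p (A \<inter> B)"
    and p_src_s: "e \<in> edges G \<Longrightarrow> p {src G e} * s e = s e"
    and s_p_rng: "e \<in> edges G \<Longrightarrow> s e * p (rng G e) = s e"
    and p_rng_t: "e \<in> edges G \<Longrightarrow> p (rng G e) * t e = t e"
    and t_p_src: "e \<in> edges G \<Longrightarrow> t e * p {src G e} = t e"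
    and t_s: "e \<in> edges G \<Longrightarrow> f \<in> edges G \<Longrightarrow> t e * s f = (if e = f then p (rng G e) else 0)"
begin

lemma \<kappa>_zero: "\<kappa> 0 = 0"
  using \<kappa>_add[of 0 0] by simp

lemma \<kappa>_cancel: "c \<noteq> 0 \<Longrightarrow> \<kappa> (inverse c) * (\<kappa> c * x) = x"
  by (simp add: mult.assoc[symmetric] \<kappa>_mult[symmetric] \<kappa>_one)

lemma \<kappa>_eq_0: "\<kappa> c * x = 0 \<Longrightarrow> c \<noteq> 0 \<Longrightarrow> x = 0"
  using \<kappa>_cancel[of c x] by simp

lemma \<kappa>_left_comm: "a * (\<kappa> c * x) = \<kappa> c * (a * x)"
  by (metis \<kappa>_comm mult.assoc)

lemma lspan_base: "x \<in> X \<Longrightarrow> x \<in> lspan \<kappa> X"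
  using lspan.step[of x X 0 \<kappa> 1] lspan.zero[of \<kappa> X] by (simp add: \<kappa>_one)

lemma lspan_scale: "x \<in> lspan \<kappa> X \<Longrightarrow> \<kappa> c * x \<in> lspan \<kappa> X"
proof (induction rule: lspan.induct)
  case (step x y d)
  have "\<kappa> c * (\<kappa> d * x + y) = \<kappa> (c * d) * x + \<kappa> c * y"
    by (simp add: \<kappa>_mult algebra_simps)
  then show ?case using lspan.step[OF step(1) step(3), of "c * d"] by simp
qed (auto intro: lspan.zero)

lemma lspan_map:
  assumes "\<And>x. x \<in> X \<Longrightarrow> a * x * b \<in> lspan \<kappa> Y" "y \<in> lspan \<kappa> X"
  shows "a * y * b \<in> lspan \<kappa> Y"
  using assms(2)
proof induction
  case (step x y c)
  have "a * (\<kappa> c * x + y) * b = \<kappa> c * (a * x * b) + a * y * b"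
    by (simp add: algebra_simps \<kappa>_left_comm)
  then show ?case using step assms(1) by (auto intro: lspan_add lspan_scale)
qed (auto intro: lspan.zero)

lemma lspan_Un:
  assumes "y \<in> lspan \<kappa> (X \<union> Y)"
  shows "\<exists>a\<in>lspan \<kappa> X. \<exists>b\<in>lspan \<kappa> Y. y = a + b"
  using assms
proof induction
  case zero
  show ?case by (intro bexI[of _ 0]) (auto intro: lspan.zero)
next
  case (step x y c)
  then obtain a b where ab: "a \<in> lspan \<kappa> X" "b \<in> lspan \<kappa> Y" "y = a + b" by auto
  show ?case
  proof (cases "x \<in> X")
    case True
    then show ?thesis using ab lspan.step[OF True ab(1), of c] by (metis add.assoc)
  next
    case False
    then have "x \<in> Y" using step by simp
    then show ?thesis using ab lspan.step[OF _ ab(2), of x c] by (metis add.left_commute)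
  qed
qed

lemma src_gen: "e \<in> edges G \<Longrightarrow> {src G e} \<in> gen_verts G"
  by (simp add: gen_verts.vertex src_in_verts)

lemma p_split:
  assumes "A \<in> gen_verts G" "B \<in> gen_verts G"
  shows "p A = p (A \<inter> B) + p (A - B)"
proof -
  have "(A \<inter> B) \<union> (A - B) = A" "(A \<inter> B) \<inter> (A - B) = {}" by auto
  then show ?thesis
    using p_un[OF gen_verts.inter[OF assms] gen_verts.diff[OF assms]] by (simp add: p_empty)
qed

lemma p_s: "A \<in> gen_verts G \<Longrightarrow> e \<in> edges G \<Longrightarrow> p A * s e = (if src G e \<in> A then s e else 0)"
proof -
  assume A: "A \<in> gen_verts G" and e: "e \<in> edges G"
  have "p A * s e = p (A \<inter> {src G e}) * s e"
    using p_mult[OF A src_gen[OF e]] p_src_s[OF e] by (metis mult.assoc)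
  also have "\<dots> = (if src G e \<in> A then s e else 0)"
    using p_src_s[OF e] by (auto simp: p_empty)
  finally show ?thesis .
qed

lemma t_p: "A \<in> gen_verts G \<Longrightarrow> e \<in> edges G \<Longrightarrow> t e * p A = (if src G e \<in> A then t e else 0)"
proof -
  assume A: "A \<in> gen_verts G" and e: "e \<in> edges G"
  have "t e * p A = t e * p ({src G e} \<inter> A)"
    using p_mult[OF src_gen[OF e] A] t_p_src[OF e] by (metis mult.assoc)
  also have "\<dots> = (if src G e \<in> A then t e else 0)"
    using t_p_src[OF e] by (auto simp: p_empty)
  finally show ?thesis .
qed

section \<open>Path products and their cancellation rules\<close>

definition sp :: "'e list \<Rightarrow> 'b" where "sp \<alpha> = prod_list (map s \<alpha>)"
definition tp :: "'e list \<Rightarrow> 'b" where "tp \<alpha> = prod_list (map t (rev \<alpha>))"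
definition mon :: "'e list \<Rightarrow> 'v set \<Rightarrow> 'e list \<Rightarrow> 'b" where "mon \<alpha> A \<beta> = sp \<alpha> * p A * tp \<beta>"

lemma sp_simps [simp]: "sp [] = 1" "sp (e # \<alpha>) = s e * sp \<alpha>" "sp (\<alpha> @ \<beta>) = sp \<alpha> * sp \<beta>"
  by (simp_all add: sp_def)

lemma tp_simps [simp]: "tp [] = 1" "tp (e # \<alpha>) = tp \<alpha> * t e" "tp (\<alpha> @ \<beta>) = tp \<beta> * tp \<alpha>"
  by (simp_all add: tp_def)

lemma p_sp: "A \<in> gen_verts G \<Longrightarrow> set \<alpha> \<subseteq> edges G \<Longrightarrow> \<alpha> \<noteq> [] \<Longrightarrow>
    p A * sp \<alpha> = (if src G (hd \<alpha>) \<in> A then sp \<alpha> else 0)"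
  by (cases \<alpha>) (simp_all add: mult.assoc[symmetric] p_s)

lemma tp_p: "A \<in> gen_verts G \<Longrightarrow> set \<alpha> \<subseteq> edges G \<Longrightarrow> \<alpha> \<noteq> [] \<Longrightarrow>
    tp \<alpha> * p A = (if src G (hd \<alpha>) \<in> A then tp \<alpha> else 0)"
  by (cases \<alpha>) (simp_all add: mult.assoc t_p)

text \<open>After an edge \<open>e\<close> one may insert \<open>p (rng G e)\<close>, which kills a
  following product whose source lies outside this range.\<close>

lemma sp_non_path: "set \<alpha> \<subseteq> edges G \<Longrightarrow> \<alpha> \<noteq> [] \<Longrightarrow> \<not> edge_path G \<alpha> \<Longrightarrow> sp \<alpha> = 0"
proof (induction \<alpha>)
  case (Cons e \<alpha>)
  have "\<alpha> \<noteq> []" using Cons.prems by (auto simp: edge_path_Cons)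
  show ?case
  proof (cases "edge_path G \<alpha>")
    case True
    then have "src G (hd \<alpha>) \<notin> rng G e" using Cons.prems by (auto simp: edge_path_Cons)
    then have "p (rng G e) * sp \<alpha> = 0"
      using Cons.prems \<open>\<alpha> \<noteq> []\<close> by (simp add: p_sp gen_verts.range)
    then show ?thesis using Cons.prems s_p_rng[of e] by (simp, metis mult.assoc mult_zero_right)
  qed (use Cons \<open>\<alpha> \<noteq> []\<close> in auto)
qed simp

lemma tp_non_path: "set \<alpha> \<subseteq> edges G \<Longrightarrow> \<alpha> \<noteq> [] \<Longrightarrow> \<not> edge_path G \<alpha> \<Longrightarrow> tp \<alpha> = 0"
proof (induction \<alpha>)
  case (Cons e \<alpha>)
  have "\<alpha> \<noteq> []" using Cons.prems by (auto simp: edge_path_Cons)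
  show ?case
  proof (cases "edge_path G \<alpha>")
    case True
    then have "src G (hd \<alpha>) \<notin> rng G e" using Cons.prems by (auto simp: edge_path_Cons)
    then have "tp \<alpha> * p (rng G e) = 0"
      using Cons.prems \<open>\<alpha> \<noteq> []\<close> by (simp add: tp_p gen_verts.range)
    then show ?thesis using Cons.prems p_rng_t[of e] by (simp, metis mult.assoc mult_zero_left)
  qed (use Cons \<open>\<alpha> \<noteq> []\<close> in auto)
qed simp

lemma tp_sp_same: "edge_path G \<alpha> \<Longrightarrow> tp \<alpha> * sp \<alpha> = p (rng G (last \<alpha>))"
proof (induction \<alpha>)
  case (Cons e \<alpha>)
  have e: "e \<in> edges G" using Cons.prems by (simp add: edge_path_Cons)
  show ?case
  proof (cases "\<alpha> = []")
    case True
    then show ?thesis using e by (simp add: t_s)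
  next
    case False
    then have \<alpha>: "edge_path G \<alpha>" "src G (hd \<alpha>) \<in> rng G e"
      using Cons.prems by (auto simp: edge_path_Cons)
    have "tp (e # \<alpha>) * sp (e # \<alpha>) = tp \<alpha> * ((t e * s e) * sp \<alpha>)" by (simp add: mult.assoc)
    also have "\<dots> = tp \<alpha> * sp \<alpha>"
      using e \<alpha> False by (simp add: t_s p_sp gen_verts.range edge_path_edges)
    finally show ?thesis using Cons.IH[OF \<alpha>(1)] False by simp
  qed
qed (simp add: edge_path_def)

text \<open>Equal first letters leave a range projection that fixes or kills the rest; the first
  pair of different letters gives \<open>t e * s f = 0\<close>.\<close>

lemma tp_sp_distinct:
  "length \<alpha> = length \<beta> \<Longrightarrow> set \<alpha> \<subseteq> edges G \<Longrightarrow> set \<beta> \<subseteq> edges G \<Longrightarrow> \<alpha> \<noteq> \<beta> \<Longrightarrow> tp \<alpha> * sp \<beta> = 0"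
proof (induction \<alpha> \<beta> rule: list_induct2)
  case (Cons e \<alpha> f \<beta>)
  have *: "tp (e # \<alpha>) * sp (f # \<beta>) = tp \<alpha> * ((t e * s f) * sp \<beta>)" by (simp add: mult.assoc)
  show ?case
  proof (cases "e = f")
    case True
    then have "\<alpha> \<noteq> \<beta>" "\<beta> \<noteq> []" using Cons by auto
    then show ?thesis using * Cons True by (simp add: t_s p_sp gen_verts.range)
  qed (use * Cons in \<open>simp add: t_s\<close>)
qed simp

text \<open>A matching prefix collapses to the projection of its last range. As \<mu> is strictly
  shorter, a nonempty remainder of \<gamma> absorbs this projection; at equal lengths the projection
  itself would be left.\<close>

lemma tp_sp_prefix:
  assumes "edge_path G \<gamma>" "set \<mu> \<subseteq> edges G" "length \<mu> < length \<gamma>"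
  shows "tp \<gamma> * sp \<mu> = (if \<mu> = take (length \<mu>) \<gamma> then tp (drop (length \<mu>) \<gamma>) else 0)"
proof (cases "\<mu> = []")
  case False
  let ?a = "take (length \<mu>) \<gamma>" and ?b = "drop (length \<mu>) \<gamma>"
  have ne: "?a \<noteq> []" "?b \<noteq> []" using False assms by auto
  have ab: "edge_path G ?a" "edge_path G ?b" "src G (hd ?b) \<in> rng G (last ?a)"
    using edge_path_append[OF ne, of G] assms(1) by auto
  have gen: "rng G (last ?a) \<in> gen_verts G"
    using edge_path_edges[OF ab(1)] last_in_set[OF ne(1)] by (blast intro: gen_verts.range)
  have "tp \<gamma> = tp ?b * tp ?a" by (metis append_take_drop_id tp_simps(3))
  moreover have "tp ?b * p (rng G (last ?a)) = tp ?b"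
    using ab ne by (subst tp_p) (auto simp: edge_path_edges gen)
  ultimately show ?thesis
    using tp_sp_distinct[of ?a \<mu>] tp_sp_same[OF ab(1)] edge_path_edges[OF ab(1)] assms
    by (auto simp: mult.assoc)
qed simp

lemma tp_prefix_sp:
  assumes "edge_path G \<gamma>" "set \<mu> \<subseteq> edges G" "length \<mu> < length \<gamma>"
  shows "tp \<mu> * sp \<gamma> = (if \<mu> = take (length \<mu>) \<gamma> then sp (drop (length \<mu>) \<gamma>) else 0)"
proof (cases "\<mu> = []")
  case False
  let ?a = "take (length \<mu>) \<gamma>" and ?b = "drop (length \<mu>) \<gamma>"
  have ne: "?a \<noteq> []" "?b \<noteq> []" using False assms by auto
  have ab: "edge_path G ?a" "edge_path G ?b" "src G (hd ?b) \<in> rng G (last ?a)"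
    using edge_path_append[OF ne, of G] assms(1) by auto
  have gen: "rng G (last ?a) \<in> gen_verts G"
    using edge_path_edges[OF ab(1)] last_in_set[OF ne(1)] by (blast intro: gen_verts.range)
  have "sp \<gamma> = sp ?a * sp ?b" by (metis append_take_drop_id sp_simps(3))
  moreover have "p (rng G (last ?a)) * sp ?b = sp ?b"
    using ab ne by (subst p_sp) (auto simp: edge_path_edges gen)
  ultimately show ?thesis
    using tp_sp_distinct[of \<mu> ?a] tp_sp_same[OF ab(1)] edge_path_edges[OF ab(1)] assms
    by (auto simp: mult.assoc[symmetric])
qed simp

text \<open>A condition on the two lengths alone covers all the spans that occur: a fixed degree,
  all other degrees, and equal lengths up to a bound. Composability of the lists is not imposed,
  because lists that are not paths contribute zero.\<close>

definition mspan :: "(nat \<Rightarrow> nat \<Rightarrow> bool) \<Rightarrow> 'b set" where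
  "mspan Q = lspan \<kappa> {mon \<alpha> A \<beta> |\<alpha> A \<beta>. set \<alpha> \<subseteq> edges G \<and> A \<in> gen_verts G \<and>
      set \<beta> \<subseteq> edges G \<and> Q (length \<alpha>) (length \<beta>)}"

lemma mspan_mon: "set \<alpha> \<subseteq> edges G \<Longrightarrow> A \<in> gen_verts G \<Longrightarrow> set \<beta> \<subseteq> edges G \<Longrightarrow>
    Q (length \<alpha>) (length \<beta>) \<Longrightarrow> mon \<alpha> A \<beta> \<in> mspan Q"
  unfolding mspan_def by (intro lspan_base) auto

lemmas mspan_zero = lspan.zero[of \<kappa> "{mon \<alpha> A \<beta> |\<alpha> A \<beta>. set \<alpha> \<subseteq> edges G \<and> A \<in> gen_verts G \<and>
      set \<beta> \<subseteq> edges G \<and> Q (length \<alpha>) (length \<beta>)}" for Q, folded mspan_def]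

lemma mspan_add: "x \<in> mspan Q \<Longrightarrow> y \<in> mspan Q \<Longrightarrow> x + y \<in> mspan Q"
  unfolding mspan_def by (rule lspan_add)

lemma mspan_scale: "x \<in> mspan Q \<Longrightarrow> \<kappa> c * x \<in> mspan Q"
  unfolding mspan_def by (rule lspan_scale)

lemma mspan_sum: "(\<And>i. i \<in> A \<Longrightarrow> f i \<in> mspan Q) \<Longrightarrow> sum f A \<in> mspan Q"
  unfolding mspan_def by (rule lspan_sum)

lemma mspan_mono: "x \<in> mspan Q \<Longrightarrow> (\<And>i j. Q i j \<Longrightarrow> Q' i j) \<Longrightarrow> x \<in> mspan Q'"
  unfolding mspan_def by (erule lspan_mono[rotated]) blast

lemma mspan_induct [consumes 1, case_names zero step]:
  assumes "x \<in> mspan Q" "R 0"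
    and "\<And>\<alpha> A \<beta> y c. set \<alpha> \<subseteq> edges G \<Longrightarrow> A \<in> gen_verts G \<Longrightarrow> set \<beta> \<subseteq> edges G \<Longrightarrow>
      Q (length \<alpha>) (length \<beta>) \<Longrightarrow> y \<in> mspan Q \<Longrightarrow> R y \<Longrightarrow> R (\<kappa> c * mon \<alpha> A \<beta> + y)"
  shows "R x"
  using assms(1) unfolding mspan_def
  by (induction rule: lspan.induct) (use assms(2,3) in \<open>auto simp: mspan_def\<close>)

lemma mspan_map:
  assumes "\<And>\<alpha> A \<beta>. set \<alpha> \<subseteq> edges G \<Longrightarrow> A \<in> gen_verts G \<Longrightarrow> set \<beta> \<subseteq> edges G \<Longrightarrow>
      Q (length \<alpha>) (length \<beta>) \<Longrightarrow> a * mon \<alpha> A \<beta> * b \<in> mspan Q'"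
    and "x \<in> mspan Q"
  shows "a * x * b \<in> mspan Q'"
  using lspan_map[OF _ assms(2)[unfolded mspan_def], of a b] assms(1)
  unfolding mspan_def by blast

lemma mspan_p: "A \<in> gen_verts G \<Longrightarrow> Q 0 0 \<Longrightarrow> p A \<in> mspan Q"
  using mspan_mon[of "[]" A "[]" Q] by (simp add: mon_def)

lemma p_mon: "B \<in> gen_verts G \<Longrightarrow> set \<alpha> \<subseteq> edges G \<Longrightarrow> A \<in> gen_verts G \<Longrightarrow>
    p B * mon \<alpha> A \<beta> = (if \<alpha> = [] then mon [] (B \<inter> A) \<beta> else if src G (hd \<alpha>) \<in> B then mon \<alpha> A \<beta> else 0)"
  by (auto simp: mon_def mult.assoc[symmetric] p_mult p_sp)

lemma mon_p: "B \<in> gen_verts G \<Longrightarrow> set \<beta> \<subseteq> edges G \<Longrightarrow> A \<in> gen_verts G \<Longrightarrow>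
    mon \<alpha> A \<beta> * p B = (if \<beta> = [] then mon \<alpha> (A \<inter> B) [] else if src G (hd \<beta>) \<in> B then mon \<alpha> A \<beta> else 0)"
  by (auto simp: mon_def mult.assoc p_mult tp_p)

lemma s_mon: "s e * mon \<alpha> A \<beta> = mon (e # \<alpha>) A \<beta>"
  by (simp add: mon_def mult.assoc)

lemma mon_t: "mon \<alpha> A \<beta> * t e = mon \<alpha> A (e # \<beta>)"
  by (simp add: mon_def mult.assoc)

text \<open>\<open>tp\<close> reverses its list, so a starred edge arriving from the left goes to
  the end of \<beta>. The set \<open>A\<close> only decides, through the source of \<open>e\<close>,
  whether the product vanishes; the projection that remains is that of the range.\<close>

lemma t_mon_Nil: "e \<in> edges G \<Longrightarrow> A \<in> gen_verts G \<Longrightarrow>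
    t e * mon [] A \<beta> = (if src G e \<in> A then mon [] (rng G e) (\<beta> @ [e]) else 0)"
  by (simp add: mon_def mult.assoc[symmetric] t_p p_rng_t)

lemma mon_s_Nil: "e \<in> edges G \<Longrightarrow> A \<in> gen_verts G \<Longrightarrow>
    mon \<alpha> A [] * s e = (if src G e \<in> A then mon (\<alpha> @ [e]) (rng G e) [] else 0)"
  by (simp add: mon_def mult.assoc p_s s_p_rng)

lemma t_mon_Cons: "e \<in> edges G \<Longrightarrow> f \<in> edges G \<Longrightarrow>
    t e * mon (f # \<alpha>) A \<beta> = (if e = f then p (rng G e) * mon \<alpha> A \<beta> else 0)"
  by (simp add: mon_def mult.assoc[symmetric] t_s)

lemma mon_s_Cons: "e \<in> edges G \<Longrightarrow> f \<in> edges G \<Longrightarrow>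
    mon \<alpha> A (f # \<beta>) * s e = (if e = f then mon \<alpha> A \<beta> * p (rng G e) else 0)"
  by (simp add: mon_def mult.assoc t_s)

lemma p_mspan:
  assumes "x \<in> mspan Q" "B \<in> gen_verts G"
  shows "p B * x \<in> mspan Q"
proof -
  have "p B * x * 1 \<in> mspan Q"
    by (rule mspan_map[OF _ assms(1)])
      (use assms(2) in \<open>auto simp: p_mon gen_verts.inter intro!: mspan_mon mspan_zero\<close>)
  then show ?thesis by simp
qed

lemma mspan_times_p:
  assumes "x \<in> mspan Q" "B \<in> gen_verts G"
  shows "x * p B \<in> mspan Q"
proof -
  have "1 * x * p B \<in> mspan Q"
    by (rule mspan_map[OF _ assms(1)])
      (use assms(2) in \<open>auto simp: mon_p gen_verts.inter intro!: mspan_mon mspan_zero\<close>)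
  then show ?thesis by simp
qed

lemma s_mspan:
  assumes "x \<in> mspan Q" "e \<in> edges G" "\<And>i j. Q i j \<Longrightarrow> Q' (Suc i) j"
  shows "s e * x \<in> mspan Q'"
proof -
  have "s e * x * 1 \<in> mspan Q'"
    by (rule mspan_map[OF _ assms(1)]) (use assms(2,3) in \<open>auto simp: s_mon intro!: mspan_mon\<close>)
  then show ?thesis by simp
qed

text \<open>The two conditions on \<open>Q'\<close> mirror the cancellation: \<open>t e\<close>
  removes the first letter of \<alpha>, and if there is none it lengthens \<beta>. Either way the
  difference of the lengths drops by one.\<close>

lemma t_mspan:
  assumes "x \<in> mspan Q" "e \<in> edges G"
    and "\<And>j. Q 0 j \<Longrightarrow> Q' 0 (Suc j)" "\<And>i j. Q (Suc i) j \<Longrightarrow> Q' i j"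
  shows "t e * x \<in> mspan Q'"
proof -
  have "t e * x * 1 \<in> mspan Q'"
  proof (rule mspan_map[OF _ assms(1)])
    fix \<alpha> A \<beta> assume h: "set \<alpha> \<subseteq> edges G" "A \<in> gen_verts G" "set \<beta> \<subseteq> edges G"
      "Q (length \<alpha>) (length \<beta>)"
    show "t e * mon \<alpha> A \<beta> * 1 \<in> mspan Q'"
      using h assms(2-) by (cases \<alpha>)
        (auto simp: t_mon_Nil t_mon_Cons intro!: mspan_zero mspan_mon p_mspan gen_verts.range)
  qed
  then show ?thesis by simp
qed

lemma mspan_times_s:
  assumes "x \<in> mspan Q" "e \<in> edges G"
    and "\<And>i. Q i 0 \<Longrightarrow> Q' (Suc i) 0" "\<And>i j. Q i (Suc j) \<Longrightarrow> Q' i j"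
  shows "x * s e \<in> mspan Q'"
proof -
  have "1 * x * s e \<in> mspan Q'"
  proof (rule mspan_map[OF _ assms(1)])
    fix \<alpha> A \<beta> assume h: "set \<alpha> \<subseteq> edges G" "A \<in> gen_verts G" "set \<beta> \<subseteq> edges G"
      "Q (length \<alpha>) (length \<beta>)"
    show "1 * mon \<alpha> A \<beta> * s e \<in> mspan Q'"
      using h assms(2-) by (cases \<beta>)
        (auto simp: mon_s_Nil mon_s_Cons intro!: mspan_zero mspan_mon mspan_times_p gen_verts.range)
  qed
  then show ?thesis by simp
qed

fun gen_val :: "('v, 'e) lpa_gen \<Rightarrow> 'b" where
  "gen_val (GenP A) = p A"
| "gen_val (GenS e) = s e"
| "gen_val (GenSstar e) = t e"

end

fun gen_degree :: "('v, 'e) lpa_gen \<Rightarrow> int" where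
  "gen_degree (GenP A) = 0"
| "gen_degree (GenS e) = 1"
| "gen_degree (GenSstar e) = - 1"

context leavitt_family
begin

text \<open>Multiplying in one generator at a time from the left brings every word into the normal
  form \<open>mon\<close>. Single edges fit this form through \<open>s e = s e * p (rng G e)\<close>
  and its adjoint.\<close>

lemma word_val_mspan:
  assumes "w \<noteq> []" "set w \<subseteq> lpa_gens G"
  shows "prod_list (map gen_val w) \<in> mspan (\<lambda>i j. int i - int j = sum_list (map gen_degree w))"
  using assms
proof (induction w rule: list_nonempty_induct)
  case (single g)
  then consider A where "g = GenP A" "A \<in> gen_verts G" | e where "g = GenS e" "e \<in> edges G"
    | e where "g = GenSstar e" "e \<in> edges G"
    by (auto simp: lpa_gens_def)
  then show ?case
  proof cases
    case 1
    then show ?thesis by (simp add: mspan_p)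
  next
    case (2 e)
    then have "mon [e] (rng G e) [] \<in> mspan (\<lambda>i j. int i - int j = 1)"
      by (intro mspan_mon gen_verts.range) auto
    then show ?thesis using 2 by (simp add: mon_def s_p_rng)
  next
    case (3 e)
    then have "mon [] (rng G e) [e] \<in> mspan (\<lambda>i j. int i - int j = - 1)"
      by (intro mspan_mon gen_verts.range) auto
    then show ?thesis using 3 by (simp add: mon_def p_rng_t)
  qed
next
  case (cons g w)
  then have w: "prod_list (map gen_val w) \<in> mspan (\<lambda>i j. int i - int j = sum_list (map gen_degree w))"
    by simp
  consider A where "g = GenP A" "A \<in> gen_verts G" | e where "g = GenS e" "e \<in> edges G"
    | e where "g = GenSstar e" "e \<in> edges G"
    using cons.prems by (auto simp: lpa_gens_def)
  then show ?case
  proof cases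
    case 1
    then show ?thesis using p_mspan[OF w] by simp
  next
    case (2 e)
    then show ?thesis using s_mspan[OF w, of e] by simp
  next
    case (3 e)
    then show ?thesis using t_mspan[OF w, of e] by simp
  qed
qed

end

section \<open>Ideals without homogeneous elements\<close>

text \<open>\<open>I\<close> stands for the image of an ideal under an embedding that need not be
  onto, so absorption is required against generators only. The last assumption is the effect of
  dividing by the homogeneous elements.\<close>

locale leavitt_family_ideal = leavitt_family G \<kappa> p s t
  for G :: "('v, 'e) pre_ultragraph" and \<kappa> :: "'k::field \<Rightarrow> 'b::ring_1" and p s t +
  fixes I :: "'b set"
  assumes I_zero: "0 \<in> I"
    and I_add: "x \<in> I \<Longrightarrow> y \<in> I \<Longrightarrow> x + y \<in> I"
    and I_scale: "x \<in> I \<Longrightarrow> \<kappa> c * x \<in> I"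
    and I_left: "x \<in> I \<Longrightarrow> g \<in> lpa_gens G \<Longrightarrow> gen_val g * x \<in> I"
    and I_right: "x \<in> I \<Longrightarrow> g \<in> lpa_gens G \<Longrightarrow> x * gen_val g \<in> I"
    and I_homogeneous: "x \<in> I \<Longrightarrow> x \<in> mspan (\<lambda>i j. int i - int j = n) \<Longrightarrow> x = 0"
begin

abbreviation hom_part :: "int \<Rightarrow> 'b set" where
  "hom_part n \<equiv> mspan (\<lambda>i j. int i - int j = n)"

abbreviation off_part :: "int \<Rightarrow> 'b set" where
  "off_part n \<equiv> mspan (\<lambda>i j. int i - int j \<noteq> n)"

lemma I_p: "x \<in> I \<Longrightarrow> A \<in> gen_verts G \<Longrightarrow> p A * x \<in> I" "x \<in> I \<Longrightarrow> A \<in> gen_verts G \<Longrightarrow> x * p A \<in> I"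
  using I_left[of x "GenP A"] I_right[of x "GenP A"] by (auto simp: lpa_gens_def)

lemma I_s: "x \<in> I \<Longrightarrow> e \<in> edges G \<Longrightarrow> s e * x \<in> I" "x \<in> I \<Longrightarrow> e \<in> edges G \<Longrightarrow> x * s e \<in> I"
  using I_left[of x "GenS e"] I_right[of x "GenS e"] by (auto simp: lpa_gens_def)

lemma I_t: "x \<in> I \<Longrightarrow> e \<in> edges G \<Longrightarrow> t e * x \<in> I" "x \<in> I \<Longrightarrow> e \<in> edges G \<Longrightarrow> x * t e \<in> I"
  using I_left[of x "GenSstar e"] I_right[of x "GenSstar e"] by (auto simp: lpa_gens_def)

lemma I_sp:
  assumes "x \<in> I" "set \<alpha> \<subseteq> edges G"
  shows "sp \<alpha> * x \<in> I" "x * sp \<alpha> \<in> I"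
proof -
  show "sp \<alpha> * x \<in> I"
    using assms by (induction \<alpha> arbitrary: x) (auto simp: mult.assoc I_s)
  show "x * sp \<alpha> \<in> I"
    using assms by (induction \<alpha> arbitrary: x) (auto simp: mult.assoc[symmetric] I_s)
qed

lemma I_tp:
  assumes "x \<in> I" "set \<alpha> \<subseteq> edges G"
  shows "tp \<alpha> * x \<in> I" "x * tp \<alpha> \<in> I"
proof -
  show "tp \<alpha> * x \<in> I"
    using assms by (induction \<alpha> arbitrary: x) (auto simp: mult.assoc I_t)
  show "x * tp \<alpha> \<in> I"
    using assms by (induction \<alpha> arbitrary: x) (auto simp: mult.assoc[symmetric] I_t)
qed

lemma I_mspan:
  assumes "y \<in> mspan Q" "x \<in> I"
  shows "y * x \<in> I" "x * y \<in> I"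
proof -
  have mon: "mon \<alpha> A \<beta> * x \<in> I \<and> x * mon \<alpha> A \<beta> \<in> I"
    if "set \<alpha> \<subseteq> edges G" "A \<in> gen_verts G" "set \<beta> \<subseteq> edges G" for \<alpha> A \<beta>
  proof
    show "mon \<alpha> A \<beta> * x \<in> I"
      using assms(2) that by (simp add: mon_def mult.assoc I_sp(1) I_tp(1) I_p(1))
    show "x * mon \<alpha> A \<beta> \<in> I"
      using assms(2) that by (simp add: mon_def mult.assoc[symmetric] I_sp(2) I_tp(2) I_p(2))
  qed
  from assms(1) have "y * x \<in> I \<and> x * y \<in> I"
    by (induction rule: mspan_induct)
      (auto simp: I_zero distrib_left distrib_right mult.assoc \<kappa>_left_comm mon[simplified mult.assoc]
        intro!: I_add I_scale)
  then show "y * x \<in> I" "x * y \<in> I" by auto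
qed

text \<open>The possible components of degree \<open>n\<close> of elements of \<open>I\<close>, presented without using that the
  components are independent.\<close>

definition W :: "int \<Rightarrow> 'b set" where
  "W n = {y \<in> hom_part n. \<exists>x \<in> I. x - y \<in> off_part n}"

lemma W_scale: "y \<in> W n \<Longrightarrow> \<kappa> c * y \<in> W n"
proof -
  assume "y \<in> W n"
  then obtain x where x: "x \<in> I" "x - y \<in> off_part n" "y \<in> hom_part n" by (auto simp: W_def)
  then show ?thesis
    using I_scale[OF x(1), of c] mspan_scale[OF x(2), of c] mspan_scale[OF x(3), of c]
    unfolding W_def by (auto simp: right_diff_distrib)
qed

lemma W_unscale: "\<kappa> c * y \<in> W n \<Longrightarrow> c \<noteq> 0 \<Longrightarrow> y \<in> W n"
  using W_scale[of "\<kappa> c * y" n "inverse c"] by (simp add: \<kappa>_cancel)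

lemma p_W: "y \<in> W n \<Longrightarrow> A \<in> gen_verts G \<Longrightarrow> p A * y \<in> W n"
proof -
  assume y: "y \<in> W n" and A: "A \<in> gen_verts G"
  obtain x where x: "x \<in> I" "x - y \<in> off_part n" "y \<in> hom_part n" using y by (auto simp: W_def)
  then show ?thesis
    using I_p(1)[OF x(1) A] p_mspan[OF x(2) A] p_mspan[OF x(3) A]
    unfolding W_def by (auto simp: right_diff_distrib)
qed

lemma t_W:
  assumes "y \<in> W n" "e \<in> edges G"
  shows "t e * y \<in> W (n - 1)"
proof -
  obtain x where x: "x \<in> I" "x - y \<in> off_part n" using assms by (auto simp: W_def)
  have "t e * y \<in> hom_part (n - 1)"
    by (rule t_mspan[of y "\<lambda>i j. int i - int j = n"]) (use assms in \<open>auto simp: W_def\<close>)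
  moreover have "t e * (x - y) \<in> off_part (n - 1)"
    by (rule t_mspan[of _ "\<lambda>i j. int i - int j \<noteq> n"]) (use assms x in auto)
  ultimately show ?thesis
    using I_t(1)[OF x(1) assms(2)] by (auto simp: W_def right_diff_distrib)
qed

lemma W_s:
  assumes "y \<in> W n" "e \<in> edges G"
  shows "y * s e \<in> W (n + 1)"
proof -
  obtain x where x: "x \<in> I" "x - y \<in> off_part n" using assms by (auto simp: W_def)
  have "y * s e \<in> hom_part (n + 1)"
    by (rule mspan_times_s[of y "\<lambda>i j. int i - int j = n"]) (use assms in \<open>auto simp: W_def\<close>)
  moreover have "(x - y) * s e \<in> off_part (n + 1)"
    by (rule mspan_times_s[of _ "\<lambda>i j. int i - int j \<noteq> n"]) (use assms x in auto)
  ultimately show ?thesis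
    using I_s(2)[OF x(1) assms(2)] by (auto simp: W_def left_diff_distrib)
qed

section \<open>Finite source projections and idempotents of degree zero\<close>

definition source_proj :: "'e set \<Rightarrow> 'b" where "source_proj F = (\<Sum>e\<in>F. s e * t e)"

lemma source_proj_s:
  assumes "finite F" "F \<subseteq> edges G" "e \<in> edges G"
  shows "source_proj F * s e = (if e \<in> F then s e else 0)"
proof -
  have "source_proj F * s e = (\<Sum>f\<in>F. if f = e then s e else 0)"
    unfolding source_proj_def sum_distrib_right
    by (rule sum.cong) (use assms in \<open>auto simp: mult.assoc t_s s_p_rng\<close>)
  then show ?thesis using assms by simp
qed

lemma t_source_proj:
  assumes "finite F" "F \<subseteq> edges G" "e \<in> edges G"
  shows "t e * source_proj F = (if e \<in> F then t e else 0)"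
proof -
  have "t e * source_proj F = (\<Sum>f\<in>F. if f = e then t e else 0)"
    unfolding source_proj_def sum_distrib_left
    by (rule sum.cong) (use assms in \<open>auto simp: mult.assoc[symmetric] t_s p_rng_t\<close>)
  then show ?thesis using assms by simp
qed

lemma source_proj_idem:
  assumes "finite F" "F \<subseteq> edges G"
  shows "source_proj F * source_proj F = source_proj F"
proof -
  have "source_proj F * source_proj F = (\<Sum>f\<in>F. (source_proj F * s f) * t f)"
    by (subst (2) source_proj_def) (simp add: sum_distrib_left mult.assoc)
  also have "\<dots> = source_proj F"
    unfolding source_proj_def[of F]
    by (rule sum.cong) (use assms source_proj_s[of F] in \<open>auto simp: source_proj_def\<close>)
  finally show ?thesis .
qed

lemma p_source_proj_comm:
  assumes "A \<in> gen_verts G" "finite F" "F \<subseteq> edges G"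
  shows "p A * source_proj F = source_proj F * p A"
  unfolding source_proj_def sum_distrib_left sum_distrib_right
proof (rule sum.cong)
  fix e assume "e \<in> F"
  then have e: "e \<in> edges G" using assms by auto
  have "p A * (s e * t e) = (p A * s e) * t e" "s e * t e * p A = s e * (t e * p A)"
    by (simp_all add: mult.assoc)
  then show "p A * (s e * t e) = s e * t e * p A" using p_s[OF assms(1) e] t_p[OF assms(1) e] by simp
qed simp

text \<open>An element of the span involves finitely many leading edges, which form
  \<open>F\<close>. Stating the conclusion for all larger finite sets lets one set serve on the left
  and on the right.\<close>

lemma source_proj_left:
  assumes "y \<in> lspan \<kappa> {s e * z |e z. e \<in> edges G}"
  shows "\<exists>F. finite F \<and> F \<subseteq> edges G \<and>
    (\<forall>F'. finite F' \<longrightarrow> F \<subseteq> F' \<longrightarrow> F' \<subseteq> edges G \<longrightarrow> source_proj F' * y = y)"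
  using assms
proof induction
  case zero
  then show ?case by (intro exI[of _ "{}"]) auto
next
  case (step x y c)
  then obtain e z F where "e \<in> edges G" "x = s e * z" "finite F" "F \<subseteq> edges G"
    "\<And>F'. finite F' \<Longrightarrow> F \<subseteq> F' \<Longrightarrow> F' \<subseteq> edges G \<Longrightarrow> source_proj F' * y = y"
    by auto
  moreover have "source_proj F' * (s e * z) = s e * z"
    if "finite F'" "insert e F \<subseteq> F'" "F' \<subseteq> edges G" for F'
    using source_proj_s[of F' e] that \<open>e \<in> edges G\<close> by (simp add: mult.assoc[symmetric])
  ultimately show ?case
    by (intro exI[of _ "insert e F"]) (simp add: distrib_left \<kappa>_left_comm)
qed

lemma source_proj_right:
  assumes "y \<in> lspan \<kappa> {z * t e |e z. e \<in> edges G}"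
  shows "\<exists>F. finite F \<and> F \<subseteq> edges G \<and>
    (\<forall>F'. finite F' \<longrightarrow> F \<subseteq> F' \<longrightarrow> F' \<subseteq> edges G \<longrightarrow> y * source_proj F' = y)"
  using assms
proof induction
  case zero
  then show ?case by (intro exI[of _ "{}"]) auto
next
  case (step x y c)
  then obtain e z F where "e \<in> edges G" "x = z * t e" "finite F" "F \<subseteq> edges G"
    "\<And>F'. finite F' \<Longrightarrow> F \<subseteq> F' \<Longrightarrow> F' \<subseteq> edges G \<Longrightarrow> y * source_proj F' = y"
    by auto
  then show ?case
    by (intro exI[of _ "insert e F"]) (auto simp: distrib_right mult.assoc t_source_proj)
qed

lemma killed_by_edges_zero:
  assumes "u \<in> W 0" "u * u = u" and kill: "\<And>e. e \<in> edges G \<Longrightarrow> u * s e = 0 \<and> t e * u = 0"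
  shows "u = 0"
proof -
  obtain x where x: "x \<in> I" "x - u \<in> off_part 0" and u: "u \<in> hom_part 0"
    using assms(1) by (auto simp: W_def)
  from x(2) have "u * (x - u) * u = 0"
  proof (induction rule: mspan_induct)
    case (step \<alpha> A \<beta> y c)
    \<comment> \<open>The lengths differ, so \<alpha> and \<beta> are not both empty; a nonempty one
      puts an edge next to \<open>u\<close>, which kills it.\<close>
    have "u * mon \<alpha> A \<beta> * u = 0"
    proof (cases \<alpha>)
      case Nil
      then obtain f \<beta>' where \<beta>: "\<beta> = f # \<beta>'" using step by (cases \<beta>) auto
      show ?thesis using kill[of f] step \<beta> by (simp add: mon_def mult.assoc)
    next
      case (Cons e \<alpha>')
      then show ?thesis using kill[of e] step by (simp add: mon_def mult.assoc[symmetric])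
    qed
    then show ?case using step by (simp add: distrib_left distrib_right \<kappa>_left_comm mult.assoc)
  qed simp
  then have "u * x * u = u"
    using assms(2) by (simp add: right_diff_distrib left_diff_distrib)
  moreover have "u * x * u \<in> I" using I_mspan[OF u] x(1) by blast
  ultimately show ?thesis using I_homogeneous[of u 0] u by simp
qed

text \<open>A combination of vertex projections is constant on each cell of the partition generated
  by the sets occurring in it. Induction on \<open>q\<close> refines \<open>B\<close> by one set
  \<open>A\<close> at a time, into \<open>B \<inter> A\<close> and \<open>B - A\<close>, so the
  cells need not be named.\<close>

lemma vertex_span_decompose:
  assumes "q \<in> lspan \<kappa> (p ` gen_verts G)" "B \<in> gen_verts G"
    and "\<And>A. A \<in> gen_verts G \<Longrightarrow> A \<subseteq> B \<Longrightarrow> \<exists>c. p A * q = \<kappa> c * p A \<Longrightarrow> p A * z = 0"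
  shows "p B * z = 0"
  using assms
proof (induction arbitrary: B)
  case zero
  have "\<exists>c. p B * 0 = \<kappa> c * p B" by (rule exI[of _ 0]) (simp add: \<kappa>_zero)
  then show ?case using zero by blast
next
  case (step x y c)
  obtain A where A: "A \<in> gen_verts G" "x = p A" using step by auto
  have "p (B \<inter> A) * z = 0"
  proof (rule step.IH)
    fix A' assume A': "A' \<in> gen_verts G" "A' \<subseteq> B \<inter> A" "\<exists>c. p A' * y = \<kappa> c * p A'"
    then obtain d where d: "p A' * y = \<kappa> d * p A'" by auto
    have "A' \<inter> A = A'" using A' by auto
    then have "p A' * p A = p A'" using p_mult[OF A'(1) A(1)] by simp
    then have "p A' * (\<kappa> c * x + y) = \<kappa> (c + d) * p A'"
      using d A by (simp add: distrib_left \<kappa>_left_comm \<kappa>_add distrib_right)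
    then show "p A' * z = 0" using step.prems(2)[of A'] A' by blast
  qed (rule gen_verts.inter[OF step.prems(1) A(1)])
  moreover have "p (B - A) * z = 0"
  proof (rule step.IH)
    fix A' assume A': "A' \<in> gen_verts G" "A' \<subseteq> B - A" "\<exists>c. p A' * y = \<kappa> c * p A'"
    then obtain d where d: "p A' * y = \<kappa> d * p A'" by auto
    have "A' \<inter> A = {}" using A' by auto
    then have "p A' * p A = 0" using p_mult[OF A'(1) A(1)] p_empty by simp
    then have "p A' * (\<kappa> c * x + y) = \<kappa> d * p A'"
      using d A by (simp add: distrib_left \<kappa>_left_comm)
    then show "p A' * z = 0" using step.prems(2)[of A'] A' by blast
  qed (rule gen_verts.diff[OF step.prems(1) A(1)])
  ultimately show ?case
    using p_split[OF step.prems(1) A(1)] by (simp add: distrib_right)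
qed

lemma vertex_span_unit:
  assumes "q \<in> lspan \<kappa> (p ` gen_verts G)"
  shows "\<exists>B\<in>gen_verts G. p B * q = q"
  using assms
proof induction
  case zero
  then show ?case by (auto intro: gen_verts.empty)
next
  case (step x y c)
  then obtain A B where A: "A \<in> gen_verts G" "x = p A" and B: "B \<in> gen_verts G" "p B * y = y" by auto
  have AB: "A \<union> B \<in> gen_verts G" using A B gen_verts.union by auto
  have "(A \<union> B) \<inter> A = A" "(A \<union> B) \<inter> B = B" by auto
  then have "p (A \<union> B) * p A = p A" "p (A \<union> B) * p B = p B"
    using p_mult[OF AB A(1)] p_mult[OF AB B(1)] by simp_all
  then have "p (A \<union> B) * (\<kappa> c * x + y) = \<kappa> c * x + y"
    using A B by (simp add: distrib_left \<kappa>_left_comm) (metis mult.assoc)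
  then show ?case using AB by blast
qed

text \<open>Write \<open>y = q + w\<close>, where \<open>q\<close> collects the vertex projections
  and every term of \<open>w\<close> starts and ends in an edge. If \<open>P\<close> is the source
  projection of the edges occurring there, \<open>cut\<close> gives \<open>P * y * P = 0\<close>,
  hence \<open>y = q - P * q * P\<close>. On a set \<open>A\<close> where \<open>q\<close> acts as a
  scalar, this is a multiple of \<open>p A - P * p A\<close>.\<close>

lemma degree_zero_cut:
  assumes y: "y \<in> W 0" "y \<in> mspan (\<lambda>i j. i = j)"
    and cut: "\<And>e f. e \<in> edges G \<Longrightarrow> f \<in> edges G \<Longrightarrow> t e * y * s f = 0"
  shows "y = 0"
proof -
  let ?V = "p ` gen_verts G" and ?M = "{s e * z * t f |e z f. e \<in> edges G \<and> f \<in> edges G}"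
  have "y \<in> lspan \<kappa> (?V \<union> ?M)"
  proof (rule lspan_mono[OF _ y(2)[unfolded mspan_def]], rule subsetI)
    fix m assume "m \<in> {mon \<alpha> A \<beta> |\<alpha> A \<beta>. set \<alpha> \<subseteq> edges G \<and> A \<in> gen_verts G \<and>
      set \<beta> \<subseteq> edges G \<and> length \<alpha> = length \<beta>}"
    then obtain \<alpha> A \<beta> where h: "m = mon \<alpha> A \<beta>" "set \<alpha> \<subseteq> edges G" "A \<in> gen_verts G"
      "set \<beta> \<subseteq> edges G" "length \<alpha> = length \<beta>" by auto
    show "m \<in> ?V \<union> ?M"
    proof (cases \<alpha>)
      case Nil
      then show ?thesis using h by (simp add: mon_def)
    next
      case (Cons e \<alpha>')
      then obtain f \<beta>' where \<beta>: "\<beta> = f # \<beta>'" using h by (cases \<beta>) auto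
      have "m = s e * mon \<alpha>' A \<beta>' * t f" using h(1) Cons \<beta> by (simp add: mon_def mult.assoc)
      then have "m \<in> ?M" using h(2,4) Cons \<beta>
        by (intro CollectI exI[of _ e] exI[of _ "mon \<alpha>' A \<beta>'"] exI[of _ f]) simp
      then show ?thesis by blast
    qed
  qed
  then obtain q w where q: "q \<in> lspan \<kappa> ?V" and w: "w \<in> lspan \<kappa> ?M" and yqw: "y = q + w"
    using lspan_Un by blast
  have "?M \<subseteq> {s e * z |e z. e \<in> edges G}"
  proof clarify
    fix e z f assume "e \<in> edges G"
    then show "\<exists>e' z'. s e * z * t f = s e' * z' \<and> e' \<in> edges G"
      by (intro exI[of _ e] exI[of _ "z * t f"]) (simp add: mult.assoc)
  qed
  moreover have "?M \<subseteq> {z * t e |e z. e \<in> edges G}" by blast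
  ultimately have "w \<in> lspan \<kappa> {s e * z |e z. e \<in> edges G}" "w \<in> lspan \<kappa> {z * t e |e z. e \<in> edges G}"
    by (auto intro: lspan_mono[OF _ w])
  note w_left = source_proj_left[OF this(1)] and w_right = source_proj_right[OF this(2)]
  from w_left obtain F1 where F1: "finite F1" "F1 \<subseteq> edges G"
    "\<forall>F'. finite F' \<longrightarrow> F1 \<subseteq> F' \<longrightarrow> F' \<subseteq> edges G \<longrightarrow> source_proj F' * w = w"
    by (elim exE conjE)
  from w_right obtain F2 where F2: "finite F2" "F2 \<subseteq> edges G"
    "\<forall>F'. finite F' \<longrightarrow> F2 \<subseteq> F' \<longrightarrow> F' \<subseteq> edges G \<longrightarrow> w * source_proj F' = w"
    by (elim exE conjE)
  \<comment> \<open>One projection must fix \<open>w\<close> from both sides; the union works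
    because both choices remain valid for larger sets.\<close>
  define F where "F = F1 \<union> F2"
  define P where "P = source_proj F"
  have F: "finite F" "F \<subseteq> edges G" and w: "P * w = w" "w * P = w"
    unfolding F_def P_def using F1 F2 by simp_all
  have PP: "P * P = P" unfolding P_def by (rule source_proj_idem[OF F])
  have "P * y * P = (\<Sum>e\<in>F. \<Sum>f\<in>F. s e * (t e * y * s f) * t f)"
  proof -
    have "P * y * P = (\<Sum>e\<in>F. s e * (t e * y) * P)"
      by (simp add: P_def source_proj_def sum_distrib_right mult.assoc)
    also have "\<dots> = (\<Sum>e\<in>F. \<Sum>f\<in>F. s e * (t e * y * s f) * t f)"
      by (rule sum.cong) (simp_all add: P_def source_proj_def sum_distrib_left mult.assoc)
    finally show ?thesis .
  qed
  also have "\<dots> = 0" using cut F by (intro sum.neutral ballI) (auto simp: subset_iff)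
  finally have "P * q * P + w = 0"
    using w by (simp add: yqw distrib_left distrib_right mult.assoc)
  then have "w = - (P * q * P)" by (rule iffD1[OF add_eq_0_iff])
  then have yP: "y = q - P * q * P" using yqw by (metis add_uminus_conv_diff)
  obtain B where B: "B \<in> gen_verts G" "p B * q = q" using vertex_span_unit[OF q] by blast
  have comm: "p A * (P * z) = P * (p A * z)" if "A \<in> gen_verts G" for A z
    using p_source_proj_comm[OF that F] unfolding P_def by (simp add: mult.assoc[symmetric])
  have "p B * (q * z) = q * z" for z using B(2) by (simp add: mult.assoc[symmetric])
  then have "p B * y = y" unfolding yP using B comm by (simp add: right_diff_distrib mult.assoc)
  moreover have "p B * y = 0"
  proof (rule vertex_span_decompose[OF q B(1)])
    fix A assume A: "A \<in> gen_verts G" and "\<exists>c. p A * q = \<kappa> c * p A"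
    then obtain c where c: "p A * q = \<kappa> c * p A" by blast
    have pA: "p A * p A = p A" using p_mult[OF A A] by simp
    have PA: "p A * P = P * p A" unfolding P_def by (rule p_source_proj_comm[OF A F])
    have r: "p A * (p A * z) = p A * z" "P * (P * z) = P * z" for z
      using pA PP by (simp_all add: mult.assoc[symmetric])
    \<comment> \<open>\<open>P\<close> commutes with \<open>p A\<close>, so \<open>u\<close> is
      idempotent: the part of \<open>p A\<close> orthogonal to the edges in
      \<open>F\<close>.\<close>
    define u where "u = p A - P * p A"
    have "p A * y = p A * q - P * (p A * q) * P"
      unfolding yP by (simp add: right_diff_distrib mult.assoc comm[OF A])
    also have "\<dots> = \<kappa> c * u"
      unfolding c u_def by (simp add: right_diff_distrib \<kappa>_left_comm mult.assoc PA r)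
    finally have yu: "p A * y = \<kappa> c * u" .
    show "p A * y = 0"
    proof (cases "c = 0")
      case True
      then show ?thesis using yu by (simp add: \<kappa>_zero)
    next
      case False
      have "u \<in> W 0" using p_W[OF y(1) A] W_unscale[OF _ False] unfolding yu by blast
      moreover have "u * u = u"
        unfolding u_def by (simp add: left_diff_distrib right_diff_distrib mult.assoc comm[OF A] r pA PA)
      moreover have "u * s g = 0 \<and> t g * u = 0" if g: "g \<in> edges G" for g
      proof -
        have us: "u * s g = p A * s g - p A * (P * s g)"
          unfolding u_def PA[symmetric] by (simp add: left_diff_distrib mult.assoc)
        have tu: "t g * u = t g * p A - (t g * P) * p A"
          unfolding u_def by (simp add: right_diff_distrib mult.assoc)
        have Pg: "P * s g = (if g \<in> F then s g else 0)" "t g * P = (if g \<in> F then t g else 0)"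
          unfolding P_def using source_proj_s[OF F g] t_source_proj[OF F g] by auto
        have pg: "p A * s g = (if src G g \<in> A then s g else 0)" "t g * p A = (if src G g \<in> A then t g else 0)"
          using p_s[OF A g] t_p[OF A g] by auto
        show ?thesis
        proof (cases "src G g \<in> A \<and> g \<notin> F")
          case True
          \<comment> \<open>An edge \<open>g\<close> outside \<open>F\<close> that starts in
            \<open>A\<close> is fixed by \<open>u\<close>, so the vanishing of
            \<open>t g * y * s g\<close> says that \<open>c\<close> times its range projection is
            zero. As \<open>c\<close> is invertible, the edge itself is zero.\<close>
          then have usg: "u * s g = s g" using us Pg pg by simp
          have "0 = t g * y * s g" using cut[OF g g] by simp
          also have "\<dots> = t g * (p A * y) * s g" using pg True by (simp add: mult.assoc[symmetric])
          also have "\<dots> = \<kappa> c * (t g * (u * s g))" unfolding yu by (simp add: \<kappa>_left_comm mult.assoc)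
          also have "\<dots> = \<kappa> c * p (rng G g)" using usg g by (simp add: t_s)
          finally have "p (rng G g) = 0" using \<kappa>_eq_0[OF _ False] by simp
          then have "s g = 0" "t g = 0" using s_p_rng[OF g] p_rng_t[OF g] by auto
          then show ?thesis by simp
        next
          case False
          then show ?thesis unfolding us tu Pg using pg by auto
        qed
      qed
      ultimately have "u = 0" using killed_by_edges_zero by blast
      then show ?thesis using yu by simp
    qed
  qed
  ultimately show ?thesis by simp
qed

text \<open>Compression by \<open>t e\<close> and \<open>s f\<close> lowers the bound on the
  lengths, and by \<open>degree_zero_cut\<close> some compression of a nonzero element is nonzero.
  When the bound is 0, a combination of vertex projections remains, and restricting it to a cell
  with nonzero coefficient isolates one projection.\<close>

lemma degree_zero_reduction:
  assumes "y \<in> W 0" "y \<in> mspan (\<lambda>i j. i = j \<and> i \<le> N)" "y \<noteq> 0"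
  shows "\<exists>A\<in>gen_verts G. p A \<in> W 0 \<and> p A \<noteq> 0"
  using assms
proof (induction N arbitrary: y)
  case 0
  have "y \<in> lspan \<kappa> (p ` gen_verts G)"
  proof (rule lspan_mono[OF _ 0(2)[unfolded mspan_def]], rule subsetI)
    fix m assume "m \<in> {mon \<alpha> A \<beta> |\<alpha> A \<beta>. set \<alpha> \<subseteq> edges G \<and> A \<in> gen_verts G \<and>
      set \<beta> \<subseteq> edges G \<and> length \<alpha> = length \<beta> \<and> length \<alpha> \<le> 0}"
    then obtain A where "A \<in> gen_verts G" "m = mon [] A []" by auto
    then show "m \<in> p ` gen_verts G" by (simp add: mon_def)
  qed
  then obtain B where B: "B \<in> gen_verts G" "p B * y = y" and q: "y \<in> lspan \<kappa> (p ` gen_verts G)"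
    using vertex_span_unit by blast
  have "\<exists>A\<in>gen_verts G. (\<exists>c. p A * y = \<kappa> c * p A) \<and> p A * y \<noteq> 0"
  proof (rule ccontr)
    assume "\<not> ?thesis"
    then have "p B * y = 0" by (intro vertex_span_decompose[OF q B(1)]) blast
    then show False using B(2) 0(3) by simp
  qed
  then obtain A c where A: "A \<in> gen_verts G" "p A * y = \<kappa> c * p A" "p A * y \<noteq> 0" by blast
  then have "c \<noteq> 0" "p A \<noteq> 0" by (auto simp: \<kappa>_zero)
  moreover have "\<kappa> c * p A \<in> W 0" using p_W[OF 0(1) A(1)] A(2) by simp
  ultimately show ?case using W_unscale A(1) by blast
next
  case (Suc N)
  show ?case
  proof (cases "\<exists>e\<in>edges G. \<exists>f\<in>edges G. t e * y * s f \<noteq> 0")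
    case True
    then obtain e f where e: "e \<in> edges G" "f \<in> edges G" "t e * y * s f \<noteq> 0" by auto
    have "t e * y \<in> mspan (\<lambda>i j. j = Suc i \<and> i \<le> N)"
      by (rule t_mspan[OF Suc(3) e(1)]) auto
    then have "t e * y * s f \<in> mspan (\<lambda>i j. i = j \<and> i \<le> N)"
      by (rule mspan_times_s[OF _ e(2)]) auto
    moreover have "t e * y * s f \<in> W 0" using W_s[OF t_W[OF Suc(2) e(1)] e(2)] by simp
    ultimately show ?thesis using Suc.IH e(3) by blast
  next
    case False
    then show ?thesis using degree_zero_cut[OF Suc(2) mspan_mono[OF Suc(3)]] Suc(4) by blast
  qed
qed


text \<open>If all edges starting in \<open>A\<close> had zero source projection, every edge would
  annihilate \<open>p A\<close>, which \<open>killed_by_edges_zero\<close> forbids.\<close>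

lemma W_zero_vertex:
  assumes "A \<in> gen_verts G" "p A \<in> W 0" "p A \<noteq> 0"
  shows "\<exists>v\<in>A. v \<in> verts G \<and> p {v} \<in> W 0 \<and> p {v} \<noteq> 0"
proof -
  have "\<exists>e\<in>edges G. src G e \<in> A \<and> p {src G e} \<noteq> 0"
  proof (rule ccontr)
    assume no: "\<not> ?thesis"
    have "p A * s e = 0 \<and> t e * p A = 0" if e: "e \<in> edges G" for e
    proof (cases "src G e \<in> A")
      case True
      then have "p {src G e} = 0" using no e by auto
      then show ?thesis using p_src_s[OF e] t_p_src[OF e] by (metis mult_zero_left mult_zero_right)
    qed (use e assms in \<open>simp add: p_s t_p\<close>)
    then have "p A = 0" using killed_by_edges_zero[OF assms(2)] p_mult[OF assms(1,1)] by simp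
    then show False using assms by simp
  qed
  then obtain e where e: "e \<in> edges G" "src G e \<in> A" "p {src G e} \<noteq> 0" by blast
  have "{src G e} \<inter> A = {src G e}" using e by auto
  then have "p {src G e} \<in> W 0"
    using p_W[OF assms(2) src_gen[OF e(1)]] p_mult[OF src_gen[OF e(1)] assms(1)] by simp
  then show ?thesis using e src_in_verts by blast
qed

section \<open>Following edges from vertices whose projections lie in \<open>W 0\<close>\<close>

definition good :: "'v \<Rightarrow> bool" where
  "good v \<longleftrightarrow> v \<in> verts G \<and> p {v} \<in> W 0 \<and> p {v} \<noteq> 0"

text \<open>Some edge at \<open>v\<close> does not annihilate \<open>p {v}\<close>. Compression by
  this edge turns \<open>p {v}\<close> into the projection of its range, which is again in
  \<open>W 0\<close> and nonzero and therefore yields the next vertex.\<close>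

lemma good_step:
  assumes "good v"
  shows "\<exists>e\<in>edges G. src G e = v \<and> (\<exists>w\<in>rng G e. good w)"
proof -
  have v: "v \<in> verts G" "p {v} \<in> W 0" "p {v} \<noteq> 0" "{v} \<in> gen_verts G"
    using assms gen_verts.vertex[of v G] by (auto simp: good_def)
  have "\<exists>e\<in>edges G. p {v} * s e \<noteq> 0 \<or> t e * p {v} \<noteq> 0"
    using killed_by_edges_zero[OF v(2)] p_mult[OF v(4,4)] v(3) by auto
  then obtain e where e: "e \<in> edges G" "p {v} * s e \<noteq> 0 \<or> t e * p {v} \<noteq> 0" by blast
  then have src: "src G e = v" and ne: "s e \<noteq> 0 \<or> t e \<noteq> 0"
    using p_s[OF v(4) e(1)] t_p[OF v(4) e(1)] by (auto split: if_splits)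
  have r: "rng G e \<in> gen_verts G" using e(1) by (rule gen_verts.range)
  have "p (rng G e) \<noteq> 0"
    using ne s_p_rng[OF e(1)] p_rng_t[OF e(1)] by (metis mult_zero_left mult_zero_right)
  moreover have "t e * p {v} * s e \<in> W 0" using W_s[OF t_W[OF v(2) e(1)] e(1)] by simp
  then have "p (rng G e) \<in> W 0" using e src t_p_src[OF e(1)] by (simp add: t_s)
  ultimately show ?thesis using W_zero_vertex[OF r] e(1) src by (auto simp: good_def)
qed

lemma good_path:
  assumes "good v"
  shows "\<exists>\<gamma>. length \<gamma> = Suc n \<and> edge_path G \<gamma> \<and> src G (hd \<gamma>) = v \<and>
    (\<forall>e\<in>set \<gamma>. good (src G e)) \<and> (\<exists>w\<in>rng G (last \<gamma>). good w)"
  using assms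
proof (induction n arbitrary: v)
  case 0
  then obtain e where "e \<in> edges G" "src G e = v" "\<exists>w\<in>rng G e. good w" using good_step by blast
  then show ?case using 0 by (intro exI[of _ "[e]"]) (auto simp: edge_path_Cons)
next
  case (Suc n)
  then obtain e w where e: "e \<in> edges G" "src G e = v" "w \<in> rng G e" "good w" using good_step by blast
  obtain \<gamma> where "length \<gamma> = Suc n" "edge_path G \<gamma>" "src G (hd \<gamma>) = w"
    "\<forall>e\<in>set \<gamma>. good (src G e)" "\<exists>w\<in>rng G (last \<gamma>). good w"
    using Suc.IH[OF e(4)] by blast
  then show ?case using e Suc.prems
    by (intro exI[of _ "e # \<gamma>"]) (auto simp: edge_path_Cons)
qed

text \<open>Once \<mu> and \<nu> have cancelled against prefixes of \<gamma>, the edges of \<gamma>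
  at positions |\<mu>| and |\<nu>| meet in the middle. They differ because \<gamma> repeats no edge,
  and the product vanishes.\<close>

lemma distinct_path_kills:
  assumes "edge_path G \<gamma>" "distinct \<gamma>" "length \<mu> < length \<gamma>" "length \<nu> < length \<gamma>"
    and "length \<mu> \<noteq> length \<nu>" "set \<mu> \<subseteq> edges G" "set \<nu> \<subseteq> edges G" "A \<in> gen_verts G"
  shows "tp \<gamma> * mon \<mu> A \<nu> * sp \<gamma> = 0"
proof -
  let ?i = "length \<mu>" and ?j = "length \<nu>"
  have E: "set (drop k \<gamma>) \<subseteq> edges G" for k
    using edge_path_edges[OF assms(1)] set_drop_subset[of k \<gamma>] by blast
  have g: "\<gamma> ! ?i \<in> edges G" "\<gamma> ! ?j \<in> edges G" using assms edge_path_edges by force+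
  have "\<gamma> ! ?i \<noteq> \<gamma> ! ?j" using assms by (simp add: nth_eq_iff_index_eq)
  then have ts: "t (\<gamma> ! ?i) * s (\<gamma> ! ?j) = 0" using g by (simp add: t_s)
  have tp: "tp (drop ?i \<gamma>) = tp (drop (Suc ?i) \<gamma>) * t (\<gamma> ! ?i)"
    and sp: "sp (drop ?j \<gamma>) = s (\<gamma> ! ?j) * sp (drop (Suc ?j) \<gamma>)"
    by (metis assms(3) Cons_nth_drop_Suc tp_simps(2)) (metis assms(4) Cons_nth_drop_Suc sp_simps(2))
  have "tp (drop ?i \<gamma>) * p A * sp (drop ?j \<gamma>) = 0"
  proof -
    have "tp (drop ?i \<gamma>) * sp (drop ?j \<gamma>) = tp (drop (Suc ?i) \<gamma>) * (t (\<gamma> ! ?i) * s (\<gamma> ! ?j)) * sp (drop (Suc ?j) \<gamma>)"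
      unfolding tp sp by (simp only: mult.assoc)
    then show ?thesis using tp_p[OF assms(8) E, of ?i] assms(3) ts by simp
  qed
  moreover have "tp \<gamma> * mon \<mu> A \<nu> * sp \<gamma> = (tp \<gamma> * sp \<mu>) * p A * (tp \<nu> * sp \<gamma>)"
    by (simp add: mon_def mult.assoc)
  ultimately show ?thesis
    using tp_sp_prefix[OF assms(1,6,3)] tp_prefix_sp[OF assms(1,7,4)] by auto
qed

lemma off_part_distinct_path:
  assumes "\<tau> \<in> off_part 0"
  shows "\<exists>N. \<forall>\<gamma>. edge_path G \<gamma> \<longrightarrow> distinct \<gamma> \<longrightarrow> N < length \<gamma> \<longrightarrow> tp \<gamma> * \<tau> * sp \<gamma> = 0"
  using assms
proof (induction rule: mspan_induct)
  case zero
  then show ?case by simp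
next
  case (step \<alpha> A \<beta> y c)
  then obtain N where N: "\<And>\<gamma>. edge_path G \<gamma> \<Longrightarrow> distinct \<gamma> \<Longrightarrow> N < length \<gamma> \<Longrightarrow> tp \<gamma> * y * sp \<gamma> = 0"
    by blast
  show ?case
  \<comment> \<open>A path longer than this sum exceeds both lists of the new monomial as well as
    the bound for \<open>y\<close>.\<close>
  proof (intro exI[of _ "N + length \<alpha> + length \<beta>"] allI impI)
    fix \<gamma> assume \<gamma>: "edge_path G \<gamma>" "distinct \<gamma>" "N + length \<alpha> + length \<beta> < length \<gamma>"
    have "tp \<gamma> * mon \<alpha> A \<beta> * sp \<gamma> = 0"
      by (rule distinct_path_kills) (use \<gamma> step in auto)
    moreover have "tp \<gamma> * y * sp \<gamma> = 0" using N \<gamma> by simp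
    ultimately show "tp \<gamma> * (\<kappa> c * mon \<alpha> A \<beta> + y) * sp \<gamma> = 0"
      by (simp add: distrib_left distrib_right \<kappa>_left_comm mult.assoc)
  qed
qed

text \<open>For unequal lengths a nonzero product requires the longer path to extend the shorter
  one. By the first-return property the remainder then starts away from \<open>v\<close>, and an
  outer \<open>p {v}\<close> kills it.\<close>

lemma first_return_orthogonal:
  assumes \<alpha>: "first_return_path_at G v \<alpha>" and \<beta>: "first_return_path_at G v \<beta>" and ne: "\<alpha> \<noteq> \<beta>"
    and v: "{v} \<in> gen_verts G"
  shows "p {v} * tp \<beta> * sp \<alpha> * p {v} = 0"
proof -
  have path: "edge_path G \<alpha>" "edge_path G \<beta>" "\<alpha> \<noteq> []" "\<beta> \<noteq> []"
    using \<alpha> \<beta> by (auto simp: first_return_path_at_def closed_path_at_def edge_path_def)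
  have E: "set \<alpha> \<subseteq> edges G" "set \<beta> \<subseteq> edges G" using path edge_path_edges by auto
  have E': "set (drop k \<alpha>) \<subseteq> edges G" "set (drop k \<beta>) \<subseteq> edges G" for k
    using E set_drop_subset by fast+
  consider "length \<alpha> = length \<beta>" | "length \<alpha> < length \<beta>" | "length \<beta> < length \<alpha>" by linarith
  then show ?thesis
  proof cases
    case 1
    then have "tp \<beta> * sp \<alpha> = 0" using tp_sp_distinct[of \<beta> \<alpha>] E ne by auto
    moreover have "p {v} * tp \<beta> * sp \<alpha> * p {v} = p {v} * (tp \<beta> * sp \<alpha>) * p {v}" by (simp add: mult.assoc)
    ultimately show ?thesis by simp
  next
    case 2
    have "src G (hd (drop (length \<alpha>) \<beta>)) \<noteq> v"
      using \<beta> 2 path by (simp add: first_return_path_at_def hd_drop_conv_nth Suc_le_eq)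
    then have "tp (drop (length \<alpha>) \<beta>) * p {v} = 0" using 2 by (simp add: tp_p[OF v E'(2)])
    then show ?thesis using tp_sp_prefix[OF path(2) E(1) 2] by (auto simp: mult.assoc)
  next
    case 3
    have "src G (hd (drop (length \<beta>) \<alpha>)) \<noteq> v"
      using \<alpha> 3 path by (simp add: first_return_path_at_def hd_drop_conv_nth Suc_le_eq)
    then have "p {v} * sp (drop (length \<beta>) \<alpha>) = 0" using 3 by (simp add: p_sp[OF v E'(1)])
    then have "p {v} * (tp \<beta> * sp \<alpha>) = 0" using tp_prefix_sp[OF path(1) E(2) 3] by auto
    then have "p {v} * (tp \<beta> * sp \<alpha>) * p {v} = 0" by simp
    then show ?thesis by (simp only: mult.assoc)
  qed
qed


lemma power_suffix:
  assumes "first_return_path_at G v \<alpha>" "v \<in> verts G"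
    and d: "d < length (concat (replicate m \<alpha>))" "src G (concat (replicate m \<alpha>) ! d) = v"
  shows "\<exists>l. drop d (concat (replicate m \<alpha>)) = \<alpha> @ concat (replicate l \<alpha>)"
proof -
  have "\<alpha> \<noteq> []" using assms by (auto simp: first_return_path_at_def closed_path_at_def edge_path_def)
  obtain k where k: "d = length \<alpha> * k"
    using first_return_power_source[OF assms(1), of d m] d by (auto simp: length_power)
  then have "k < m" using d \<open>\<alpha> \<noteq> []\<close> by (simp add: length_power mult.commute)
  then obtain l where "m - k = Suc l" by (metis Suc_diff_Suc)
  then show ?thesis using drop_power[of k \<alpha> m] k by (auto simp: mult.commute)
qed

lemma closed_path_absorb:
  assumes "closed_path_at G v \<gamma>" "v \<in> verts G"
  shows "p {v} * sp \<gamma> = sp \<gamma>" "tp \<gamma> * p {v} = tp \<gamma>"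
proof -
  have \<gamma>: "src G (hd \<gamma>) = v" "\<gamma> \<noteq> []" "set \<gamma> \<subseteq> edges G"
    using assms(1) edge_path_nonempty[of G \<gamma>] edge_path_edges[of G \<gamma>]
    unfolding closed_path_at_def by blast+
  have v: "{v} \<in> gen_verts G" using assms(2) by (rule gen_verts.vertex)
  show "p {v} * sp \<gamma> = sp \<gamma>" "tp \<gamma> * p {v} = tp \<gamma>"
    using p_sp[OF v \<gamma>(3,2)] tp_p[OF v \<gamma>(3,2)] \<gamma>(1) by simp_all
qed

text \<open>The exponent \<open>l = 0\<close> is included. There \<open>sp \<delta>\<close> and
  \<open>tp \<delta>\<close> are the unit of the ring, which is why one \<open>p {v}\<close> has to
  stay.\<close>

lemma power_projection:
  assumes "closed_path_at G v \<alpha>" "v \<in> verts G" "\<delta> = concat (replicate l \<alpha>)"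
  shows "p {v} * sp \<delta> * p {v} = sp \<delta> * p {v}" "p {v} * tp \<delta> * p {v} = p {v} * tp \<delta>"
proof -
  have v: "{v} \<in> gen_verts G" using assms(2) by (rule gen_verts.vertex)
  have "p {v} * sp \<delta> * p {v} = sp \<delta> * p {v} \<and> p {v} * tp \<delta> * p {v} = p {v} * tp \<delta>"
  proof (cases "l = 0")
    case True
    then show ?thesis using p_mult[OF v v] assms(3) by simp
  next
    case False
    then have "closed_path_at G v \<delta>" using closed_path_at_power[OF assms(1)] assms(3) by simp
    from closed_path_absorb[OF this assms(2)] show ?thesis by (simp add: mult.assoc)
  qed
  then show "p {v} * sp \<delta> * p {v} = sp \<delta> * p {v}" "p {v} * tp \<delta> * p {v} = p {v} * tp \<delta>" by auto
qed

text \<open>A suffix of a power of \<alpha> either starts away from \<open>v\<close>, where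
  \<open>p {v}\<close> kills it, or begins with a full copy of \<alpha>, which is orthogonal to
  \<beta>.\<close>

lemma power_suffix_kills:
  assumes \<alpha>: "first_return_path_at G v \<alpha>" and \<beta>: "first_return_path_at G v \<beta>" and ne: "\<alpha> \<noteq> \<beta>"
    and v: "v \<in> verts G" and d: "d < length (concat (replicate m \<alpha>))"
  shows "p {v} * tp \<beta> * p {v} * sp (drop d (concat (replicate m \<alpha>))) * p {v} = 0"
    and "p {v} * tp (drop d (concat (replicate m \<alpha>))) * p {v} * sp \<beta> * p {v} = 0"
proof -
  let ?\<gamma> = "concat (replicate m \<alpha>)"
  have vg: "{v} \<in> gen_verts G" using v by (rule gen_verts.vertex)
  have c\<alpha>: "closed_path_at G v \<alpha>" using \<alpha> by (simp add: first_return_path_at_def)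
  then have "set \<alpha> \<subseteq> edges G" "\<alpha> \<noteq> []" "src G (hd \<alpha>) = v"
    by (auto simp: closed_path_at_def edge_path_def)
  then have p\<alpha>: "p {v} * sp \<alpha> = sp \<alpha>" "tp \<alpha> * p {v} = tp \<alpha>" by (simp_all add: p_sp[OF vg] tp_p[OF vg])
  have E: "set (drop d ?\<gamma>) \<subseteq> edges G" using \<open>set \<alpha> \<subseteq> edges G\<close> by (auto dest!: in_set_dropD)
  have "p {v} * tp \<beta> * p {v} * sp (drop d ?\<gamma>) * p {v} = 0 \<and>
    p {v} * tp (drop d ?\<gamma>) * p {v} * sp \<beta> * p {v} = 0"
  proof (cases "src G (?\<gamma> ! d) = v")
    case True
    obtain l where l: "drop d ?\<gamma> = \<alpha> @ concat (replicate l \<alpha>)" using power_suffix[OF \<alpha> v d True] by blast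
    let ?\<delta> = "concat (replicate l \<alpha>)"
    have "p {v} * tp \<beta> * p {v} * sp (drop d ?\<gamma>) * p {v} = p {v} * tp \<beta> * (p {v} * sp \<alpha>) * (sp ?\<delta> * p {v})"
      by (simp add: l mult.assoc)
    also have "\<dots> = (p {v} * tp \<beta> * sp \<alpha> * p {v}) * sp ?\<delta> * p {v}"
      by (subst power_projection(1)[OF c\<alpha> v refl, of l, symmetric]) (simp only: p\<alpha> mult.assoc)
    also have "\<dots> = 0" using first_return_orthogonal[OF \<alpha> \<beta> ne vg] by simp
    finally have 1: "p {v} * tp \<beta> * p {v} * sp (drop d ?\<gamma>) * p {v} = 0" .
    have "p {v} * tp (drop d ?\<gamma>) * p {v} * sp \<beta> * p {v} = (p {v} * tp ?\<delta>) * (tp \<alpha> * p {v}) * sp \<beta> * p {v}"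
      by (simp add: l mult.assoc)
    also have "\<dots> = p {v} * tp ?\<delta> * (p {v} * tp \<alpha> * sp \<beta> * p {v})"
      by (subst power_projection(2)[OF c\<alpha> v refl, of l, symmetric]) (simp only: p\<alpha> mult.assoc)
    also have "\<dots> = 0" using first_return_orthogonal[OF \<beta> \<alpha> ne[symmetric] vg] by simp
    finally show ?thesis using 1 by blast
  next
    case False
    then have "p {v} * sp (drop d ?\<gamma>) = 0" "tp (drop d ?\<gamma>) * p {v} = 0"
      using d by (simp_all add: p_sp[OF vg E] tp_p[OF vg E] hd_drop_conv_nth)
    moreover have "p {v} * tp \<beta> * p {v} * sp (drop d ?\<gamma>) * p {v} = p {v} * tp \<beta> * (p {v} * sp (drop d ?\<gamma>)) * p {v}"
      "p {v} * tp (drop d ?\<gamma>) * p {v} * sp \<beta> * p {v} = p {v} * (tp (drop d ?\<gamma>) * p {v}) * sp \<beta> * p {v}"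
      by (simp_all only: mult.assoc)
    ultimately show ?thesis by simp
  qed
  then show "p {v} * tp \<beta> * p {v} * sp (drop d ?\<gamma>) * p {v} = 0"
    "p {v} * tp (drop d ?\<gamma>) * p {v} * sp \<beta> * p {v} = 0"
    by auto
qed

text \<open>Conjugation by the power \<gamma> alone need not kill a monomial of nonzero degree: a
  suffix of \<gamma>, starred or not, may remain. The further conjugation by \<beta> is there to
  remove it.\<close>

lemma power_path_kills:
  assumes \<alpha>: "first_return_path_at G v \<alpha>" and \<beta>: "first_return_path_at G v \<beta>" and ne: "\<alpha> \<noteq> \<beta>"
    and v: "v \<in> verts G" and \<gamma>: "\<gamma> = concat (replicate m \<alpha>)"
    and len: "length \<mu> < length \<gamma>" "length \<nu> < length \<gamma>" "length \<mu> \<noteq> length \<nu>"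
    and h: "set \<mu> \<subseteq> edges G" "set \<nu> \<subseteq> edges G" "A \<in> gen_verts G"
  shows "(p {v} * tp \<beta> * p {v} * tp \<gamma>) * mon \<mu> A \<nu> * (sp \<gamma> * p {v} * sp \<beta> * p {v}) = 0"
proof -
  let ?i = "length \<mu>" and ?j = "length \<nu>"
  have "m > 0" using \<gamma> len by (cases m) auto
  then have path: "edge_path G \<gamma>"
    using closed_path_at_power[of G v \<alpha> m] \<alpha> \<gamma> by (auto simp: first_return_path_at_def closed_path_at_def)
  have pd: "edge_path G (drop ?i \<gamma>)" "edge_path G (drop ?j \<gamma>)" using edge_path_drop[OF path] len by auto
  have E: "set (drop k \<gamma>) \<subseteq> edges G" for k
    using edge_path_edges[OF path] set_drop_subset[of k \<gamma>] by blast
  define X where "X = tp \<gamma> * mon \<mu> A \<nu> * sp \<gamma>"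
  have "X = (tp \<gamma> * sp \<mu>) * p A * (tp \<nu> * sp \<gamma>)" by (simp add: X_def mon_def mult.assoc)
  then have X: "X = 0 \<or> X = tp (drop ?i \<gamma>) * sp (drop ?j \<gamma>)"
    using tp_sp_prefix[OF path h(1) len(1)] tp_prefix_sp[OF path h(2) len(2)]
      tp_p[OF h(3) E, of ?i] len(1) by (auto split: if_splits)
  \<comment> \<open>Cancelling the two suffixes of \<gamma> against each other leaves a suffix whose
    length is the difference of |\<mu>| and |\<nu>|. It is nonempty because these lengths differ,
    whence \<open>d < length \<gamma>\<close>.\<close>
  have "\<exists>d<length \<gamma>. X = 0 \<or> X = sp (drop d \<gamma>) \<or> X = tp (drop d \<gamma>)"
  proof (cases "?i < ?j")
    case True
    have "length (drop ?j \<gamma>) < length (drop ?i \<gamma>)" using True len by simp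
    then have "X = 0 \<or> X = tp (drop (length (drop ?j \<gamma>)) (drop ?i \<gamma>))"
      using X tp_sp_prefix[OF pd(1) E, of ?j] by auto
    then show ?thesis using True len by (intro exI[of _ "length (drop ?j \<gamma>) + ?i"]) auto
  next
    case False
    then have "length (drop ?i \<gamma>) < length (drop ?j \<gamma>)" using len by simp
    then have "X = 0 \<or> X = sp (drop (length (drop ?i \<gamma>)) (drop ?j \<gamma>))"
      using X tp_prefix_sp[OF pd(2) E, of ?i] by auto
    then show ?thesis using False len by (intro exI[of _ "length (drop ?i \<gamma>) + ?j"]) auto
  qed
  then obtain d where d: "d < length \<gamma>" "X = 0 \<or> X = sp (drop d \<gamma>) \<or> X = tp (drop d \<gamma>)" by blast
  note kills = power_suffix_kills[OF \<alpha> \<beta> ne v d(1)[unfolded \<gamma>], folded \<gamma>]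
  have "(p {v} * tp \<beta> * p {v} * tp \<gamma>) * mon \<mu> A \<nu> * (sp \<gamma> * p {v} * sp \<beta> * p {v}) =
    (p {v} * tp \<beta> * p {v} * X * p {v}) * (sp \<beta> * p {v})"
    by (simp add: X_def mult.assoc)
  moreover have "\<dots> = (p {v} * tp \<beta>) * (p {v} * X * p {v} * sp \<beta> * p {v})"
    by (simp add: mult.assoc)
  ultimately show ?thesis using d(2) kills by auto
qed

lemma off_part_power_path:
  assumes \<alpha>: "first_return_path_at G v \<alpha>" and \<beta>: "first_return_path_at G v \<beta>" and ne: "\<alpha> \<noteq> \<beta>"
    and v: "v \<in> verts G" and \<tau>: "\<tau> \<in> off_part 0"
  shows "\<exists>N. \<forall>m. let \<gamma> = concat (replicate m \<alpha>) in N < length \<gamma> \<longrightarrow>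
    (p {v} * tp \<beta> * p {v} * tp \<gamma>) * \<tau> * (sp \<gamma> * p {v} * sp \<beta> * p {v}) = 0"
  using \<tau>
proof (induction rule: mspan_induct)
  case zero
  then show ?case by simp
next
  case (step \<mu> A \<nu> y c)
  from step.IH obtain N where N: "\<forall>m. let \<gamma> = concat (replicate m \<alpha>) in N < length \<gamma> \<longrightarrow>
      (p {v} * tp \<beta> * p {v} * tp \<gamma>) * y * (sp \<gamma> * p {v} * sp \<beta> * p {v}) = 0"
    by (elim exE)
  show ?case
    unfolding Let_def
  proof (intro exI[of _ "N + length \<mu> + length \<nu>"] allI impI)
    fix m
    define \<gamma> where \<gamma>: "\<gamma> = concat (replicate m \<alpha>)"
    assume "N + length \<mu> + length \<nu> < length (concat (replicate m \<alpha>))"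
    then have len: "N + length \<mu> + length \<nu> < length \<gamma>" by (simp only: \<gamma>)
    let ?l = "p {v} * tp \<beta> * p {v} * tp \<gamma>" and ?r = "sp \<gamma> * p {v} * sp \<beta> * p {v}"
    have 1: "?l * mon \<mu> A \<nu> * ?r = 0"
      by (rule power_path_kills[OF \<alpha> \<beta> ne v \<gamma>]) (use len step in auto)
    have 2: "?l * y * ?r = 0" using N[unfolded Let_def, rule_format, of m, folded \<gamma>] len by linarith
    have "?l * (\<kappa> c * mon \<mu> A \<nu> + y) * ?r = \<kappa> c * (?l * mon \<mu> A \<nu> * ?r) + ?l * y * ?r"
      by (simp only: distrib_left distrib_right \<kappa>_left_comm mult.assoc)
    then have "?l * (\<kappa> c * mon \<mu> A \<nu> + y) * ?r = 0" unfolding 1 2 by simp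
    then show "(p {v} * tp \<beta> * p {v} * tp (concat (replicate m \<alpha>))) * (\<kappa> c * mon \<mu> A \<nu> + y) *
        (sp (concat (replicate m \<alpha>)) * p {v} * sp \<beta> * p {v}) = 0"
      unfolding \<gamma> .
  qed
qed

lemma closed_path_isometry:
  assumes "closed_path_at G v \<gamma>" "v \<in> verts G"
  shows "p {v} * tp \<gamma> * p {v} * sp \<gamma> * p {v} = p {v}"
proof -
  have v: "{v} \<in> gen_verts G" using assms(2) by (rule gen_verts.vertex)
  have \<gamma>: "edge_path G \<gamma>" "src G (hd \<gamma>) = v" "v \<in> rng G (last \<gamma>)" "\<gamma> \<noteq> []" "set \<gamma> \<subseteq> edges G"
    using assms(1) edge_path_nonempty[of G \<gamma>] edge_path_edges[of G \<gamma>]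
    unfolding closed_path_at_def by blast+
  have "last \<gamma> \<in> edges G" using \<gamma>(4,5) last_in_set by blast
  then have r: "rng G (last \<gamma>) \<in> gen_verts G" by (rule gen_verts.range)
  have "p {v} * tp \<gamma> * p {v} * sp \<gamma> * p {v} = p {v} * ((tp \<gamma> * p {v}) * sp \<gamma>) * p {v}"
    by (simp only: mult.assoc)
  also have "tp \<gamma> * p {v} = tp \<gamma>" using tp_p[OF v \<gamma>(5,4)] \<gamma>(2) by simp
  also have "tp \<gamma> * sp \<gamma> = p (rng G (last \<gamma>))" by (rule tp_sp_same[OF \<gamma>(1)])
  also have "p {v} * p (rng G (last \<gamma>)) = p {v}" using p_mult[OF v r] \<gamma>(3) by simp
  also have "p {v} * p {v} = p {v}" using p_mult[OF v v] by simp
  finally show ?thesis .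
qed

lemma not_good:
  assumes K: "condition_K G"
  shows "\<not> good v"
proof
  assume "good v"
  show False
  proof (cases "\<exists>w. good w \<and> (\<exists>es. closed_path_at G w es)")
    case True
    then obtain w where w: "w \<in> verts G" "p {w} \<in> W 0" "p {w} \<noteq> 0" "\<exists>es. closed_path_at G w es"
      by (auto simp: good_def)
    obtain \<alpha> \<beta> where ab: "\<alpha> \<noteq> \<beta>" "first_return_path_at G w \<alpha>" "first_return_path_at G w \<beta>"
      using K w(1,4) unfolding condition_K_def by blast
    obtain x where x: "x \<in> I" "x - p {w} \<in> off_part 0" using w(2) by (auto simp: W_def)
    from off_part_power_path[OF ab(2,3,1) w(1) x(2)]
    obtain N where N: "\<forall>m. let \<gamma> = concat (replicate m \<alpha>) in N < length \<gamma> \<longrightarrow>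
        (p {w} * tp \<beta> * p {w} * tp \<gamma>) * (x - p {w}) * (sp \<gamma> * p {w} * sp \<beta> * p {w}) = 0"
      by (elim exE)
    define \<gamma> where "\<gamma> = concat (replicate (Suc N) \<alpha>)"
    have c: "closed_path_at G w \<alpha>" "closed_path_at G w \<beta>" using ab by (auto simp: first_return_path_at_def)
    then have c\<gamma>: "closed_path_at G w \<gamma>" unfolding \<gamma>_def by (intro closed_path_at_power) simp_all
    have E: "set \<beta> \<subseteq> edges G" "set \<gamma> \<subseteq> edges G" "\<alpha> \<noteq> []"
      using c c\<gamma> edge_path_nonempty edge_path_edges unfolding closed_path_at_def by blast+
    have vg: "{w} \<in> gen_verts G" using w(1) by (rule gen_verts.vertex)
    have "N < length \<gamma>" unfolding \<gamma>_def length_power using E(3) by (cases \<alpha>) auto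
    then have "(p {w} * tp \<beta> * p {w} * tp \<gamma>) * x * (sp \<gamma> * p {w} * sp \<beta> * p {w}) =
      (p {w} * tp \<beta> * p {w} * tp \<gamma>) * p {w} * (sp \<gamma> * p {w} * sp \<beta> * p {w})"
      using N[unfolded Let_def, rule_format, of "Suc N", folded \<gamma>_def]
      by (simp only: left_diff_distrib right_diff_distrib right_minus_eq)
    also have "\<dots> = p {w} * tp \<beta> * (p {w} * tp \<gamma> * p {w} * sp \<gamma> * p {w}) * sp \<beta> * p {w}"
      by (simp only: mult.assoc)
    also have "\<dots> = p {w}"
      unfolding closed_path_isometry[OF c\<gamma> w(1)] closed_path_isometry[OF c(2) w(1)] ..
    \<comment> \<open>This form exhibits \<open>p {w}\<close> as the element \<open>x\<close> of
      \<open>I\<close> multiplied on both sides by generators, so \<open>p {w}\<close> is a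
      homogeneous element of \<open>I\<close>.\<close>
    finally have "p {w} = p {w} * (tp \<beta> * (p {w} * (tp \<gamma> * x * sp \<gamma>) * p {w}) * sp \<beta>) * p {w}"
      by (simp only: mult.assoc)
    moreover have "\<dots> \<in> I"
      using x(1) E vg by (intro I_p I_sp I_tp) auto
    ultimately have "p {w} \<in> I" by simp
    then show False using I_homogeneous[of "p {w}" 0] mspan_p[OF vg] w(3) by simp
  next
    case False
    obtain x where x: "x \<in> I" "x - p {v} \<in> off_part 0" using \<open>good v\<close> by (auto simp: W_def good_def)
    obtain N where N: "\<And>\<gamma>. edge_path G \<gamma> \<Longrightarrow> distinct \<gamma> \<Longrightarrow> N < length \<gamma> \<Longrightarrow>
        tp \<gamma> * (x - p {v}) * sp \<gamma> = 0"
      using off_part_distinct_path[OF x(2)] by blast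
    obtain \<gamma> w where \<gamma>: "length \<gamma> = Suc N" "edge_path G \<gamma>" "src G (hd \<gamma>) = v"
      "\<forall>e\<in>set \<gamma>. good (src G e)" "w \<in> rng G (last \<gamma>)" "good w"
      using good_path[OF \<open>good v\<close>, of N] by blast
    \<comment> \<open>All sources along \<gamma> are good, and a repeated edge would produce a
      closed path at one of them.\<close>
    have "distinct \<gamma>" using closed_path_of_repeated_edge[OF \<gamma>(2)] False \<gamma>(4) by blast
    then have "tp \<gamma> * x * sp \<gamma> = tp \<gamma> * p {v} * sp \<gamma>"
      using N[OF \<gamma>(2)] \<gamma>(1) by (simp add: left_diff_distrib right_diff_distrib)
    also have "tp \<gamma> * p {v} = tp \<gamma>"
      using tp_p[of "{v}" \<gamma>] edge_path_nonempty[OF \<gamma>(2)] edge_path_edges[OF \<gamma>(2)] \<gamma>(3) \<open>good v\<close>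
      by (simp add: good_def gen_verts.vertex)
    also have "tp \<gamma> * sp \<gamma> = p (rng G (last \<gamma>))" by (rule tp_sp_same[OF \<gamma>(2)])
    finally have "p (rng G (last \<gamma>)) = tp \<gamma> * x * sp \<gamma>" by simp
    moreover have "\<dots> \<in> I" using x(1) edge_path_edges[OF \<gamma>(2)] by (intro I_sp I_tp)
    moreover have "last \<gamma> \<in> edges G"
      using edge_path_nonempty[OF \<gamma>(2)] edge_path_edges[OF \<gamma>(2)] last_in_set by blast
    then have r: "rng G (last \<gamma>) \<in> gen_verts G" by (rule gen_verts.range)
    ultimately have "p (rng G (last \<gamma>)) = 0" using I_homogeneous[of _ 0] mspan_p[OF r] by simp
    moreover have "{w} \<in> gen_verts G" "{w} \<inter> rng G (last \<gamma>) = {w}"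
      using \<gamma> by (auto simp: good_def gen_verts.vertex)
    ultimately have "p {w} = 0" using p_mult[of "{w}" "rng G (last \<gamma>)"] r by simp
    then show False using \<gamma>(6) by (simp add: good_def)
  qed
qed

lemma W_zero_trivial:
  assumes "condition_K G" "y \<in> W 0"
  shows "y = 0"
proof (rule ccontr)
  assume "y \<noteq> 0"
  have "y \<in> mspan (\<lambda>i j. int i - int j = 0)" using assms(2) by (simp add: W_def)
  then have "\<exists>N. y \<in> mspan (\<lambda>i j. i = j \<and> i \<le> N)"
  proof (induction rule: mspan_induct)
    case (step \<alpha> A \<beta> y c)
    then obtain N where N: "y \<in> mspan (\<lambda>i j. i = j \<and> i \<le> N)" by blast
    have "y \<in> mspan (\<lambda>i j. i = j \<and> i \<le> N + length \<alpha>)" by (rule mspan_mono[OF N]) simp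
    then show ?case
      using step by (intro exI[of _ "N + length \<alpha>"] mspan_add mspan_scale mspan_mon) auto
  qed (auto intro: mspan_zero)
  then obtain A where "A \<in> gen_verts G" "p A \<in> W 0" "p A \<noteq> 0"
    using degree_zero_reduction[OF assms(2) _ \<open>y \<noteq> 0\<close>] by blast
  then show False using W_zero_vertex not_good[OF assms(1)] by (auto simp: good_def)
qed

text \<open>In positive degree every monomial starts with an edge, so \<open>y\<close> is a finite
  sum of terms \<open>s e * (t e * y)\<close>, and \<open>t e * y\<close> has degree one less. In
  negative degree edges are taken off on the right in the same way.\<close>

lemma W_nat_trivial:
  assumes K: "condition_K G"
  shows "y \<in> W (int n) \<Longrightarrow> y = 0" "y \<in> W (- int n) \<Longrightarrow> y = 0"
proof (induction n arbitrary: y)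
  case 0
  {
    case 1
    then show ?case using W_zero_trivial[OF K] by simp
  next
    case 2
    then show ?case using W_zero_trivial[OF K] by simp
  }
next
  case (Suc n)
  {
    case 1
    then have "y \<in> mspan (\<lambda>i j. int i - int j = int (Suc n))" by (simp add: W_def)
    then have "y \<in> lspan \<kappa> {s e * z |e z. e \<in> edges G}"
    proof (induction rule: mspan_induct)
      case (step \<alpha> A \<beta> y c)
      then obtain e \<alpha>' where a: "\<alpha> = e # \<alpha>'" by (cases \<alpha>) auto
      have "mon \<alpha> A \<beta> = s e * mon \<alpha>' A \<beta>" by (simp add: a s_mon)
      then have "mon \<alpha> A \<beta> \<in> {s e * z |e z. e \<in> edges G}" using step(1) a by auto
      then show ?case using step by (intro lspan.step)
    qed (rule lspan.zero)
    from source_proj_left[OF this] obtain F where F: "finite F" "F \<subseteq> edges G" "source_proj F * y = y"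
      by blast
    have "t e * y = 0" if "e \<in> F" for e
      using t_W[OF 1, of e] F that by (intro Suc.IH(1)) auto
    then have "source_proj F * y = 0"
      unfolding source_proj_def sum_distrib_right by (intro sum.neutral) (simp add: mult.assoc)
    then show ?case using F by simp
  next
    case 2
    then have "y \<in> mspan (\<lambda>i j. int i - int j = - int (Suc n))" by (simp add: W_def)
    then have "y \<in> lspan \<kappa> {z * t e |e z. e \<in> edges G}"
    proof (induction rule: mspan_induct)
      case (step \<alpha> A \<beta> y c)
      then obtain e \<beta>' where b: "\<beta> = e # \<beta>'" by (cases \<beta>) auto
      have "mon \<alpha> A \<beta> = mon \<alpha> A \<beta>' * t e" by (simp add: b mon_t)
      then have "mon \<alpha> A \<beta> \<in> {z * t e |e z. e \<in> edges G}" using step(3) b by auto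
      then show ?case using step by (intro lspan.step)
    qed (rule lspan.zero)
    from source_proj_right[OF this] obtain F where F: "finite F" "F \<subseteq> edges G" "y * source_proj F = y"
      by blast
    have "y * s e = 0" if "e \<in> F" for e
      using W_s[OF 2, of e] F that by (intro Suc.IH(2)) auto
    then have "y * source_proj F = 0"
      unfolding source_proj_def sum_distrib_left by (intro sum.neutral) (simp add: mult.assoc[symmetric])
    then show ?case using F by simp
  }
qed

text \<open>Each \<open>h n\<close> belongs to \<open>W n\<close> with \<open>x\<close> itself as
  witness, because the remaining summands have other degrees. Any decomposition into homogeneous
  terms will do.\<close>

theorem ideal_trivial:
  assumes K: "condition_K G" and x: "x \<in> I" and M: "finite M" "x = (\<Sum>n\<in>M. h n)"
    and h: "\<And>n. n \<in> M \<Longrightarrow> h n \<in> hom_part n"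
  shows "x = 0"
proof -
  have "h n = 0" if n: "n \<in> M" for n
  proof -
    have "(\<Sum>m\<in>M - {n}. h m) \<in> off_part n"
    proof (rule mspan_sum)
      fix m assume "m \<in> M - {n}"
      then have m: "m \<in> M" "m \<noteq> n" by auto
      show "h m \<in> off_part n" by (rule mspan_mono[OF h[OF m(1)]]) (use m(2) in simp)
    qed
    moreover have "x - h n = (\<Sum>m\<in>M - {n}. h m)" using M n by (simp add: sum.remove)
    ultimately have "h n \<in> W n" using h[OF n] x unfolding W_def by force
    then show ?thesis using W_nat_trivial[OF K, of "h n" "nat \<bar>n\<bar>"] by (cases "n \<ge> 0") auto
  qed
  then show ?thesis using M by simp
qed

end

section \<open>Quotients of monoid algebras\<close>

alias single = Poly_Mapping.single
alias keys = Poly_Mapping.keys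
alias lookup = Poly_Mapping.lookup

lemma poly_mapping_span_induct [case_names keys zero step]:
  fixes x :: "'w \<Rightarrow>\<^sub>0 'k::comm_monoid_add"
  assumes "keys x \<subseteq> S" "P 0"
    and "\<And>w c y. w \<in> S \<Longrightarrow> P y \<Longrightarrow> P (single w c + y)"
  shows "P x"
proof -
  have "P (\<Sum>w\<in>A. single w (lookup x w))" if "finite A" "A \<subseteq> S" for A
    using that by (induction rule: finite_induct) (use assms in auto)
  then have "P (\<Sum>w\<in>keys x. single w (lookup x w))"
    using assms(1) by simp
  moreover have "(\<Sum>w\<in>keys x. single w (lookup x w)) = x"
    by (rule poly_mapping_eqI) (auto simp: lookup_sum lookup_single when_def in_keys_iff)
  ultimately show ?thesis by simp
qed

lemma single_zero_commute:
  fixes x :: "'w::monoid_add \<Rightarrow>\<^sub>0 'k::comm_semiring_0"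
  shows "x * single 0 c = single 0 c * x"
proof (induction x rule: poly_mapping_span_induct[where S = UNIV])
  case (step w d y)
  then show ?case by (simp add: distrib_left distrib_right mult_single mult.commute)
qed auto

text \<open>A ring type is wanted that does not depend on the ideal to be divided out; the
  endomorphisms of the ambient space provide one. Scalars appear as \<open>single 0 c\<close>, since
  0 is the neutral element of the monoid.\<close>

typedef (overloaded) ('w, 'k) lin_endo =
  "{f :: ('w::monoid_add \<Rightarrow>\<^sub>0 'k::field) \<Rightarrow> ('w \<Rightarrow>\<^sub>0 'k).
    (\<forall>x y. f (x + y) = f x + f y) \<and>
    (\<forall>c x. f (single 0 c * x) = single 0 c * f x)}"
  by (rule exI[of _ "\<lambda>x. 0"]) simp

setup_lifting type_definition_lin_endo

instantiation lin_endo :: (monoid_add, field) ring_1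
begin

lift_definition zero_lin_endo :: "('a, 'b) lin_endo" is "\<lambda>x. 0" by simp
lift_definition one_lin_endo :: "('a, 'b) lin_endo" is "\<lambda>x. x" by simp
lift_definition plus_lin_endo :: "('a, 'b) lin_endo \<Rightarrow> ('a, 'b) lin_endo \<Rightarrow> ('a, 'b) lin_endo"
  is "\<lambda>f g x. f x + g x" by (simp add: algebra_simps)
lift_definition minus_lin_endo :: "('a, 'b) lin_endo \<Rightarrow> ('a, 'b) lin_endo \<Rightarrow> ('a, 'b) lin_endo"
  is "\<lambda>f g x. f x - g x" by (simp add: algebra_simps)
lift_definition uminus_lin_endo :: "('a, 'b) lin_endo \<Rightarrow> ('a, 'b) lin_endo"
  is "\<lambda>f x. - f x" by simp
lift_definition times_lin_endo :: "('a, 'b) lin_endo \<Rightarrow> ('a, 'b) lin_endo \<Rightarrow> ('a, 'b) lin_endo"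
  is "\<lambda>f g x. f (g x)" by simp

instance
proof
  show "(0 :: ('a, 'b) lin_endo) \<noteq> 1"
    by transfer (metis zero_neq_one)
qed (transfer; force simp: algebra_simps)+

end

lift_definition endo_scale :: "'k \<Rightarrow> ('w::monoid_add, 'k::field) lin_endo"
  is "\<lambda>c x. single 0 c * x"
  by (auto simp: distrib_left) (metis mult.assoc single_zero_commute)

lemma endo_scale_simps:
  "endo_scale (a + b) = endo_scale a + endo_scale b"
  "endo_scale (a * b) = endo_scale a * endo_scale b"
  "endo_scale 1 = 1"
  "z * endo_scale a = endo_scale a * z"
proof -
  show "endo_scale (a + b) = endo_scale a + endo_scale b"
    by transfer (simp add: single_add distrib_right fun_eq_iff)
  show "endo_scale (a * b) = endo_scale a * endo_scale b"
    by transfer (simp add: mult_single mult.assoc[symmetric] fun_eq_iff)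
qed (transfer; simp)+

text \<open>A basis of \<open>J\<close> is extended to the whole space; \<pi> sends the basis of
  \<open>J\<close> to zero and fixes the added vectors. It thus picks one representative from every
  coset.\<close>

lemma ideal_projection:
  fixes J :: "('w::monoid_add \<Rightarrow>\<^sub>0 'k::field) set"
  assumes J: "0 \<in> J" "\<And>x y. x \<in> J \<Longrightarrow> y \<in> J \<Longrightarrow> x + y \<in> J"
    "\<And>c x. x \<in> J \<Longrightarrow> single 0 c * x \<in> J"
  shows "\<exists>\<pi>. (\<forall>x y. \<pi> (x + y) = \<pi> x + \<pi> y) \<and>
    (\<forall>c x. \<pi> (single 0 c * x) = single 0 c * \<pi> x) \<and>
    (\<forall>x. \<pi> x - x \<in> J) \<and> (\<forall>x\<in>J. \<pi> x = 0)"
proof -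
  define sc :: "'k \<Rightarrow> ('w \<Rightarrow>\<^sub>0 'k) \<Rightarrow> ('w \<Rightarrow>\<^sub>0 'k)" where "sc c x = single 0 c * x" for c x
  interpret V: vector_space sc
    by unfold_locales (simp_all add: sc_def distrib_left distrib_right single_add mult_single mult.assoc[symmetric])
  interpret VV: vector_space_pair sc sc by unfold_locales
  have sub: "V.subspace J" using J by (auto intro!: V.subspaceI simp: sc_def)
  obtain B where B: "B \<subseteq> J" "V.independent B" "J \<subseteq> V.span B"
    using V.maximal_independent_subset[of J] by blast
  define E where "E = V.extend_basis B"
  have E: "B \<subseteq> E" "V.independent E" "V.span E = UNIV"
    unfolding E_def using B V.extend_basis_superset V.independent_extend_basis V.span_extend_basis by auto
  define \<pi> where "\<pi> = VV.construct E (\<lambda>b. if b \<in> B then 0 else b)"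
  interpret L: linear sc sc \<pi> unfolding \<pi>_def using E(2) by (rule VV.linear_construct)
  have \<pi>E: "\<pi> b = (if b \<in> B then 0 else b)" if "b \<in> E" for b
    unfolding \<pi>_def using VV.construct_basis[OF E(2) that] .
  have "\<pi> x - x \<in> J" for x
  proof -
    have "x \<in> V.span E" using E by simp
    then show ?thesis
    proof (induction rule: V.span_induct_alt)
      case base
      then show ?case using J by (simp add: L.zero)
    next
      case (step c b y)
      have "\<pi> b - b \<in> J" using \<pi>E[OF step(1)] B(1) J(1) V.subspace_neg[OF sub] by auto
      then have "sc c (\<pi> b - b) \<in> J" using V.subspace_scale[OF sub] by simp
      then have "sc c (\<pi> b - b) + (\<pi> y - y) \<in> J" using step(2) J(2) by blast
      moreover have "\<pi> (sc c b + y) - (sc c b + y) = sc c (\<pi> b - b) + (\<pi> y - y)"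
        by (simp add: L.add L.scale V.scale_right_diff_distrib)
      ultimately show ?case by metis
    qed
  qed
  moreover have "\<pi> x = 0" if "x \<in> J" for x
  proof -
    have "x \<in> V.span B" using B(3) that by auto
    then show ?thesis
      using \<pi>E E(1) by (induction rule: V.span_induct_alt) (auto simp: L.zero L.add L.scale)
  qed
  ultimately show ?thesis
    using L.add L.scale unfolding sc_def by blast
qed

text \<open>The quotient by \<open>J\<close>, which is not available as a type, is realized by its left regular
  representation on a linear complement of \<open>J\<close>.\<close>

lemma ideal_quotient_embedding:
  fixes J :: "('w::monoid_add \<Rightarrow>\<^sub>0 'k::field) set"
  assumes J: "0 \<in> J" "\<And>x y. x \<in> J \<Longrightarrow> y \<in> J \<Longrightarrow> x + y \<in> J"
    "\<And>x y. x \<in> J \<Longrightarrow> y * x \<in> J" "\<And>x y. x \<in> J \<Longrightarrow> x * y \<in> J"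
  shows "\<exists>\<phi> :: ('w \<Rightarrow>\<^sub>0 'k) \<Rightarrow> ('w, 'k) lin_endo.
    (\<forall>x y. \<phi> (x + y) = \<phi> x + \<phi> y) \<and> (\<forall>x y. \<phi> (x * y) = \<phi> x * \<phi> y) \<and>
    (\<forall>c x. \<phi> (single 0 c * x) = endo_scale c * \<phi> x) \<and>
    (\<forall>x. \<phi> x = 0 \<longleftrightarrow> x \<in> J)"
proof -
  obtain \<pi> where \<pi>: "\<And>x y. \<pi> (x + y) = \<pi> x + \<pi> y"
    "\<And>c x. \<pi> (single 0 c * x) = single 0 c * \<pi> x"
    "\<And>x. \<pi> x - x \<in> J" "\<And>x. x \<in> J \<Longrightarrow> \<pi> x = 0"
    using ideal_projection[OF J(1,2,3)] by metis
  have lin: "\<pi> (x * (u + v)) = \<pi> (x * u) + \<pi> (x * v)"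
    "\<pi> (x * (single 0 c * v)) = single 0 c * \<pi> (x * v)" for x u v c
  proof -
    show "\<pi> (x * (u + v)) = \<pi> (x * u) + \<pi> (x * v)" by (simp add: distrib_left \<pi>(1))
    have "x * (single 0 c * v) = single 0 c * (x * v)"
      by (metis mult.assoc single_zero_commute)
    then show "\<pi> (x * (single 0 c * v)) = single 0 c * \<pi> (x * v)"
      by (simp only: \<pi>(2))
  qed
  define \<phi> :: "('w \<Rightarrow>\<^sub>0 'k) \<Rightarrow> ('w, 'k) lin_endo" where "\<phi> x = Abs_lin_endo (\<lambda>v. \<pi> (x * v))" for x
  have rep: "Rep_lin_endo (\<phi> x) = (\<lambda>v. \<pi> (x * v))" for x
    unfolding \<phi>_def by (rule Abs_lin_endo_inverse) (use lin in simp)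
  have "\<phi> (x + y) = \<phi> x + \<phi> y" for x y
    by (simp add: Rep_lin_endo_inject[symmetric] plus_lin_endo.rep_eq rep distrib_right \<pi>(1))
  moreover have "\<phi> (x * y) = \<phi> x * \<phi> y" for x y
  proof -
    have "\<pi> (x * \<pi> (y * v)) = \<pi> (x * (y * v))" for v
    proof -
      \<comment> \<open>Passing from \<open>y * v\<close> to its representative changes it by an
        element of \<open>J\<close>, and multiplication by \<open>x\<close> stays in
        \<open>J\<close>.\<close>
      have "\<pi> (x * (\<pi> (y * v) - y * v)) = 0" using \<pi>(3,4) J(3) by blast
      then have "\<pi> (x * (\<pi> (y * v) - y * v) + x * (y * v)) = \<pi> (x * (y * v))" by (simp add: \<pi>(1))
      then show ?thesis by (simp add: right_diff_distrib)
    qed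
    then show ?thesis
      by (simp add: Rep_lin_endo_inject[symmetric] times_lin_endo.rep_eq rep mult.assoc)
  qed
  moreover have "\<phi> (single 0 c * x) = endo_scale c * \<phi> x" for c x
    by (simp add: Rep_lin_endo_inject[symmetric] times_lin_endo.rep_eq endo_scale.rep_eq rep mult.assoc \<pi>(2))
  moreover have "\<phi> x = 0 \<longleftrightarrow> x \<in> J" for x
  proof
    assume "\<phi> x = 0"
    \<comment> \<open>Evaluation at 1 returns \<open>\<pi> x\<close>, whose vanishing puts
      \<open>x\<close> into \<open>J\<close>. The unit of the monoid algebra is what makes the
      representation faithful.\<close>
    then have "Rep_lin_endo (\<phi> x) 1 = 0" by (simp add: zero_lin_endo.rep_eq)
    then have "- x \<in> J" using \<pi>(3)[of x] rep by simp
    then show "x \<in> J" using J(3)[of "- x" "- 1"] by simp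
  next
    assume "x \<in> J"
    then show "\<phi> x = 0"
      using J(4) \<pi>(4) by (simp add: Rep_lin_endo_inject[symmetric] zero_lin_endo.rep_eq rep)
  qed
  ultimately show ?thesis by blast
qed

section \<open>Ideals of free algebras\<close>

definition restr :: "'w set \<Rightarrow> ('w \<Rightarrow>\<^sub>0 'k::comm_monoid_add) \<Rightarrow> 'w \<Rightarrow>\<^sub>0 'k" where
  "restr S x = (\<Sum>w\<in>keys x \<inter> S. single w (lookup x w))"

lemma lookup_restr: "lookup (restr S x) w = (lookup x w when w \<in> S)"
  unfolding restr_def by (auto simp: lookup_sum lookup_single when_def in_keys_iff)

lemma restr_simps [simp]:
  "restr S 0 = 0" "restr S (x + y) = restr S x + restr S y"
  "restr S (single w c) = (if w \<in> S then single w c else 0)"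
  by (auto intro!: poly_mapping_eqI simp: lookup_restr lookup_add lookup_single when_def)

lemma restr_same: "keys x \<subseteq> S \<Longrightarrow> restr S x = x"
  by (rule poly_mapping_eqI) (auto simp: lookup_restr when_def in_keys_iff)

lemma restr_disjoint: "keys x \<inter> S = {} \<Longrightarrow> restr S x = 0"
  by (rule poly_mapping_eqI) (auto simp: lookup_restr when_def in_keys_iff)

lemma keys_restr: "keys (restr S x) = keys x \<inter> S"
  by (auto simp: in_keys_iff lookup_restr)

abbreviation free_carrier :: "'x set \<Rightarrow> ('x free_word \<Rightarrow>\<^sub>0 'k::field) set" where
  "free_carrier A \<equiv> carrier (free_algebra A)"

lemma carrier_free_algebra:
  "x \<in> free_carrier A \<longleftrightarrow> keys x \<subseteq> FWord ` {xs. xs \<noteq> [] \<and> set xs \<subseteq> A}"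
  by (simp add: free_algebra_def)

lemma free_algebra_simps [simp]:
  "mult (free_algebra A) = (*)" "zero (free_algebra A) = 0" "add (free_algebra A) = (+)"
  by (simp_all add: free_algebra_def)

lemma smult_free_algebra [simp]: "smult (free_algebra A) c x = single 0 c * x"
  by (simp add: free_algebra_def mult_map_scale_conv_mult)

lemma free_algebra_zero: "0 \<in> free_carrier A"
  by (simp add: carrier_free_algebra)

lemma free_algebra_add:
  "x \<in> free_carrier A \<Longrightarrow> y \<in> free_carrier A \<Longrightarrow> x + y \<in> free_carrier A"
  unfolding carrier_free_algebra using keys_add[of x y] by blast

lemma free_algebra_single:
  "xs \<noteq> [] \<Longrightarrow> set xs \<subseteq> A \<Longrightarrow> single (FWord xs) c \<in> free_carrier A"
  by (simp add: carrier_free_algebra)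

lemma free_algebra_var: "g \<in> A \<Longrightarrow> free_var g \<in> free_carrier A"
  unfolding free_var_def by (rule free_algebra_single) auto

lemma free_algebra_mult:
  assumes "x \<in> free_carrier A" "y \<in> free_carrier A"
  shows "x * y \<in> free_carrier A"
proof -
  have "keys (x * y) \<subseteq> FWord ` {xs. xs \<noteq> [] \<and> set xs \<subseteq> A}"
  proof
    fix w assume "w \<in> keys (x * y)"
    then obtain a b where "w = a + b" "a \<in> keys x" "b \<in> keys y"
      using keys_mult[of x y] by blast
    then obtain xs ys where "w = FWord xs + FWord ys" "xs \<noteq> []" "set xs \<subseteq> A" "set ys \<subseteq> A"
      using assms unfolding carrier_free_algebra by blast
    then show "w \<in> FWord ` {xs. xs \<noteq> [] \<and> set xs \<subseteq> A}" by auto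
  qed
  then show ?thesis by (simp add: carrier_free_algebra)
qed

lemma free_algebra_scale:
  assumes "x \<in> free_carrier A"
  shows "single 0 c * x \<in> free_carrier A"
proof -
  have "keys (single 0 c * x) \<subseteq> keys x"
    using keys_mult[of "single 0 c" x] by (auto split: if_splits)
  then show ?thesis using assms by (auto simp: carrier_free_algebra)
qed

lemma scale_minus_one: "single 0 (- 1) * x = - (x :: 'w::monoid_add \<Rightarrow>\<^sub>0 'k::comm_ring_1)"
  by (simp add: single_uminus)

lemma free_algebra_uminus: "x \<in> free_carrier A \<Longrightarrow> - x \<in> free_carrier A"
  using free_algebra_scale[of x A "- 1"] by (simp add: scale_minus_one)

lemma free_algebra_diff:
  "x \<in> free_carrier A \<Longrightarrow> y \<in> free_carrier A \<Longrightarrow> x - y \<in> free_carrier A"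
  using free_algebra_add[OF _ free_algebra_uminus, of x A y] by simp

lemma free_algebra_sum:
  "(\<And>i. i \<in> B \<Longrightarrow> f i \<in> free_carrier A) \<Longrightarrow> sum f B \<in> free_carrier A"
  by (induction B rule: infinite_finite_induct) (auto intro: free_algebra_zero free_algebra_add)

lemma free_algebra_induct [consumes 1, case_names zero step]:
  assumes "x \<in> free_carrier A" "P 0"
    and "\<And>xs c y. xs \<noteq> [] \<Longrightarrow> set xs \<subseteq> A \<Longrightarrow> y \<in> free_carrier A \<Longrightarrow> P y \<Longrightarrow>
      P (single (FWord xs) c + y)"
  shows "P x"
proof -
  have "P x \<and> x \<in> free_carrier A"
  proof (induction x rule: poly_mapping_span_induct[where S = "FWord ` {xs. xs \<noteq> [] \<and> set xs \<subseteq> A}"])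
    case keys
    then show ?case using assms(1) by (simp add: carrier_free_algebra)
  next
    case zero
    then show ?case using assms(2) free_algebra_zero by simp
  next
    case (step w c y)
    then show ?case using assms(3) by (auto intro!: free_algebra_add free_algebra_single)
  qed
  then show ?thesis by simp
qed

lemma abelian_group_free_algebra: "abelian_group (free_algebra A)"
proof (rule abelian_groupI)
  fix x assume "x \<in> free_carrier A"
  then show "\<exists>y\<in>free_carrier A. y \<oplus>\<^bsub>free_algebra A\<^esub> x = \<zero>\<^bsub>free_algebra A\<^esub>"
    by (intro bexI[of _ "- x"]) (auto intro: free_algebra_uminus)
qed (auto simp: algebra_simps intro: free_algebra_add free_algebra_zero)

lemma a_inv_free_algebra: "x \<in> free_carrier A \<Longrightarrow> \<ominus>\<^bsub>free_algebra A\<^esub> x = - x"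
  by (rule abelian_group.minus_equality[OF abelian_group_free_algebra])
    (auto intro: free_algebra_uminus)

definition free_ideal :: "'x set \<Rightarrow> ('x free_word \<Rightarrow>\<^sub>0 'k::field) set \<Rightarrow> bool" where
  "free_ideal A I \<longleftrightarrow> I \<subseteq> free_carrier A \<and> 0 \<in> I \<and> (\<forall>x\<in>I. \<forall>y\<in>I. x + y \<in> I) \<and>
     (\<forall>c. \<forall>x\<in>I. single 0 c * x \<in> I) \<and>
     (\<forall>x\<in>I. \<forall>y\<in>free_carrier A. y * x \<in> I \<and> x * y \<in> I)"

lemma free_idealD:
  assumes "free_ideal A I"
  shows "x \<in> I \<Longrightarrow> x \<in> free_carrier A" "0 \<in> I" "x \<in> I \<Longrightarrow> y \<in> I \<Longrightarrow> x + y \<in> I"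
    "x \<in> I \<Longrightarrow> single 0 c * x \<in> I" "x \<in> I \<Longrightarrow> y \<in> free_carrier A \<Longrightarrow> y * x \<in> I"
    "x \<in> I \<Longrightarrow> y \<in> free_carrier A \<Longrightarrow> x * y \<in> I" "x \<in> I \<Longrightarrow> - x \<in> I"
    "x \<in> I \<Longrightarrow> y \<in> I \<Longrightarrow> x - y \<in> I"
proof -
  show 1: "x \<in> I \<Longrightarrow> - x \<in> I" for x using assms scale_minus_one[of x] unfolding free_ideal_def by metis
  show "x \<in> I \<Longrightarrow> y \<in> I \<Longrightarrow> x - y \<in> I"
    using 1[of y] assms unfolding free_ideal_def by (metis add_uminus_conv_diff)
qed (use assms in \<open>auto simp: free_ideal_def\<close>)

lemma free_ideal_iff:
  "two_sided_ideal (free_algebra A) I \<and> linear_subspace (free_algebra A) I \<longleftrightarrow> free_ideal A I"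
proof
  assume l: "two_sided_ideal (free_algebra A) I \<and> linear_subspace (free_algebra A) I"
  then interpret additive_subgroup I "free_algebra A" by (simp add: two_sided_ideal_def)
  show "free_ideal A I"
    using l a_subset zero_closed a_closed by (auto simp: free_ideal_def two_sided_ideal_def linear_subspace_def)
next
  assume r: "free_ideal A I"
  have "subgroup I (add_monoid (free_algebra A))"
  proof (rule group.subgroupI[OF abelian_group.a_group[OF abelian_group_free_algebra]])
    fix a assume a: "a \<in> I"
    have "inv\<^bsub>add_monoid (free_algebra A)\<^esub> a = - a"
      using a_inv_free_algebra[OF free_idealD(1)[OF r a]] by (simp add: a_inv_def)
    then show "inv\<^bsub>add_monoid (free_algebra A)\<^esub> a \<in> I" using free_idealD(7)[OF r a] by simp
  qed (use r in \<open>auto simp: free_ideal_def\<close>)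
  then show "two_sided_ideal (free_algebra A) I \<and> linear_subspace (free_algebra A) I"
    using r by (auto simp: two_sided_ideal_def linear_subspace_def free_ideal_def intro: additive_subgroupI)
qed

text \<open>The embedding requires an ideal of the unital monoid algebra over all letters. Words
  with a letter outside \<open>A\<close> span an ideal, which is added to \<open>I\<close>. The
  empty word counts as a word over \<open>A\<close>, so elements of \<open>J\<close> have no
  constant term and \<open>J\<close> meets the free algebra exactly in \<open>I\<close>.\<close>

lemma free_ideal_extension:
  fixes I :: "('x free_word \<Rightarrow>\<^sub>0 'k::field) set"
  assumes I: "free_ideal A I"
  defines "J \<equiv> {x. restr (FWord ` {xs. set xs \<subseteq> A}) x \<in> I}"
  shows "0 \<in> J" "x \<in> J \<Longrightarrow> y \<in> J \<Longrightarrow> x + y \<in> J" "x \<in> J \<Longrightarrow> y * x \<in> J" "x \<in> J \<Longrightarrow> x * y \<in> J"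
    "z \<in> free_carrier A \<Longrightarrow> z \<in> J \<longleftrightarrow> z \<in> I"
proof -
  let ?S = "FWord ` {xs. set xs \<subseteq> A}"
  show "0 \<in> J" unfolding J_def using free_idealD(2)[OF I] by simp
  show add: "x \<in> J \<Longrightarrow> y \<in> J \<Longrightarrow> x + y \<in> J" for x y unfolding J_def using free_idealD(3)[OF I] by simp
  have app: "FWord xs + FWord ys \<in> ?S \<longleftrightarrow> set xs \<subseteq> A \<and> set ys \<subseteq> A" for xs ys by auto
  have one: "FWord [] = 0" by (simp add: zero_free_word_def)
  have l: "restr ?S (single (FWord xs) c * x) =
      (if set xs \<subseteq> A then single (FWord xs) c * restr ?S x else 0)"
    for xs and c :: 'k and x
  proof (induction x rule: poly_mapping_span_induct[where S = UNIV])
    case (step w d y)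
    obtain ys where "w = FWord ys" by (cases w)
    then show ?case using step app by (auto simp: distrib_left mult_single simp del: plus_free_word.simps)
  qed auto
  have r: "restr ?S (x * single (FWord xs) c) =
      (if set xs \<subseteq> A then restr ?S x * single (FWord xs) c else 0)"
    for xs and c :: 'k and x
  proof (induction x rule: poly_mapping_span_induct[where S = UNIV])
    case (step w d y)
    obtain ys where "w = FWord ys" by (cases w)
    then show ?case using step app by (auto simp: distrib_right mult_single simp del: plus_free_word.simps)
  qed auto
  have closed: "single (FWord xs) c * x \<in> I \<and> x * single (FWord xs) c \<in> I"
    if "x \<in> I" "set xs \<subseteq> A" for xs c x
    using that free_idealD(4-6)[OF I] free_algebra_single[of xs A c] single_zero_commute[of x c]
    by (cases "xs = []") (auto simp: one)
  show "y * x \<in> J" if "x \<in> J"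
  proof (induction y rule: poly_mapping_span_induct[where S = UNIV])
    case (step w c y)
    obtain ys where "w = FWord ys" by (cases w)
    then have "single w c * x \<in> J"
      using that l closed free_idealD(2)[OF I] by (auto simp: J_def)
    then show ?case using step add by (simp add: distrib_right)
  qed (use \<open>0 \<in> J\<close> in auto)
  show "x * y \<in> J" if "x \<in> J"
  proof (induction y rule: poly_mapping_span_induct[where S = UNIV])
    case (step w c y)
    obtain ys where "w = FWord ys" by (cases w)
    then have "x * single w c \<in> J"
      using that r closed free_idealD(2)[OF I] by (auto simp: J_def)
    then show ?case using step add by (simp add: distrib_left)
  qed (use \<open>0 \<in> J\<close> in auto)
  show "z \<in> J \<longleftrightarrow> z \<in> I" if "z \<in> free_carrier A"
  proof -
    have "keys z \<subseteq> ?S" using that unfolding carrier_free_algebra by blast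
    then show ?thesis by (simp add: J_def restr_same)
  qed
qed

lemma free_ideal_embedding:
  assumes I: "free_ideal A (I :: ('x free_word \<Rightarrow>\<^sub>0 'k::field) set)"
  shows "\<exists>\<phi> :: ('x free_word \<Rightarrow>\<^sub>0 'k) \<Rightarrow> ('x free_word, 'k) lin_endo.
    (\<forall>x y. \<phi> (x + y) = \<phi> x + \<phi> y) \<and> (\<forall>x y. \<phi> (x * y) = \<phi> x * \<phi> y) \<and>
    (\<forall>c x. \<phi> (single 0 c * x) = endo_scale c * \<phi> x) \<and>
    (\<forall>x\<in>free_carrier A. \<phi> x = 0 \<longleftrightarrow> x \<in> I)"
  using ideal_quotient_embedding[OF free_ideal_extension(1-4)[OF I]] free_ideal_extension(5)[OF I]
  by metis

section \<open>Degrees of words and homogeneous components\<close>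

fun word_degree :: "('x \<Rightarrow> int) \<Rightarrow> 'x free_word \<Rightarrow> int" where
  "word_degree d (FWord xs) = sum_list (map d xs)"

lemma word_degree_add: "word_degree d (u + w) = word_degree d u + word_degree d w"
  by (cases u; cases w) simp

definition component :: "('x \<Rightarrow> int) \<Rightarrow> int \<Rightarrow> ('x free_word \<Rightarrow>\<^sub>0 'k::field) \<Rightarrow> ('x free_word \<Rightarrow>\<^sub>0 'k)" where
  "component d n x = restr {w. word_degree d w = n} x"

lemma component_add: "component d n (x + y) = component d n x + component d n y"
  by (simp add: component_def)

lemma component_zero: "component d n 0 = 0"
  by (simp add: component_def)

lemma component_single_mult:
  "component d n (single w c * x) = single w c * component d (n - word_degree d w) x"
proof (induction x rule: poly_mapping_span_induct[where S = UNIV])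
  case (step u b y)
  then show ?case
    by (auto simp: distrib_left component_add mult_single) (auto simp: component_def word_degree_add mult_single)
qed (auto simp: component_zero)

lemma component_mult_single:
  "component d n (x * single w c) = component d (n - word_degree d w) x * single w c"
proof (induction x rule: poly_mapping_span_induct[where S = UNIV])
  case (step u b y)
  then show ?case
    by (auto simp: distrib_right component_add mult_single) (auto simp: component_def word_degree_add mult_single)
qed (auto simp: component_zero)

lemma component_carrier: "x \<in> free_carrier A \<Longrightarrow> component d n x \<in> free_carrier A"
  unfolding carrier_free_algebra component_def keys_restr by blast

lemma sum_components:
  "(\<Sum>n\<in>word_degree d ` keys x. component d n x) = x"
proof (rule poly_mapping_eqI)
  fix w
  have "(\<Sum>n\<in>word_degree d ` keys x. lookup x w when word_degree d w = n) =
      lookup x w"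
    by (cases "w \<in> keys x") (auto simp: when_def in_keys_iff)
  then show "lookup (\<Sum>n\<in>word_degree d ` keys x. component d n x) w = lookup x w"
    by (simp add: lookup_sum component_def lookup_restr)
qed

definition homogeneous :: "('x \<Rightarrow> int) \<Rightarrow> int \<Rightarrow> ('x free_word \<Rightarrow>\<^sub>0 'k::field) \<Rightarrow> bool" where
  "homogeneous d n x \<longleftrightarrow> (\<forall>w\<in>keys x. word_degree d w = n)"

lemma component_homogeneous: "homogeneous d m x \<Longrightarrow> component d n x = (if n = m then x else 0)"
  unfolding homogeneous_def component_def by (auto intro: restr_same restr_disjoint)

lemma homogeneous_component: "homogeneous d n (component d n x)"
  unfolding homogeneous_def component_def keys_restr by auto

lemma homogeneous_add: "homogeneous d n x \<Longrightarrow> homogeneous d n y \<Longrightarrow> homogeneous d n (x + y)"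
  unfolding homogeneous_def using keys_add[of x y] by blast

lemma homogeneous_scale: "homogeneous d n x \<Longrightarrow> homogeneous d n (single 0 c * x)"
  unfolding homogeneous_def using keys_mult[of "single 0 c" x] by (auto split: if_splits)

lemma homogeneous_diff: "homogeneous d n x \<Longrightarrow> homogeneous d n y \<Longrightarrow> homogeneous d n (x - y)"
  using homogeneous_add[OF _ homogeneous_scale, of d n x y "- 1"] by (simp add: scale_minus_one)

lemma homogeneous_zero: "homogeneous d n 0"
  by (simp add: homogeneous_def)

lemma homogeneous_sum: "(\<And>i. i \<in> B \<Longrightarrow> homogeneous d n (f i)) \<Longrightarrow> homogeneous d n (sum f B)"
  by (induction B rule: infinite_finite_induct) (auto intro: homogeneous_zero homogeneous_add)

lemma homogeneous_mult: "homogeneous d m x \<Longrightarrow> homogeneous d n y \<Longrightarrow> homogeneous d (m + n) (x * y)"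
  unfolding homogeneous_def using keys_mult[of x y] by (auto simp: word_degree_add dest!: subsetD)

lemma homogeneous_var: "homogeneous d (d g) (free_var g)"
  by (simp add: homogeneous_def free_var_def)

text \<open>For an ideal \<open>I\<close> this is the ideal generated by its homogeneous elements,
  in a form that allows membership to be tested on components.\<close>

definition homogeneous_core :: "'x set \<Rightarrow> ('x \<Rightarrow> int) \<Rightarrow> ('x free_word \<Rightarrow>\<^sub>0 'k::field) set \<Rightarrow> ('x free_word \<Rightarrow>\<^sub>0 'k) set" where
  "homogeneous_core A d I = {x \<in> free_carrier A. \<forall>n. component d n x \<in> I}"

text \<open>By linearity only multiplication by single words matters, and this merely shifts the
  degrees of the components.\<close>

lemma homogeneous_core_ideal:
  assumes I: "free_ideal A I"
  shows "free_ideal A (homogeneous_core A d I)"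
proof -
  have "y * x \<in> homogeneous_core A d I \<and> x * y \<in> homogeneous_core A d I"
    if x: "x \<in> homogeneous_core A d I" and y: "y \<in> free_carrier A" for x y
    using y
  proof (induction rule: free_algebra_induct)
    case zero
    then show ?case using free_idealD(2)[OF I] by (simp add: homogeneous_core_def component_zero free_algebra_zero)
  next
    case (step xs c y)
    let ?s = "single (FWord xs) c"
    have s: "?s \<in> free_carrier A" using step by (intro free_algebra_single)
    then have "?s * x \<in> homogeneous_core A d I \<and> x * ?s \<in> homogeneous_core A d I"
      using x free_idealD(5,6)[OF I]
      by (auto simp: homogeneous_core_def component_single_mult component_mult_single intro: free_algebra_mult)
    then show ?case using step.IH free_idealD(3)[OF I]
      by (auto simp: homogeneous_core_def distrib_left distrib_right component_add intro: free_algebra_add)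
  qed
  moreover have "component d n (single 0 c * x) = single 0 c * component d n x"
    for n c and x :: "'a free_word \<Rightarrow>\<^sub>0 'b"
    by (simp add: component_single_mult zero_free_word_def)
  ultimately show ?thesis
    using free_idealD(2-4)[OF I]
    by (auto simp: free_ideal_def homogeneous_core_def component_add component_zero
        intro: free_algebra_zero free_algebra_add free_algebra_scale)
qed

section \<open>Cosets modulo an ideal of the free algebra\<close>

locale free_quotient =
  fixes A :: "'x set" and N :: "('x free_word \<Rightarrow>\<^sub>0 'k::field) set"
  assumes N: "free_ideal A N"
begin

abbreviation Q :: "('k, ('x free_word \<Rightarrow>\<^sub>0 'k) set) module" where
  "Q \<equiv> quotient_algebra (free_algebra A) N"

definition cl :: "('x free_word \<Rightarrow>\<^sub>0 'k) \<Rightarrow> ('x free_word \<Rightarrow>\<^sub>0 'k) set" where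
  "cl x = N +>\<^bsub>free_algebra A\<^esub> x"

lemma mem_cl: "z \<in> cl x \<longleftrightarrow> z - x \<in> N"
  by (auto simp: cl_def a_r_coset_def r_coset_def intro!: bexI[of _ "z - x"])

lemma cl_eq_iff: "cl x = cl y \<longleftrightarrow> x - y \<in> N"
proof
  assume "cl x = cl y"
  moreover have "x \<in> cl x" using free_idealD(2)[OF N] by (simp add: mem_cl)
  ultimately show "x - y \<in> N" by (simp add: mem_cl)
next
  assume h: "x - y \<in> N"
  have "z - x \<in> N \<longleftrightarrow> z - y \<in> N" for z
    using free_idealD(3)[OF N _ h, of "z - x"] free_idealD(8)[OF N _ h, of "z - y"] by auto
  then show "cl x = cl y" by (auto simp: mem_cl)
qed

lemma carrier_Q: "carrier Q = cl ` free_carrier A"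
  by (auto simp: quotient_algebra_def ring.defs FactRing_def A_RCOSETS_def RCOSETS_def cl_def a_r_coset_def)

lemma zero_Q: "\<zero>\<^bsub>Q\<^esub> = cl 0"
  by (auto simp: quotient_algebra_def ring.defs FactRing_def mem_cl)

lemma add_Q: "x \<in> free_carrier A \<Longrightarrow> y \<in> free_carrier A \<Longrightarrow> cl x \<oplus>\<^bsub>Q\<^esub> cl y = cl (x + y)"
proof -
  have "cl x \<oplus>\<^bsub>Q\<^esub> cl y = (\<Union>a\<in>cl x. \<Union>b\<in>cl y. {a + b})"
    by (simp add: quotient_algebra_def ring.defs FactRing_def set_add_def set_mult_def)
  then have "z \<in> cl x \<oplus>\<^bsub>Q\<^esub> cl y \<longleftrightarrow> (\<exists>a b. a - x \<in> N \<and> b - y \<in> N \<and> z = a + b)" for z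
    by (simp add: mem_cl Bex_def)
  moreover have "(\<exists>a b. a - x \<in> N \<and> b - y \<in> N \<and> z = a + b) \<longleftrightarrow> z - (x + y) \<in> N" for z
  proof
    assume "\<exists>a b. a - x \<in> N \<and> b - y \<in> N \<and> z = a + b"
    then obtain a b where ab: "a - x \<in> N" "b - y \<in> N" "z = a + b" by blast
    have "z - (x + y) = (a - x) + (b - y)" using ab by simp
    then show "z - (x + y) \<in> N" using free_idealD(3)[OF N ab(1,2)] by (simp only:)
  next
    assume "z - (x + y) \<in> N"
    then show "\<exists>a b. a - x \<in> N \<and> b - y \<in> N \<and> z = a + b"
      using free_idealD(2)[OF N] by (intro exI[of _ x] exI[of _ "z - x"]) (auto simp: algebra_simps)
  qed
  ultimately show ?thesis unfolding set_eq_iff mem_cl by blast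
qed

lemma mult_Q:
  assumes "x \<in> free_carrier A" "y \<in> free_carrier A"
  shows "cl x \<otimes>\<^bsub>Q\<^esub> cl y = cl (x * y)"
proof -
  have "cl x \<otimes>\<^bsub>Q\<^esub> cl y = (\<Union>a\<in>cl x. \<Union>b\<in>cl y. cl (a * b))"
    by (simp add: quotient_algebra_def ring.defs FactRing_def rcoset_mult_def cl_def)
  also have "cl (a * b) = cl (x * y)" if "a \<in> cl x" "b \<in> cl y" for a b
  proof -
    have ab: "a - x \<in> N" "b - y \<in> N" using that by (auto simp: mem_cl)
    then have "a \<in> free_carrier A"
      using free_algebra_add[OF free_idealD(1)[OF N ab(1)] assms(1)] by simp
    then have "a * (b - y) \<in> N" "(a - x) * y \<in> N"
      using free_idealD(5)[OF N ab(2)] free_idealD(6)[OF N ab(1) assms(2)] by auto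
    then have "a * (b - y) + (a - x) * y \<in> N" by (rule free_idealD(3)[OF N])
    then show ?thesis by (simp add: cl_eq_iff algebra_simps)
  qed
  then have "(\<Union>a\<in>cl x. \<Union>b\<in>cl y. cl (a * b)) = (\<Union>a\<in>cl x. \<Union>b\<in>cl y. cl (x * y))" by simp
  also have "\<dots> = cl (x * y)"
  proof -
    have "x \<in> cl x" "y \<in> cl y" using free_idealD(2)[OF N] by (auto simp: mem_cl)
    then show ?thesis by auto
  qed
  finally show ?thesis .
qed

lemma smult_Q:
  assumes "x \<in> free_carrier A"
  shows "c \<odot>\<^bsub>Q\<^esub> cl x = cl (single 0 c * x)"
proof -
  have eq: "c \<odot>\<^bsub>Q\<^esub> cl x = (\<Union>z\<in>cl x. cl (single 0 c * z))"
    by (simp add: quotient_algebra_def ring.defs cl_def)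
  have "cl (single 0 c * z) = cl (single 0 c * x)" if "z \<in> cl x" for z
  proof -
    have "single 0 c * (z - x) \<in> N" using that free_idealD(4)[OF N] by (simp add: mem_cl)
    then show ?thesis by (simp add: cl_eq_iff right_diff_distrib)
  qed
  then have "(\<Union>z\<in>cl x. cl (single 0 c * z)) = (\<Union>z\<in>cl x. cl (single 0 c * x))"
    by (rule SUP_cong[OF refl])
  moreover have "x \<in> cl x" using free_idealD(2)[OF N] by (simp add: mem_cl)
  then have "(\<Union>z\<in>cl x. cl (single 0 c * x)) = cl (single 0 c * x)" by blast
  ultimately show ?thesis using eq by simp
qed

lemma abelian_group_Q: "abelian_group Q"
proof (rule abelian_groupI)
  fix X assume "X \<in> carrier Q"
  then obtain x where x: "X = cl x" "x \<in> free_carrier A" by (auto simp: carrier_Q)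
  then show "\<exists>Y\<in>carrier Q. Y \<oplus>\<^bsub>Q\<^esub> X = \<zero>\<^bsub>Q\<^esub>"
    using free_algebra_uminus[OF x(2)]
    by (intro bexI[of _ "cl (- x)"]) (auto simp: add_Q zero_Q carrier_Q)
qed (auto simp: carrier_Q add_Q zero_Q free_algebra_add free_algebra_zero algebra_simps)

lemma a_inv_Q: "x \<in> free_carrier A \<Longrightarrow> \<ominus>\<^bsub>Q\<^esub> cl x = cl (- x)"
  by (rule abelian_group.minus_equality[OF abelian_group_Q])
    (auto simp: add_Q zero_Q carrier_Q free_algebra_uminus)

lemma finsum_Q:
  assumes "finite M" "\<And>i. i \<in> M \<Longrightarrow> f i \<in> free_carrier A"
  shows "finsum Q (\<lambda>i. cl (f i)) M = cl (sum f M)"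
proof -
  interpret abelian_group Q by (rule abelian_group_Q)
  show ?thesis
    using assms by (induction rule: finite_induct)
      (auto simp: zero_Q add_Q carrier_Q free_algebra_sum Pi_def)
qed

definition pull :: "('x free_word \<Rightarrow>\<^sub>0 'k) set set \<Rightarrow> ('x free_word \<Rightarrow>\<^sub>0 'k) set" where
  "pull P = {x \<in> free_carrier A. cl x \<in> P}"

text \<open>Closure under scalars comes from the local units: if \<open>u * x\<close> and
  \<open>x\<close> have the same class, then a scalar multiple of \<open>x\<close> has the class of
  the scaled \<open>u\<close> times \<open>x\<close>.\<close>

lemma pull_ideal:
  assumes "two_sided_ideal Q P"
    and units: "\<And>x. x \<in> free_carrier A \<Longrightarrow> \<exists>u\<in>free_carrier A. u * x - x \<in> N"
  shows "free_ideal A (pull P)" "N \<subseteq> pull P" "P = cl ` pull P"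
proof -
  interpret additive_subgroup P Q using assms by (simp add: two_sided_ideal_def)
  have P: "X \<otimes>\<^bsub>Q\<^esub> Y \<in> P" "Y \<otimes>\<^bsub>Q\<^esub> X \<in> P" if "Y \<in> P" "X \<in> carrier Q" for X Y
    using assms(1) that by (auto simp: two_sided_ideal_def)
  have mult: "y * x \<in> pull P" "x * y \<in> pull P" if "x \<in> pull P" "y \<in> free_carrier A" for x y
    using that P[of "cl x" "cl y"] by (auto simp: pull_def mult_Q carrier_Q free_algebra_mult)
  have scale: "single 0 c * x \<in> pull P" if x: "x \<in> pull P" for c x
  proof -
    have x': "x \<in> free_carrier A" using x by (simp add: pull_def)
    then obtain u where u: "u \<in> free_carrier A" "u * x - x \<in> N" using units by blast
    have "(single 0 c * u) * x \<in> pull P"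
      by (rule mult(1)[OF x free_algebra_scale[OF u(1)]])
    moreover have "cl ((single 0 c * u) * x) = cl (single 0 c * x)"
      using free_idealD(4)[OF N u(2), of c] by (simp add: cl_eq_iff algebra_simps)
    ultimately show ?thesis using x' by (simp add: pull_def free_algebra_scale)
  qed
  have "0 \<in> pull P" using zero_closed by (simp add: pull_def zero_Q free_algebra_zero)
  moreover have "x + y \<in> pull P" if "x \<in> pull P" "y \<in> pull P" for x y
    using that a_closed[of "cl x" "cl y"] by (simp add: pull_def add_Q free_algebra_add)
  ultimately show "free_ideal A (pull P)"
    using mult scale unfolding free_ideal_def by (auto simp: pull_def)
  show "N \<subseteq> pull P"
  proof
    fix x assume x: "x \<in> N"
    then have "cl x = cl 0" by (simp add: cl_eq_iff)
    then show "x \<in> pull P" using zero_closed free_idealD(1)[OF N x] by (simp add: pull_def zero_Q)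
  qed
  show "P = cl ` pull P" using a_subset by (auto simp: pull_def carrier_Q)
qed

lemma image_subgroup:
  assumes U: "U \<subseteq> free_carrier A" "0 \<in> U" "\<And>x y. x \<in> U \<Longrightarrow> y \<in> U \<Longrightarrow> x + y \<in> U" "\<And>x. x \<in> U \<Longrightarrow> - x \<in> U"
  shows "additive_subgroup (cl ` U) Q"
proof (rule additive_subgroupI, rule group.subgroupI)
  interpret abelian_group Q by (rule abelian_group_Q)
  show "group (add_monoid Q)" by (rule a_group)
  show "cl ` U \<subseteq> carrier (add_monoid Q)" "cl ` U \<noteq> {}" using U by (auto simp: carrier_Q)
  fix X assume "X \<in> cl ` U"
  then obtain x where x: "X = cl x" "x \<in> U" by auto
  have "inv\<^bsub>add_monoid Q\<^esub> X = cl (- x)" using a_inv_Q[of x] U(1) x by (auto simp: a_inv_def)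
  then show "inv\<^bsub>add_monoid Q\<^esub> X \<in> cl ` U" using U(4)[OF x(2)] by simp
  fix Y assume "Y \<in> cl ` U"
  then obtain y where y: "Y = cl y" "y \<in> U" by auto
  have "X \<otimes>\<^bsub>add_monoid Q\<^esub> Y = cl (x + y)" using add_Q[of x y] U(1) x y by auto
  then show "X \<otimes>\<^bsub>add_monoid Q\<^esub> Y \<in> cl ` U" using U(3)[OF x(2) y(2)] by simp
qed

lemma image_ideal:
  assumes I: "free_ideal A I" "N \<subseteq> I"
  shows "two_sided_ideal Q (cl ` I)" "x \<in> free_carrier A \<Longrightarrow> cl x \<in> cl ` I \<longleftrightarrow> x \<in> I"
proof -
  have car: "x \<in> free_carrier A" if "x \<in> I" for x using free_idealD(1)[OF I(1) that] .
  show "two_sided_ideal Q (cl ` I)"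
    using free_idealD(5,6)[OF I(1)] car image_subgroup[OF subsetI[OF car] free_idealD(2,3,7)[OF I(1)]]
    by (auto simp: two_sided_ideal_def carrier_Q mult_Q)
  show "cl x \<in> cl ` I \<longleftrightarrow> x \<in> I" if "x \<in> free_carrier A"
  proof
    assume "cl x \<in> cl ` I"
    then obtain y where "y \<in> I" "x - y \<in> N" by (auto simp: cl_eq_iff)
    then show "x \<in> I" using free_idealD(3)[OF I(1), of "x - y" y] I(2) by auto
  qed auto
qed

end

section \<open>Ideals of the Leavitt path algebra\<close>

lemma free_ideal_Inter:
  fixes \<C> :: "('x free_word \<Rightarrow>\<^sub>0 'k::field) set set"
  assumes "C \<in> \<C>" "\<And>I. I \<in> \<C> \<Longrightarrow> free_ideal A I"
  shows "free_ideal A (\<Inter>\<C>)"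
  unfolding free_ideal_def
proof (intro conjI ballI allI)
  show "\<Inter>\<C> \<subseteq> free_carrier A" using free_idealD(1)[OF assms(2)[OF assms(1)]] assms(1) by blast
  fix x assume x: "x \<in> \<Inter>\<C>"
  show "single 0 c * x \<in> \<Inter>\<C>" for c using free_idealD(4)[OF assms(2)] x by auto
  show "x + y \<in> \<Inter>\<C>" if "y \<in> \<Inter>\<C>" for y using free_idealD(3)[OF assms(2)] x that by auto
  fix y :: "'x free_word \<Rightarrow>\<^sub>0 'k" assume "y \<in> free_carrier A"
  then show "y * x \<in> \<Inter>\<C>" "x * y \<in> \<Inter>\<C>" using free_idealD(5,6)[OF assms(2)] x by auto
qed (use free_idealD(2)[OF assms(2)] in auto)

context ultragraph
begin

text \<open>The relations compare terms of equal degree, which is what makes the ideal of relations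
  graded. \<open>H\<close> carries membership and homogeneity through the cases together.\<close>

lemma relator_carrier_homogeneous:
  fixes r :: "('v, 'e, 'k::field) lpa_free"
  assumes "r \<in> lpa_relators G"
  shows "r \<in> free_carrier (lpa_gens G)" "\<exists>n. homogeneous gen_degree n r"
proof -
  define H where "H n r \<longleftrightarrow> r \<in> free_carrier (lpa_gens G) \<and> homogeneous gen_degree n r"
    for n and r :: "('v, 'e, 'k) lpa_free"
  have p: "A \<in> gen_verts G \<Longrightarrow> H 0 (pp A)" for A
    using homogeneous_var[of gen_degree "GenP A"] by (auto simp: H_def lpa_gens_def intro!: free_algebra_var)
  have s: "e \<in> edges G \<Longrightarrow> H 1 (ss e)" for e
    using homogeneous_var[of gen_degree "GenS e"] by (auto simp: H_def lpa_gens_def intro!: free_algebra_var)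
  have t: "e \<in> edges G \<Longrightarrow> H (- 1) (ss_star e)" for e
    using homogeneous_var[of gen_degree "GenSstar e"] by (auto simp: H_def lpa_gens_def intro!: free_algebra_var)
  have z: "H n 0" for n by (simp add: H_def free_algebra_zero homogeneous_zero)
  have d: "H n (x - y)" if "H n x" "H n y" for n x y
    using that by (simp add: H_def free_algebra_diff homogeneous_diff)
  have a: "H n (x + y)" if "H n x" "H n y" for n x y
    using that by (simp add: H_def free_algebra_add homogeneous_add)
  have m: "H k (x * y)" if "H m x" "H n y" "m + n = k" for m n k x y
    using that free_algebra_mult homogeneous_mult unfolding H_def by blast
  have src: "e \<in> edges G \<Longrightarrow> {src G e} \<in> gen_verts G" for e
    by (simp add: gen_verts.vertex src_in_verts)
  have rng: "e \<in> edges G \<Longrightarrow> rng G e \<in> gen_verts G" for e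
    by (rule gen_verts.range)
  have "H 0 r \<or> H 1 r \<or> H (- 1) r"
    using assms
  proof cases
    case p_empty
    then show ?thesis using p gen_verts.empty by blast
  next
    case (p_inter A B)
    then show ?thesis using d[OF m[OF p p] p] gen_verts.inter[OF p_inter(2,3)] by simp
  next
    case (p_union A B)
    then show ?thesis using d[OF p d[OF a[OF p p] p]] gen_verts.inter[OF p_union(2,3)] gen_verts.union[OF p_union(2,3)] by simp
  next
    case (src_s e)
    then show ?thesis using d[OF m[OF p s] s] src by simp
  next
    case (s_rng e)
    then show ?thesis using d[OF m[OF s p] s] rng by simp
  next
    case (rng_star e)
    then show ?thesis using d[OF m[OF p t] t] rng by simp
  next
    case (star_src e)
    then show ?thesis using d[OF m[OF t p] t] src by simp
  next
    case (star_s e f)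
    have "H 0 (ss_star e * ss f)" using m[OF t s] star_s by simp
    moreover have "H 0 (if e = f then pp (rng G e) else 0)" using p rng z star_s by simp
    ultimately show ?thesis using d star_s by simp
  next
    case (regular v)
    have "H 0 (ss e * ss_star e)" if "e \<in> {e \<in> edges G. src G e = v}" for e
      using m[OF s t] that by simp
    then have "H 0 (\<Sum>e\<in>{e \<in> edges G. src G e = v}. ss e * ss_star e)"
      unfolding H_def by (intro conjI free_algebra_sum homogeneous_sum) blast+
    moreover have "H 0 (pp {v})" using regular by (intro p gen_verts.vertex) (simp add: regular_vertex_def)
    ultimately show ?thesis using d regular by simp
  qed
  then show "r \<in> free_carrier (lpa_gens G)" "\<exists>n. homogeneous gen_degree n r"
    unfolding H_def by blast+
qed

lemma free_ideal_lpa_ideal: "free_ideal (lpa_gens G) (lpa_ideal G)"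
proof -
  let ?A = "lpa_gens G"
  have F: "free_ideal ?A (free_carrier ?A)"
    by (auto simp: free_ideal_def intro: free_algebra_zero free_algebra_add free_algebra_scale free_algebra_mult)
  have eq: "lpa_ideal G = \<Inter>{I. free_ideal ?A I \<and> lpa_relators G \<subseteq> I}"
    by (simp add: lpa_ideal_def algebra_ideal_generated_def free_ideal_iff[symmetric] conj_assoc)
  show ?thesis
    unfolding eq
  proof (rule free_ideal_Inter)
    show "free_carrier ?A \<in> {I. free_ideal ?A I \<and> lpa_relators G \<subseteq> I}"
      using F relator_carrier_homogeneous(1) by blast
  qed blast
qed

lemma lpa_relators_subset: "lpa_relators G \<subseteq> lpa_ideal G"
  by (auto simp: lpa_ideal_def algebra_ideal_generated_def)

lemma lpa_ideal_minimal: "free_ideal (lpa_gens G) I \<Longrightarrow> lpa_relators G \<subseteq> I \<Longrightarrow> lpa_ideal G \<subseteq> I"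
  using free_ideal_iff[of "lpa_gens G" I] by (auto simp: lpa_ideal_def algebra_ideal_generated_def)

text \<open>The components of a homogeneous relator are the relator itself and 0. Hence the
  relations still hold modulo the core, and the ideal of relations is contained in its own
  core.\<close>

lemma lpa_relators_core:
  fixes I :: "('v, 'e, 'k::field) lpa_free set"
  assumes "free_ideal (lpa_gens G) I" "lpa_relators G \<subseteq> I"
  shows "lpa_relators G \<subseteq> homogeneous_core (lpa_gens G) gen_degree I"
proof
  fix r :: "('v, 'e, 'k) lpa_free" assume r: "r \<in> lpa_relators G"
  obtain m where "homogeneous gen_degree m r" using relator_carrier_homogeneous(2)[OF r] by blast
  then have "component gen_degree n r \<in> I" for n
    using component_homogeneous[of gen_degree m r n] r assms free_idealD(2)[OF assms(1)] by auto
  then show "r \<in> homogeneous_core (lpa_gens G) gen_degree I"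
    using relator_carrier_homogeneous(1)[OF r] by (simp add: homogeneous_core_def)
qed

end

text \<open>The image of the free algebra is a copy of its quotient by \<open>J\<close>. This is
  used both for the ideal of relations and for the core of a larger ideal.\<close>

locale lpa_embedding = leavitt_family G endo_scale "\<lambda>A. \<phi> (pp A)" "\<lambda>e. \<phi> (ss e)" "\<lambda>e. \<phi> (ss_star e)"
  for G :: "('v, 'e) pre_ultragraph"
    and \<phi> :: "('v, 'e, 'k::field) lpa_free \<Rightarrow> (('v, 'e) lpa_gen free_word, 'k) lin_endo" +
  fixes J :: "('v, 'e, 'k) lpa_free set"
  assumes \<phi>_add: "\<phi> (x + y) = \<phi> x + \<phi> y" and \<phi>_mult: "\<phi> (x * y) = \<phi> x * \<phi> y"
    and \<phi>_scale: "\<phi> (single 0 c * x) = endo_scale c * \<phi> x"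
    and \<phi>_zero_iff: "x \<in> free_carrier (lpa_gens G) \<Longrightarrow> \<phi> x = 0 \<longleftrightarrow> x \<in> J"

lemma (in ultragraph) lpa_embedding_exists:
  fixes J :: "('v, 'e, 'k::field) lpa_free set"
  assumes J: "free_ideal (lpa_gens G) J" and rel: "lpa_relators G \<subseteq> J"
  shows "\<exists>\<phi>. lpa_embedding G \<phi> J"
proof -
  obtain \<phi> :: "('v, 'e, 'k) lpa_free \<Rightarrow> (('v, 'e) lpa_gen free_word, 'k) lin_endo"
    where add: "\<And>x y. \<phi> (x + y) = \<phi> x + \<phi> y" and mult: "\<And>x y. \<phi> (x * y) = \<phi> x * \<phi> y"
      and scale: "\<And>c x. \<phi> (single 0 c * x) = endo_scale c * \<phi> x"
      and zero: "\<And>x. x \<in> free_carrier (lpa_gens G) \<Longrightarrow> \<phi> x = 0 \<longleftrightarrow> x \<in> J"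
    using free_ideal_embedding[OF J] by blast
  have z: "\<phi> 0 = 0" using add[of 0 0] by simp
  have diff: "\<phi> (x - y) = \<phi> x - \<phi> y" for x y using add[of "x - y" y] by simp
  have rel0: "\<phi> r = 0" if "r \<in> lpa_relators G" for r
    using that rel zero relator_carrier_homogeneous(1) by blast
  have "leavitt_family G endo_scale (\<lambda>A. \<phi> (pp A)) (\<lambda>e. \<phi> (ss e)) (\<lambda>e. \<phi> (ss_star e))"
  proof (intro leavitt_family.intro leavitt_family_axioms.intro ultragraph_axioms)
    show "\<phi> (pp {}) = 0" using rel0 lpa_relators.p_empty by blast
    fix A B assume AB: "A \<in> gen_verts G" "B \<in> gen_verts G"
    show "\<phi> (pp A) * \<phi> (pp B) = \<phi> (pp (A \<inter> B))"
      using rel0[OF lpa_relators.p_inter[OF AB]] by (simp add: diff mult)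
    show "\<phi> (pp (A \<union> B)) = \<phi> (pp A) + \<phi> (pp B) - \<phi> (pp (A \<inter> B))"
      using rel0[OF lpa_relators.p_union[OF AB]] by (simp add: diff add)
  next
    fix e assume e: "e \<in> edges G"
    show "\<phi> (pp {src G e}) * \<phi> (ss e) = \<phi> (ss e)" using rel0[OF lpa_relators.src_s[OF e]] by (simp add: diff mult)
    show "\<phi> (ss e) * \<phi> (pp (rng G e)) = \<phi> (ss e)" using rel0[OF lpa_relators.s_rng[OF e]] by (simp add: diff mult)
    show "\<phi> (pp (rng G e)) * \<phi> (ss_star e) = \<phi> (ss_star e)"
      using rel0[OF lpa_relators.rng_star[OF e]] by (simp add: diff mult)
    show "\<phi> (ss_star e) * \<phi> (pp {src G e}) = \<phi> (ss_star e)"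
      using rel0[OF lpa_relators.star_src[OF e]] by (simp add: diff mult)
    fix f assume f: "f \<in> edges G"
    show "\<phi> (ss_star e) * \<phi> (ss f) = (if e = f then \<phi> (pp (rng G e)) else 0)"
      using rel0[OF lpa_relators.star_s[OF e f]] z by (simp add: diff mult split: if_splits)
  qed (rule endo_scale_simps)+
  then have "lpa_embedding G \<phi> J"
    by (intro lpa_embedding.intro lpa_embedding_axioms.intro) (use add mult scale zero in auto)
  then show ?thesis by blast
qed

context lpa_embedding
begin

lemma \<phi>_zero: "\<phi> 0 = 0"
  using \<phi>_add[of 0 0] by simp

lemma \<phi>_diff: "\<phi> (x - y) = \<phi> x - \<phi> y"
  using \<phi>_add[of "x - y" y] by simp

lemma \<phi>_sum: "\<phi> (sum f M) = (\<Sum>i\<in>M. \<phi> (f i))"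
  by (induction M rule: infinite_finite_induct) (auto simp: \<phi>_zero \<phi>_add)

lemma \<phi>_gen: "\<phi> (free_var g) = gen_val g"
  by (cases g) simp_all

lemma \<phi>_word:
  "w \<noteq> [] \<Longrightarrow> \<phi> (single (FWord w) c) = endo_scale c * prod_list (map gen_val w)"
proof (induction w rule: list_nonempty_induct)
  case (single g)
  have "single (FWord [g]) c = single 0 c * free_var g"
    by (simp add: free_var_def mult_single)
  then have "\<phi> (single (FWord [g]) c) = endo_scale c * gen_val g"
    by (metis \<phi>_scale \<phi>_gen)
  then show ?case by simp
next
  case (cons g w)
  have "single (FWord (g # w)) c = free_var g * single (FWord w) c"
    by (simp add: free_var_def mult_single)
  then have "\<phi> (single (FWord (g # w)) c) = gen_val g * (endo_scale c * prod_list (map gen_val w))"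
    by (metis \<phi>_mult \<phi>_gen cons.IH)
  then show ?case by (simp only: \<kappa>_left_comm list.map prod_list.Cons)
qed

lemma \<phi>_paths:
  "es \<noteq> [] \<Longrightarrow> \<phi> (prod_list (map ss es)) = sp es"
  "es \<noteq> [] \<Longrightarrow> \<phi> (prod_list (map ss_star (rev es))) = tp es"
proof -
  show "\<phi> (prod_list (map ss es)) = sp es" if "es \<noteq> []"
    using that by (induction es rule: list_nonempty_induct) (auto simp: \<phi>_mult)
  show "\<phi> (prod_list (map ss_star (rev es))) = tp es" if "es \<noteq> []"
    using that by (induction es rule: list_nonempty_induct) (auto simp: \<phi>_mult)
qed

lemma homogeneous_in_mspan:
  assumes "x \<in> free_carrier (lpa_gens G)" "homogeneous gen_degree n x"
  shows "\<phi> x \<in> mspan (\<lambda>i j. int i - int j = n)"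
proof (induction x rule: poly_mapping_span_induct[where
      S = "{FWord w |w. w \<noteq> [] \<and> set w \<subseteq> lpa_gens G \<and> sum_list (map gen_degree w) = n}"])
  case keys
  show ?case
  proof
    fix u assume u: "u \<in> keys x"
    then obtain w where "u = FWord w" "w \<noteq> []" "set w \<subseteq> lpa_gens G"
      using assms(1) unfolding carrier_free_algebra by blast
    moreover have "word_degree gen_degree u = n" using u assms(2) by (simp add: homogeneous_def)
    ultimately show "u \<in> {FWord w |w. w \<noteq> [] \<and> set w \<subseteq> lpa_gens G \<and> sum_list (map gen_degree w) = n}"
      by auto
  qed
next
  case zero
  then show ?case by (simp add: \<phi>_zero mspan_zero)
next
  case (step u c y)
  then obtain w where w: "u = FWord w" "w \<noteq> []" "set w \<subseteq> lpa_gens G" "sum_list (map gen_degree w) = n"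
    by blast
  have "prod_list (map gen_val w) \<in> mspan (\<lambda>i j. int i - int j = n)"
    using word_val_mspan[OF w(2,3)] w(4) by simp
  then show ?case using step w by (simp add: \<phi>_add \<phi>_word mspan_add mspan_scale)
qed

text \<open>A monomial is the value of an explicit word: the edges of \<alpha>, one projection, then
  the starred edges of \<beta> in reversed order. The difference of the lengths is the degree of
  that word.\<close>

lemma mspan_homogeneous:
  assumes "z \<in> mspan (\<lambda>i j. int i - int j = n)"
  shows "\<exists>x\<in>free_carrier (lpa_gens G). homogeneous gen_degree n x \<and> z = \<phi> x"
  using assms
proof (induction rule: mspan_induct)
  case zero
  show ?case using free_algebra_zero homogeneous_zero \<phi>_zero by metis
next
  case (step \<alpha> A \<beta> y c)
  then obtain x where x: "x \<in> free_carrier (lpa_gens G)" "homogeneous gen_degree n x" "y = \<phi> x" by blast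
  define w where "w = map GenS \<alpha> @ [GenP A] @ map GenSstar (rev \<beta>)"
  have w: "w \<noteq> []" "set w \<subseteq> lpa_gens G" using step by (auto simp: w_def lpa_gens_def)
  have deg: "sum_list (map gen_degree w) = n"
    using step(4) by (simp add: w_def o_def sum_list_triv)
  have val: "prod_list (map gen_val w) = mon \<alpha> A \<beta>"
    by (simp add: w_def o_def mon_def sp_def tp_def mult.assoc)
  have "homogeneous gen_degree n (single (FWord w) c)" using deg by (simp add: homogeneous_def)
  then show ?case using x w
    by (intro bexI[of _ "single (FWord w) c + x"])
      (auto simp: \<phi>_add \<phi>_word val intro: homogeneous_add free_algebra_add free_algebra_single)
qed

end

text \<open>Modulo its core \<open>J\<close>, the ideal \<open>I\<close> has no nonzero homogeneous
  element, and \<open>ideal_trivial\<close> makes its image zero. So \<open>I\<close> equals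
  \<open>J\<close>, which contains the components of its elements by definition.\<close>

lemma (in ultragraph) ideal_homogeneous:
  fixes I :: "('v, 'e, 'k::field) lpa_free set"
  assumes K: "condition_K G" and I: "free_ideal (lpa_gens G) I" "lpa_relators G \<subseteq> I" and x: "x \<in> I"
  shows "component gen_degree n x \<in> I"
proof -
  let ?F = "free_carrier (lpa_gens G) :: ('v, 'e, 'k) lpa_free set"
  define J where "J = homogeneous_core (lpa_gens G) gen_degree I"
  have J: "free_ideal (lpa_gens G) J" "lpa_relators G \<subseteq> J"
    unfolding J_def using homogeneous_core_ideal[OF I(1)] lpa_relators_core[OF I] by auto
  have JI: "J \<subseteq> I"
  proof
    fix z assume "z \<in> J"
    then have "(\<Sum>n\<in>M. component gen_degree n z) \<in> I" for M
      using free_idealD(2,3)[OF I(1)] unfolding J_def homogeneous_core_def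
      by (induction M rule: infinite_finite_induct) auto
    then show "z \<in> I" using sum_components[of gen_degree z] by metis
  qed
  obtain \<phi> where "lpa_embedding G \<phi> J" using lpa_embedding_exists[OF J] by blast
  then interpret lpa_embedding G \<phi> J .
  have car: "z \<in> ?F" if "z \<in> I" for z using free_idealD(1)[OF I(1) that] .
  interpret L: leavitt_family_ideal G endo_scale "\<lambda>A. \<phi> (pp A)" "\<lambda>e. \<phi> (ss e)" "\<lambda>e. \<phi> (ss_star e)" "\<phi> ` I"
  proof
    show "0 \<in> \<phi> ` I" using \<phi>_zero free_idealD(2)[OF I(1)] by (metis image_eqI)
    show "X + Y \<in> \<phi> ` I" if "X \<in> \<phi> ` I" "Y \<in> \<phi> ` I" for X Y
      using that free_idealD(3)[OF I(1)] by (auto simp: \<phi>_add[symmetric])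
    show "endo_scale c * X \<in> \<phi> ` I" if "X \<in> \<phi> ` I" for X c
      using that free_idealD(4)[OF I(1)] by (auto simp: \<phi>_scale[symmetric])
    show "gen_val g * X \<in> \<phi> ` I" if "X \<in> \<phi> ` I" "g \<in> lpa_gens G" for X g
      using that free_idealD(5)[OF I(1) _ free_algebra_var[OF that(2)]]
      by (auto simp: \<phi>_gen[symmetric] \<phi>_mult[symmetric])
    show "X * gen_val g \<in> \<phi> ` I" if "X \<in> \<phi> ` I" "g \<in> lpa_gens G" for X g
      using that free_idealD(6)[OF I(1) _ free_algebra_var[OF that(2)]]
      by (auto simp: \<phi>_gen[symmetric] \<phi>_mult[symmetric])
    fix X n assume "X \<in> \<phi> ` I" "X \<in> mspan (\<lambda>i j. int i - int j = n)"
    then obtain z y where zy: "z \<in> I" "X = \<phi> z" "y \<in> ?F" "homogeneous gen_degree n y" "X = \<phi> y"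
      using mspan_homogeneous by blast
    \<comment> \<open>The lift \<open>z\<close> in \<open>I\<close> and the homogeneous lift
      \<open>y\<close> may differ, but only by an element of \<open>J\<close>, which lies in
      \<open>I\<close>. So \<open>y\<close> is in \<open>I\<close> too and, being homogeneous, in
      \<open>J\<close>.\<close>
    then have "z - y \<in> J"
      using \<phi>_zero_iff[OF free_algebra_diff[OF car[OF zy(1)] zy(3)]] by (simp add: \<phi>_diff)
    then have "z - (z - y) \<in> I" using JI zy(1) free_idealD(8)[OF I(1)] by blast
    then have "y \<in> I" by simp
    then have "y \<in> J"
      using zy(3,4) free_idealD(2)[OF I(1)] by (simp add: J_def homogeneous_core_def component_homogeneous)
    then show "X = 0" using \<phi>_zero_iff[OF zy(3)] zy(5) by simp
  qed
  have "\<phi> x = 0"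
  proof (rule L.ideal_trivial[OF K])
    show "\<phi> x \<in> \<phi> ` I" using x by simp
    show "finite (word_degree gen_degree ` keys x)" by simp
    show "\<phi> x = (\<Sum>n\<in>word_degree gen_degree ` keys x. \<phi> (component gen_degree n x))"
      by (simp add: \<phi>_sum[symmetric] sum_components)
    show "\<phi> (component gen_degree n x) \<in> mspan (\<lambda>i j. int i - int j = n)" for n
      by (rule homogeneous_in_mspan[OF component_carrier[OF car[OF x]] homogeneous_component])
  qed
  then have "x \<in> J" using \<phi>_zero_iff[OF car[OF x]] by simp
  then show ?thesis by (simp add: J_def homogeneous_core_def)
qed

section \<open>The module of a tail class\<close>

definition infinite_path :: "('v, 'e) pre_ultragraph \<Rightarrow> (nat \<Rightarrow> 'e) \<Rightarrow> bool" where
  "infinite_path G \<xi> \<longleftrightarrow> (\<forall>i. \<xi> i \<in> edges G \<and> src G (\<xi> (Suc i)) \<in> rng G (\<xi> i))"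

definition tail_class :: "('v, 'e) pre_ultragraph \<Rightarrow> (nat \<Rightarrow> 'e) \<Rightarrow> (nat \<Rightarrow> 'e) set" where
  "tail_class G \<zeta> = {\<xi>. infinite_path G \<xi> \<and> (\<exists>i j. \<forall>k. \<xi> (i + k) = \<zeta> (j + k))}"

lemma edge_path_of_infinite_path:
  assumes "infinite_path G \<xi>" "0 < n"
  shows "edge_path G (map \<xi> [0..<n])"
  using assms by (auto simp: edge_path_def infinite_path_def)

text \<open>Both paths are pushed until they meet \<zeta> at the index \<open>j + j'\<close>, which
  explains the crosswise sums of the offsets.\<close>

lemma tail_class_equivalent:
  assumes "\<xi> \<in> tail_class G \<zeta>" "\<eta> \<in> tail_class G \<zeta>"
  shows "\<exists>i j. \<forall>k. \<xi> (i + k) = \<eta> (j + k)"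
proof -
  obtain i j i' j' where h: "\<And>k. \<xi> (i + k) = \<zeta> (j + k)" "\<And>k. \<eta> (i' + k) = \<zeta> (j' + k)"
    using assms by (auto simp: tail_class_def)
  have "\<xi> ((i + j') + k) = \<eta> ((i' + j) + k)" for k
    using h(1)[of "j' + k"] h(2)[of "j + k"] by (simp add: add.assoc add.left_commute)
  then show ?thesis by blast
qed

lemma tail_class_shift:
  assumes "\<xi> \<in> tail_class G \<zeta>"
  shows "(\<lambda>k. \<xi> (n + k)) \<in> tail_class G \<zeta>"
proof -
  obtain i j where "\<And>k. \<xi> (i + k) = \<zeta> (j + k)" using assms by (auto simp: tail_class_def)
  then have "\<xi> (n + (i + k)) = \<zeta> ((j + n) + k)" for k by (metis add.assoc add.commute)
  then show ?thesis using assms by (auto simp: tail_class_def infinite_path_def)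
qed

lemma tail_class_prepend:
  assumes "\<xi> \<in> tail_class G \<zeta>" "e \<in> edges G" "src G (\<xi> 0) \<in> rng G e"
  shows "case_nat e \<xi> \<in> tail_class G \<zeta>"
proof -
  obtain i j where "\<And>k. \<xi> (i + k) = \<zeta> (j + k)" using assms by (auto simp: tail_class_def)
  then have "case_nat e \<xi> (Suc i + k) = \<zeta> (j + k)" for k by simp
  moreover have "infinite_path G (case_nat e \<xi>)"
    using assms by (auto simp: infinite_path_def tail_class_def split: nat.split)
  ultimately show ?thesis unfolding tail_class_def by blast
qed

text \<open>The transpose of the Chen module of a tail class: the free algebra acts from the left on the
  functions on infinite paths, a generator by composition with a partial map.\<close>

fun gen_act :: "('v, 'e) pre_ultragraph \<Rightarrow> (nat \<Rightarrow> 'e) set \<Rightarrow> ('v, 'e) lpa_gen \<Rightarrow> (nat \<Rightarrow> 'e) \<Rightarrow> (nat \<Rightarrow> 'e) option" where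
  "gen_act G X (GenP A) \<xi> = (if \<xi> \<in> X \<and> src G (\<xi> 0) \<in> A then Some \<xi> else None)"
| "gen_act G X (GenS e) \<xi> = (if \<xi> \<in> X \<and> \<xi> 0 = e then Some (\<lambda>k. \<xi> (Suc k)) else None)"
| "gen_act G X (GenSstar e) \<xi> =
    (if \<xi> \<in> X \<and> e \<in> edges G \<and> src G (\<xi> 0) \<in> rng G e then Some (case_nat e \<xi>) else None)"

text \<open>Letters act on points from left to right: pulling functions back along maps reverses the
  order of composition, so products act on functions from the left.\<close>

fun word_act :: "('x \<Rightarrow> 'p \<Rightarrow> 'p option) \<Rightarrow> 'x list \<Rightarrow> 'p \<Rightarrow> 'p option" where
  "word_act a [] \<xi> = Some \<xi>"
| "word_act a (g # w) \<xi> = Option.bind (a g \<xi>) (word_act a w)"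

lemma word_act_append: "word_act a (u @ w) \<xi> = Option.bind (word_act a u \<xi>) (word_act a w)"
  by (induction u arbitrary: \<xi>) (auto simp: Option.bind_assoc split: Option.bind_split)

fun free_word_list :: "'x free_word \<Rightarrow> 'x list" where
  "free_word_list (FWord xs) = xs"

definition action :: "('x \<Rightarrow> 'p \<Rightarrow> 'p option) \<Rightarrow> ('x free_word \<Rightarrow>\<^sub>0 'k::field) \<Rightarrow> ('p \<Rightarrow> 'k) \<Rightarrow> 'p \<Rightarrow> 'k" where
  "action a x \<psi> \<xi> = (\<Sum>w\<in>keys x. lookup x w *
      case_option 0 \<psi> (word_act a (free_word_list w) \<xi>))"

lemma action_superset:
  assumes "finite S" "keys x \<subseteq> S"
  shows "action a x \<psi> \<xi> = (\<Sum>w\<in>S. lookup x w * case_option 0 \<psi> (word_act a (free_word_list w) \<xi>))"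
  unfolding action_def by (rule sum.mono_neutral_left) (use assms in \<open>auto simp: in_keys_iff\<close>)

lemma action_zero: "action a 0 \<psi> \<xi> = 0"
  by (simp add: action_def)

lemma action_add: "action a (x + y) \<psi> \<xi> = action a x \<psi> \<xi> + action a y \<psi> \<xi>"
proof -
  let ?S = "keys x \<union> keys y"
  have "finite ?S" "keys (x + y) \<subseteq> ?S" using keys_add[of x y] by auto
  then show ?thesis
    by (subst (1 2 3) action_superset[of ?S]) (auto simp: lookup_add algebra_simps sum.distrib)
qed

lemma action_single:
  "action a (single w c) \<psi> \<xi> = c * case_option 0 \<psi> (word_act a (free_word_list w) \<xi>)"
  by (simp add: action_def)

lemma action_single_mult:
  "action a (single u c * y) \<psi> \<xi> =
    c * case_option 0 (action a y \<psi>) (word_act a (free_word_list u) \<xi>)"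
proof (induction y rule: poly_mapping_span_induct[where S = UNIV])
  case zero
  then show ?case by (auto simp: action_zero split: option.split)
next
  case (step w d y)
  have "free_word_list (u + w) = free_word_list u @ free_word_list w" by (cases u; cases w) simp
  then show ?case using step
    by (auto simp: distrib_left action_add mult_single action_single word_act_append algebra_simps
        split: option.split)
qed simp

lemma action_mult: "action a (x * y) \<psi> \<xi> = action a x (action a y \<psi>) \<xi>"
proof (induction x rule: poly_mapping_span_induct[where S = UNIV])
  case (step u c x)
  then show ?case by (simp add: distrib_right action_add action_single_mult action_single)
qed (auto simp: action_zero)

lemma action_uminus: "action a (- x) \<psi> \<xi> = - action a x \<psi> \<xi>"
  using action_add[of a x "- x" \<psi> \<xi>] by (simp add: action_zero eq_neg_iff_add_eq_0 add.commute)

lemma action_diff: "action a (x - y) \<psi> \<xi> = action a x \<psi> \<xi> - action a y \<psi> \<xi>"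
  using action_add[of a x "- y" \<psi> \<xi>] by (simp add: action_uminus)

lemma action_sum: "action a (sum f M) \<psi> \<xi> = (\<Sum>i\<in>M. action a (f i) \<psi> \<xi>)"
  by (induction M rule: infinite_finite_induct) (auto simp: action_zero action_add)

lemma action_var: "action a (free_var g) \<psi> \<xi> = case_option 0 \<psi> (a g \<xi>)"
  by (cases "a g \<xi>") (simp_all add: free_var_def action_single)

lemma action_linear:
  "action a x (\<lambda>\<eta>. \<Sum>i\<in>M. f i * h i \<eta>) \<xi> = (\<Sum>i\<in>M. f i * action a x (h i) \<xi>)"
proof -
  have "case_option 0 (\<lambda>\<eta>. \<Sum>i\<in>M. f i * h i \<eta>) z = (\<Sum>i\<in>M. f i * case_option 0 (h i) z)" for z
    by (cases z) auto
  then show ?thesis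
    unfolding action_def
    by (simp add: sum_distrib_left sum_distrib_right mult.left_commute sum.swap[of _ M])
qed

text \<open>Viewing \<open>x\<close> as a matrix, the nonzero entries of the row at \<xi> lie in
  these columns. Their finiteness allows an arbitrary function to be replaced by a finite
  combination of indicator functions.\<close>

definition reach :: "('x \<Rightarrow> 'p \<Rightarrow> 'p option) \<Rightarrow> ('x free_word \<Rightarrow>\<^sub>0 'k::field) \<Rightarrow> 'p \<Rightarrow> 'p set" where
  "reach a x \<xi> = {\<eta>. \<exists>w\<in>keys x. word_act a (free_word_list w) \<xi> = Some \<eta>}"

lemma finite_reach: "finite (reach a x \<xi>)"
proof -
  have "reach a x \<xi> \<subseteq> (\<lambda>w. the (word_act a (free_word_list w) \<xi>)) ` keys x"
    by (force simp: reach_def)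
  then show ?thesis by (rule finite_subset) simp
qed

lemma action_cong: "(\<And>\<eta>. \<eta> \<in> reach a x \<xi> \<Longrightarrow> \<psi> \<eta> = \<psi>' \<eta>) \<Longrightarrow> action a x \<psi> \<xi> = action a x \<psi>' \<xi>"
  unfolding action_def by (rule sum.cong) (auto simp: reach_def split: option.split)

section \<open>The annihilator of the tail-class module\<close>

locale tail_representation = ultragraph G
  for G :: "('v, 'e) pre_ultragraph" +
  fixes \<zeta> :: "nat \<Rightarrow> 'e"
begin

abbreviation X :: "(nat \<Rightarrow> 'e) set" where "X \<equiv> tail_class G \<zeta>"
abbreviation act where "act \<equiv> gen_act G X"

definition annihilator :: "('v, 'e, 'k::field) lpa_free set" where
  "annihilator = {x \<in> free_carrier (lpa_gens G). \<forall>\<psi>. \<forall>\<xi>\<in>X. action act x \<psi> \<xi> = 0}"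

lemma tail_in_X: "\<xi> \<in> X \<Longrightarrow> (\<lambda>k. \<xi> (Suc k)) \<in> X"
  using tail_class_shift[of \<xi> G \<zeta> 1] by simp

lemma gen_act_X: "act g \<xi> = Some \<eta> \<Longrightarrow> \<eta> \<in> X"
  by (cases g) (auto split: if_splits simp: tail_in_X tail_class_prepend)

lemma word_act_X: "word_act act w \<xi> = Some \<eta> \<Longrightarrow> \<xi> \<in> X \<Longrightarrow> \<eta> \<in> X"
  by (induction w arbitrary: \<xi>) (auto split: Option.bind_splits dest: gen_act_X)

lemma reach_X: "\<xi> \<in> X \<Longrightarrow> reach act x \<xi> \<subseteq> X"
  by (auto simp: reach_def dest: word_act_X)

text \<open>Right multiples annihilate because \<psi> is arbitrary. For left multiples the row of
  \<open>y\<close> at a point of the class must not reach outside the class, since vanishing is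
  known only there.\<close>

lemma free_ideal_annihilator: "free_ideal (lpa_gens G) (annihilator :: ('v, 'e, 'k::field) lpa_free set)"
proof -
  have "action act y \<psi> \<xi> = 0" if "\<xi> \<in> X" "\<And>\<eta>. \<eta> \<in> X \<Longrightarrow> \<psi> \<eta> = 0"
    for y :: "('v, 'e, 'k) lpa_free" and \<psi> \<xi>
  proof -
    have "action act y \<psi> \<xi> = action act y (\<lambda>_. 0) \<xi>"
      using reach_X[OF that(1)] that(2) by (intro action_cong) blast
    also have "\<dots> = 0" by (auto simp: action_def intro!: sum.neutral split: option.split)
    finally show ?thesis .
  qed
  then show ?thesis
    by (auto simp: free_ideal_def annihilator_def action_zero action_add action_mult
        intro: free_algebra_zero free_algebra_add free_algebra_scale free_algebra_mult)
qed

lemma relators_annihilate: "(lpa_relators G :: ('v, 'e, 'k::field) lpa_free set) \<subseteq> {x. \<forall>\<psi>. \<forall>\<xi>\<in>X. action act x \<psi> \<xi> = 0}"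
proof (intro subsetI CollectI allI ballI)
  fix r :: "('v, 'e, 'k) lpa_free" and \<psi> \<xi>
  assume r: "r \<in> lpa_relators G" and \<xi>: "\<xi> \<in> X"
  have path: "\<xi> i \<in> edges G" "src G (\<xi> (Suc i)) \<in> rng G (\<xi> i)" for i
    using \<xi> by (auto simp: tail_class_def infinite_path_def)
  have re: "case_nat (\<xi> 0) (\<lambda>k. \<xi> (Suc k)) = \<xi>" by (auto split: nat.split)
  note [simp] = action_diff action_add action_mult action_var tail_in_X tail_class_prepend
  show "action act r \<psi> \<xi> = 0"
    using r
  proof cases
    case (regular v)
    \<comment> \<open>Only the first edge of \<xi> itself can be stripped off and put back, so at
      most one summand survives.\<close>
    have "action act (ss e * ss_star e) \<psi> \<xi> = (if e = \<xi> 0 then \<psi> \<xi> else 0)"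
      if "e \<in> {e \<in> edges G. src G e = v}" for e
      using that \<xi> path[of 0] re by auto
    then have "action act (\<Sum>e\<in>{e \<in> edges G. src G e = v}. ss e * ss_star e) \<psi> \<xi> =
        (\<Sum>e\<in>{e \<in> edges G. src G e = v}. if e = \<xi> 0 then \<psi> \<xi> else 0)"
      unfolding action_sum by (intro sum.cong) auto
    also have "\<dots> = (if src G (\<xi> 0) = v then \<psi> \<xi> else 0)"
      using regular path(1)[of 0] by (auto simp: regular_vertex_def)
    finally show ?thesis using regular \<xi> by simp
  qed (use \<xi> path[of 0] in \<open>auto simp: action_zero\<close>)
qed

lemma word_act_strip:
  "\<eta> \<in> X \<Longrightarrow> word_act act (map GenS \<beta>) \<eta> =
    (if \<forall>k<length \<beta>. \<eta> k = \<beta> ! k then Some (\<lambda>k. \<eta> (length \<beta> + k)) else None)"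
proof (induction \<beta> arbitrary: \<eta>)
  case (Cons e \<beta>)
  have "(\<forall>k<length (e # \<beta>). \<eta> k = (e # \<beta>) ! k) \<longleftrightarrow> \<eta> 0 = e \<and> (\<forall>k<length \<beta>. \<eta> (Suc k) = \<beta> ! k)"
    by (auto simp: less_Suc_eq_0_disj)
  then show ?case using Cons.prems Cons.IH[OF tail_in_X[OF Cons.prems]] by simp
qed simp

lemma word_act_prepend:
  assumes "\<xi> \<in> X"
  shows "word_act act (map GenSstar (rev (map \<xi> [0..<n]))) (\<lambda>k. \<xi> (n + k)) = Some \<xi>"
proof (induction n)
  case (Suc n)
  have "case_nat (\<xi> n) (\<lambda>k. \<xi> (Suc n + k)) = (\<lambda>k. \<xi> (n + k))"
    by (auto split: nat.split)
  moreover have "\<xi> n \<in> edges G" "src G (\<xi> (Suc n)) \<in> rng G (\<xi> n)"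
    using assms by (auto simp: tail_class_def infinite_path_def)
  moreover have "(\<lambda>k. \<xi> (Suc n + k)) \<in> X" using tail_class_shift[OF assms] .
  ultimately have "act (GenSstar (\<xi> n)) (\<lambda>k. \<xi> (Suc n + k)) = Some (\<lambda>k. \<xi> (n + k))" by simp
  then show ?case using Suc by simp
qed simp

text \<open>A long prefix of a path separates it from the finitely many others occurring in a
  row, and tail equivalence moves it to any other path of the class.\<close>

lemma annihilator_prime:
  fixes f g :: "('v, 'e, 'k::field) lpa_free"
  assumes f: "f \<in> free_carrier (lpa_gens G)" "f \<notin> annihilator"
    and g: "g \<in> free_carrier (lpa_gens G)" "g \<notin> annihilator"
  shows "\<exists>t\<in>free_carrier (lpa_gens G). f * (t * g) \<notin> annihilator"
proof -
  obtain \<psi>' \<xi>' where \<xi>': "\<xi>' \<in> X" "action act f \<psi>' \<xi>' \<noteq> 0" using f by (auto simp: annihilator_def)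
  obtain \<psi> \<xi> where \<xi>: "\<xi> \<in> X" "action act g \<psi> \<xi> \<noteq> 0" using g by (auto simp: annihilator_def)
  define Y where "Y = reach act f \<xi>'"
  define \<delta> :: "(nat \<Rightarrow> 'e) \<Rightarrow> (nat \<Rightarrow> 'e) \<Rightarrow> 'k" where "\<delta> \<eta> \<eta>' = (if \<eta>' = \<eta> then 1 else 0)" for \<eta> \<eta>'
  have Y: "finite Y" "Y \<subseteq> X" unfolding Y_def using finite_reach[of act f \<xi>'] reach_X[OF \<xi>'(1), of f] by simp_all
  have "action act f \<psi>' \<xi>' = action act f (\<lambda>\<eta>. \<Sum>i\<in>Y. \<psi>' i * \<delta> i \<eta>) \<xi>'"
    by (rule action_cong) (use Y(1) in \<open>auto simp: \<delta>_def Y_def[symmetric] if_distrib cong: if_cong\<close>)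
  also have "\<dots> = (\<Sum>i\<in>Y. \<psi>' i * action act f (\<delta> i) \<xi>')" by (rule action_linear)
  \<comment> \<open>Some entry of the row of \<open>f\<close> at \<xi>' is nonzero; its column will
    be \<open>\<eta>0\<close>.\<close>
  finally have "\<exists>\<eta>\<in>Y. action act f (\<delta> \<eta>) \<xi>' \<noteq> 0"
    using \<xi>'(2) by (metis (no_types, lifting) mult_zero_right sum.neutral)
  then obtain \<eta>0 where \<eta>0: "\<eta>0 \<in> Y" "action act f (\<delta> \<eta>0) \<xi>' \<noteq> 0" by blast
  have "\<exists>i. \<eta> \<noteq> \<eta>0 \<longrightarrow> \<eta> i \<noteq> \<eta>0 i" for \<eta> by (cases "\<eta> = \<eta>0") auto
  then obtain dif where dif: "\<And>\<eta>. \<eta> \<noteq> \<eta>0 \<Longrightarrow> \<eta> (dif \<eta>) \<noteq> \<eta>0 (dif \<eta>)" by metis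
  \<comment> \<open>For a path of \<open>Y\<close> other than \<open>\<eta>0\<close>,
    \<open>dif\<close> gives a position of disagreement. The first \<open>L\<close> edges therefore
    distinguish \<open>\<eta>0\<close> within \<open>Y\<close>.\<close>
  define L where "L = Suc (Max (dif ` Y))"
  have L: "dif \<eta> < L" if "\<eta> \<in> Y" for \<eta>
    unfolding L_def using Y(1) that by (simp add: less_Suc_eq_le)
  obtain i j where ij: "\<And>k. \<eta>0 (i + k) = \<xi> (j + k)"
    using tail_class_equivalent[of \<eta>0 G \<zeta> \<xi>] \<eta>0(1) Y(2) \<xi>(1) by blast
  \<comment> \<open>The word \<open>t\<close> will replace the beginning \<beta> of
    \<open>\<eta>0\<close> by the beginning \<alpha> of \<xi>. The lengths \<open>i + L\<close> and
    \<open>j + L\<close> align the common tails, so \<open>\<eta>0\<close> goes to \<xi>, while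
    \<open>t\<close> is undefined on the other paths of \<open>Y\<close>.\<close>
  define \<beta> where "\<beta> = map \<eta>0 [0..<i + L]"
  define \<alpha> where "\<alpha> = map \<xi> [0..<j + L]"
  define t :: "('v, 'e, 'k) lpa_free" where
    "t = single (FWord (map GenS \<beta> @ map GenSstar (rev \<alpha>))) 1"
  have inE: "\<xi> k \<in> edges G" "\<eta>0 k \<in> edges G" for k
    using \<xi>(1) \<eta>0(1) Y(2) by (auto simp: tail_class_def infinite_path_def)
  have t: "t \<in> free_carrier (lpa_gens G)"
    unfolding t_def using inE by (intro free_algebra_single) (auto simp: \<beta>_def \<alpha>_def lpa_gens_def L_def)
  have "action act t \<chi> \<eta> = (if \<eta> = \<eta>0 then \<chi> \<xi> else 0)" if \<eta>: "\<eta> \<in> Y" for \<chi> \<eta>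
  proof (cases "\<eta> = \<eta>0")
    case True
    have "(\<lambda>k. \<eta>0 (length \<beta> + k)) = (\<lambda>k. \<xi> (j + L + k))"
      using ij by (simp add: \<beta>_def add.assoc)
    then have "word_act act (map GenS \<beta>) \<eta> = Some (\<lambda>k. \<xi> (j + L + k))"
      using word_act_strip[of \<eta> \<beta>] \<eta> Y(2) True by (auto simp: \<beta>_def)
    then show ?thesis
      using word_act_prepend[OF \<xi>(1), of "j + L"] True
      by (simp add: t_def action_single word_act_append \<alpha>_def)
  next
    case False
    have "dif \<eta> < length \<beta>" "\<eta> (dif \<eta>) \<noteq> \<beta> ! dif \<eta>"
      using L[OF \<eta>] dif[OF False] by (simp_all add: \<beta>_def)
    then have "\<not> (\<forall>k<length \<beta>. \<eta> k = \<beta> ! k)" by blast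
    moreover have "\<eta> \<in> X" using \<eta> Y(2) by blast
    ultimately have "word_act act (map GenS \<beta>) \<eta> = None"
      using word_act_strip[of \<eta> \<beta>] by (simp only: if_False)
    then show ?thesis using False by (simp add: t_def action_single word_act_append)
  qed
  then have "action act t (action act g \<psi>) \<eta> = (\<Sum>i\<in>{\<eta>0}. action act g \<psi> \<xi> * \<delta> i \<eta>)" if "\<eta> \<in> Y" for \<eta>
    using that by (simp add: \<delta>_def)
  then have "action act f (action act t (action act g \<psi>)) \<xi>' =
      action act f (\<lambda>\<eta>. \<Sum>i\<in>{\<eta>0}. action act g \<psi> \<xi> * \<delta> i \<eta>) \<xi>'"
    unfolding Y_def by (intro action_cong) blast
  also have "\<dots> = action act g \<psi> \<xi> * action act f (\<delta> \<eta>0) \<xi>'" by (subst action_linear) simp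
  also have "\<dots> \<noteq> 0" using \<xi>(2) \<eta>0(2) by simp
  finally have "action act f (action act (t * g) \<psi>) \<xi>' \<noteq> 0"
    using action_mult[of act t g \<psi>] by presburger
  then have "action act (f * (t * g)) \<psi> \<xi>' \<noteq> 0" by (subst action_mult)
  then have "f * (t * g) \<notin> annihilator" using \<xi>'(1) by (auto simp: annihilator_def)
  then show ?thesis using t by blast
qed

end

section \<open>Condition (K) and graded ideals\<close>

text \<open>The closed path is cut at its first return to \<open>v\<close>; this is its end if no
  later edge starts at \<open>v\<close>.\<close>

lemma first_return_exists:
  assumes "closed_path_at G v es"
  shows "\<exists>fs. first_return_path_at G v fs"
proof -
  let ?P = "\<lambda>i. 0 < i \<and> i \<le> length es \<and> (i = length es \<or> src G (es ! i) = v)"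
  have es: "edge_path G es" "src G (hd es) = v" "v \<in> rng G (last es)" "es \<noteq> []"
    using assms edge_path_nonempty[of G es] by (auto simp: closed_path_at_def)
  have ex: "?P (length es)" using es(4) by simp
  define i where "i = (LEAST i. ?P i)"
  have i: "?P i" unfolding i_def by (rule LeastI[of ?P, OF ex])
  have least: "\<not> ?P j" if "j < i" for j using not_less_Least[of j ?P] that unfolding i_def by blast
  have path: "edge_path G (take i es)" using edge_path_take[OF es(1)] i by simp
  have "v \<in> rng G (last (take i es))"
  proof (cases "i = length es")
    case False
    then have "src G (hd (drop i es)) \<in> rng G (last (take i es))" "hd (drop i es) = es ! i"
      using edge_path_append[of "take i es" "drop i es" G] es i by (auto simp: hd_drop_conv_nth)
    then show ?thesis using i False by simp
  qed (use es in simp)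
  moreover have "hd (take i es) = hd es" using i es(4) by (simp add: hd_conv_nth)
  ultimately have "first_return_path_at G v (take i es)"
    using path es(2) least i by (auto simp: first_return_path_at_def closed_path_at_def)
  then show ?thesis by blast
qed

lemma cycle_infinite_path:
  assumes "closed_path_at G v c"
  shows "infinite_path G (\<lambda>n. c ! (n mod length c))"
  unfolding infinite_path_def
proof (intro allI conjI)
  fix i
  have c: "edge_path G c" "src G (hd c) = v" "v \<in> rng G (last c)" "c \<noteq> []"
    using assms edge_path_nonempty[of G c] by (auto simp: closed_path_at_def)
  then have m: "i mod length c < length c" by simp
  then show "c ! (i mod length c) \<in> edges G" using edge_path_edges[OF c(1)] nth_mem by blast
  show "src G (c ! (Suc i mod length c)) \<in> rng G (c ! (i mod length c))"
  proof (cases "Suc (i mod length c) = length c")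
    case True
    then have "Suc i mod length c = 0" "i mod length c = length c - 1" by (simp_all add: mod_Suc)
    then show ?thesis using c by (simp add: hd_conv_nth last_conv_nth)
  next
    case False
    then have "Suc i mod length c = Suc (i mod length c)" by (simp add: mod_Suc)
    moreover have "Suc (i mod length c) < length c" using m False by simp
    ultimately show ?thesis using c(1) unfolding edge_path_def by simp
  qed
qed

text \<open>A path with the tail of the cycle visits \<open>v\<close> again. If it starts at
  \<open>v\<close>, the segment up to its first return is a first-return path and so equals
  \<open>c\<close>; the same applies from there on.\<close>

lemma unique_first_return_tail:
  assumes c: "first_return_path_at G v c"
    and unique: "\<And>fs. first_return_path_at G v fs \<Longrightarrow> fs = c"
    and \<xi>: "\<xi> \<in> tail_class G (\<lambda>n. c ! (n mod length c))" "src G (\<xi> 0) = v"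
  shows "\<xi> = (\<lambda>n. c ! (n mod length c))"
proof -
  let ?\<zeta> = "\<lambda>n. c ! (n mod length c)"
  have c': "src G (hd c) = v" "c \<noteq> []"
    using c edge_path_nonempty[of G c] by (auto simp: first_return_path_at_def closed_path_at_def)
  have block: "(\<forall>k<length c. \<xi> k = c ! k) \<and> src G (\<xi> (length c)) = v"
    if \<xi>: "\<xi> \<in> tail_class G ?\<zeta>" "src G (\<xi> 0) = v" for \<xi>
  proof -
    obtain i j where ij: "\<And>k. \<xi> (i + k) = ?\<zeta> (j + k)" using \<xi>(1) by (auto simp: tail_class_def)
    have path: "infinite_path G \<xi>" using \<xi>(1) by (simp add: tail_class_def)
    \<comment> \<open>\<open>j + ?k\<close> is a multiple of \<open>length c\<close>, so a new
      period begins there. The factor \<open>Suc j\<close> makes \<open>?k\<close> positive, which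
      excludes the starting point itself.\<close>
    let ?k = "Suc j * length c - j"
    have "j + ?k = Suc j * length c" using c'(2) by (cases c) auto
    then have "\<xi> (i + ?k) = c ! 0" using ij[of ?k] by simp
    then have ex: "0 < i + ?k \<and> src G (\<xi> (i + ?k)) = v" using c' by (cases c) auto
    define n where "n = (LEAST n. 0 < n \<and> src G (\<xi> n) = v)"
    have n: "0 < n" "src G (\<xi> n) = v"
      using LeastI[of "\<lambda>n. 0 < n \<and> src G (\<xi> n) = v", OF ex] unfolding n_def by auto
    have least: "src G (\<xi> l) \<noteq> v" if "0 < l" "l < n" for l
      using not_less_Least[of l "\<lambda>n. 0 < n \<and> src G (\<xi> n) = v"] that unfolding n_def by blast
    have "src G (\<xi> (Suc (n - 1))) \<in> rng G (\<xi> (n - 1))" using path by (simp add: infinite_path_def)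
    then have "first_return_path_at G v (map \<xi> [0..<n])"
      using n \<xi>(2) least edge_path_of_infinite_path[OF path n(1)]
      by (auto simp: first_return_path_at_def closed_path_at_def hd_map last_map)
    then have eq: "map \<xi> [0..<n] = c" by (rule unique)
    then have len: "n = length c" by (metis length_map length_upt diff_zero)
    have "\<xi> k = c ! k" if "k < length c" for k
      using that len unfolding eq[symmetric] by simp
    then show ?thesis using n len by simp
  qed
  have visit: "src G (\<xi> (q * length c)) = v" for q
  proof (induction q)
    case (Suc q)
    have "(\<lambda>k. \<xi> (q * length c + k)) \<in> tail_class G ?\<zeta>" by (rule tail_class_shift[OF \<xi>(1)])
    from block[OF this] Suc show ?case by (simp add: add.commute)
  qed (simp add: \<xi>(2))
  show ?thesis
  proof
    fix n
    have "(\<lambda>k. \<xi> (n div length c * length c + k)) \<in> tail_class G ?\<zeta>" by (rule tail_class_shift[OF \<xi>(1)])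
    from block[OF this] visit[of "n div length c"]
    have "\<forall>k<length c. \<xi> (n div length c * length c + k) = c ! k" by simp
    moreover have "n mod length c < length c" using c'(2) by simp
    ultimately have "\<xi> (n div length c * length c + n mod length c) = c ! (n mod length c)" by blast
    then show "\<xi> n = c ! (n mod length c)" by simp
  qed
qed

context ultragraph
begin

section \<open>Degree components and ideals of the Leavitt path algebra\<close>

lemma lpa_quotient: "free_quotient (lpa_gens G) (lpa_ideal G)"
  by (rule free_quotient.intro[OF free_ideal_lpa_ideal])

lemma lpa_class_eq: "lpa_class G = free_quotient.cl (lpa_gens G) (lpa_ideal G)"
  by (simp add: fun_eq_iff lpa_class_def free_quotient.cl_def[OF lpa_quotient])

lemma lpa_embedding_ideal: "\<exists>\<phi>. lpa_embedding G \<phi> (lpa_ideal G :: ('v, 'e, 'k::field) lpa_free set)"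
  by (rule lpa_embedding_exists[OF free_ideal_lpa_ideal lpa_relators_subset])

lemma pp_carrier: "A \<in> gen_verts G \<Longrightarrow> pp A \<in> free_carrier (lpa_gens G)"
  by (rule free_algebra_var) (simp add: lpa_gens_def)

text \<open>Only the first letters of words matter. Each is fixed from the left by some projection,
  and the union of the finitely many sets involved serves for all words.\<close>

lemma lpa_local_unit:
  fixes x :: "('v, 'e, 'k::field) lpa_free"
  assumes "x \<in> free_carrier (lpa_gens G)"
  shows "\<exists>u\<in>free_carrier (lpa_gens G). u * x - x \<in> lpa_ideal G"
proof -
  obtain \<phi> where "lpa_embedding G \<phi> (lpa_ideal G :: ('v, 'e, 'k) lpa_free set)" using lpa_embedding_ideal by blast
  then interpret lpa_embedding G \<phi> "lpa_ideal G" .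
  have gen: "\<exists>B\<in>gen_verts G. \<phi> (pp B) * gen_val g = gen_val g" if g: "g \<in> lpa_gens G" for g
  proof -
    consider B where "g = GenP B" "B \<in> gen_verts G" | e where "g = GenS e" "e \<in> edges G"
      | e where "g = GenSstar e" "e \<in> edges G"
      using g by (auto simp: lpa_gens_def)
    then show ?thesis
    proof cases
      case 1
      then show ?thesis using p_mult[of B B] by auto
    next
      case 2
      then show ?thesis using p_src_s src_gen by auto
    next
      case 3
      then show ?thesis using p_rng_t gen_verts.range[of _ G] by auto
    qed
  qed
  have "\<exists>B\<in>gen_verts G. \<phi> (pp B) * \<phi> x = \<phi> x"
    using assms
  proof (induction rule: free_algebra_induct)
    case zero
    then show ?case using gen_verts.empty by (auto simp: \<phi>_zero)
  next
    case (step w c y)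
    then obtain B where B: "B \<in> gen_verts G" "\<phi> (pp B) * \<phi> y = \<phi> y" by blast
    obtain g w' where w: "w = g # w'" using step(1) by (cases w) auto
    then obtain B' where B': "B' \<in> gen_verts G" "\<phi> (pp B') * gen_val g = gen_val g"
      using gen[of g] step(2) by auto
    let ?s = "single (FWord w) c" and ?U = "pp (B \<union> B')"
    have "\<phi> ?s = endo_scale c * (gen_val g * prod_list (map gen_val w'))"
      using \<phi>_word[of w c] w by simp
    then have "\<phi> (pp B') * \<phi> ?s = endo_scale c * ((\<phi> (pp B') * gen_val g) * prod_list (map gen_val w'))"
      by (simp only: \<kappa>_left_comm mult.assoc)
    then have s: "\<phi> (pp B') * \<phi> ?s = \<phi> ?s"
      using \<phi>_word[of w c] w B'(2) by simp
    have U: "B \<union> B' \<in> gen_verts G" using B B' gen_verts.union by blast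
    have "\<phi> ?U * \<phi> (pp B) = \<phi> (pp B)" "\<phi> ?U * \<phi> (pp B') = \<phi> (pp B')"
      using p_mult[OF U B(1)] p_mult[OF U B'(1)] by (simp_all add: Int_absorb1)
    then have "\<phi> ?U * \<phi> y = \<phi> y" "\<phi> ?U * \<phi> ?s = \<phi> ?s"
      using B(2) s by (metis mult.assoc)+
    then have "\<phi> ?U * \<phi> (?s + y) = \<phi> (?s + y)" by (simp add: \<phi>_add distrib_left)
    then show ?case using U by blast
  qed
  then obtain B where B: "B \<in> gen_verts G" "\<phi> (pp B) * \<phi> x = \<phi> x" by blast
  have car: "pp B * x - x \<in> free_carrier (lpa_gens G)"
    using assms pp_carrier[OF B(1)] by (intro free_algebra_diff free_algebra_mult)
  then have "pp B * x - x \<in> lpa_ideal G" using \<phi>_zero_iff[OF car] B(2) by (simp add: \<phi>_diff \<phi>_mult)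
  then show ?thesis using pp_carrier[OF B(1)] by blast
qed

text \<open>The empty list of a monomial has to be read as a path of length zero. Taking for it the
  set of the middle projection is harmless because that projection is idempotent.\<close>

definition path_of :: "'v set \<Rightarrow> 'e list \<Rightarrow> ('v, 'e) upath" where
  "path_of A es = (if es = [] then VPath A else EPath es)"

lemma (in lpa_embedding) mon_path_elem:
  assumes "A \<in> gen_verts G"
  shows "\<phi> (path_elem (path_of A \<alpha>) * pp A * path_elem_star (path_of A \<beta>)) = mon \<alpha> A \<beta>"
proof -
  have 1: "\<phi> (path_elem (path_of A \<alpha>)) * \<phi> (pp A) = sp \<alpha> * \<phi> (pp A)"
    using p_mult[OF assms assms] by (cases "\<alpha> = []") (simp_all add: path_of_def \<phi>_paths)
  have 2: "\<phi> (pp A) * \<phi> (path_elem_star (path_of A \<beta>)) = \<phi> (pp A) * tp \<beta>"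
    using p_mult[OF assms assms] by (cases "\<beta> = []") (simp_all add: path_of_def \<phi>_paths)
  have "\<phi> (path_elem (path_of A \<alpha>) * pp A * path_elem_star (path_of A \<beta>)) =
      sp \<alpha> * (\<phi> (pp A) * \<phi> (path_elem_star (path_of A \<beta>)))"
    by (simp only: \<phi>_mult 1 mult.assoc[symmetric])
  then show ?thesis by (simp only: 2 mon_def mult.assoc)
qed

lemma path_elem_homogeneous:
  assumes "finite_path G \<alpha>"
  shows "(path_elem \<alpha> :: ('v, 'e, 'k::field) lpa_free) \<in> free_carrier (lpa_gens G)"
    "homogeneous gen_degree (int (path_length \<alpha>)) (path_elem \<alpha> :: ('v, 'e, 'k) lpa_free)"
    "(path_elem_star \<alpha> :: ('v, 'e, 'k) lpa_free) \<in> free_carrier (lpa_gens G)"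
    "homogeneous gen_degree (- int (path_length \<alpha>)) (path_elem_star \<alpha> :: ('v, 'e, 'k) lpa_free)"
proof -
  let ?H = "\<lambda>n (x :: ('v, 'e, 'k) lpa_free). x \<in> free_carrier (lpa_gens G) \<and> homogeneous gen_degree n x"
  have "?H (int (path_length \<alpha>)) (path_elem \<alpha>) \<and> ?H (- int (path_length \<alpha>)) (path_elem_star \<alpha>)"
  proof (cases \<alpha>)
    case (VPath A)
    then show ?thesis using assms pp_carrier[of A] homogeneous_var[of gen_degree "GenP A"] by simp
  next
    case (EPath es)
    have p: "prod_list (map (\<lambda>e. free_var (h e)) fs) = (single (FWord (map h fs)) 1 :: ('v, 'e, 'k) lpa_free)"
      for h and fs :: "'e list"
      by (induction fs) (simp_all add: free_var_def mult_single zero_free_word_def[symmetric])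
    have "es \<noteq> []" "set es \<subseteq> edges G" using assms EPath by (auto simp: edge_path_def)
    moreover from this have "set (map GenS es) \<subseteq> lpa_gens G" "set (map GenSstar (rev es)) \<subseteq> lpa_gens G"
      unfolding lpa_gens_def by auto
    ultimately show ?thesis
      using EPath p[of GenS es] p[of GenSstar "rev es"]
      by (simp add: homogeneous_def o_def sum_list_triv free_algebra_single)
  qed
  then show "(path_elem \<alpha> :: ('v, 'e, 'k) lpa_free) \<in> free_carrier (lpa_gens G)"
    "homogeneous gen_degree (int (path_length \<alpha>)) (path_elem \<alpha> :: ('v, 'e, 'k) lpa_free)"
    "(path_elem_star \<alpha> :: ('v, 'e, 'k) lpa_free) \<in> free_carrier (lpa_gens G)"
    "homogeneous gen_degree (- int (path_length \<alpha>)) (path_elem_star \<alpha> :: ('v, 'e, 'k) lpa_free)"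
    by auto
qed

text \<open>The classes of homogeneous elements of degree \<open>n\<close> form a subspace that
  contains the spanning monomials.\<close>

lemma lpa_component_homogeneous:
  fixes Y :: "('v, 'e, 'k::field) lpa_free set"
  assumes "Y \<in> lpa_component G n"
  shows "\<exists>x\<in>free_carrier (lpa_gens G). homogeneous gen_degree n x \<and> Y = lpa_class G x"
proof -
  interpret LQ: free_quotient "lpa_gens G" "lpa_ideal G :: ('v, 'e, 'k) lpa_free set" by (rule lpa_quotient)
  have Q: "LQ.Q = leavitt_path_algebra G" by (simp add: leavitt_path_algebra_def)
  define U where "U = LQ.cl ` {x \<in> free_carrier (lpa_gens G). homogeneous gen_degree n x}"
  have "homogeneous gen_degree n (- x)" if "homogeneous gen_degree n x" for x :: "('v, 'e, 'k) lpa_free"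
    using homogeneous_diff[OF homogeneous_zero that] by simp
  then have "additive_subgroup U LQ.Q"
    unfolding U_def by (intro LQ.image_subgroup)
      (auto intro: free_algebra_zero free_algebra_add free_algebra_uminus homogeneous_zero homogeneous_add)
  moreover have "c \<odot>\<^bsub>LQ.Q\<^esub> a \<in> U" if "a \<in> U" for c a
    using that unfolding U_def by (auto simp: LQ.smult_Q intro!: imageI free_algebra_scale homogeneous_scale)
  ultimately have U: "linear_subspace LQ.Q U" by (simp add: linear_subspace_def)
  have "lpa_class G (path_elem \<alpha> * pp A * path_elem_star \<beta>) \<in> U"
    if h: "finite_path G \<alpha>" "A \<in> gen_verts G" "finite_path G \<beta>" "int (path_length \<alpha>) - int (path_length \<beta>) = n"
    for \<alpha> A \<beta>
  proof -
    have "homogeneous gen_degree (int (path_length \<alpha>) + 0 + (- int (path_length \<beta>))) (path_elem \<alpha> * pp A * path_elem_star \<beta>)"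
      using path_elem_homogeneous[OF h(1)] path_elem_homogeneous[OF h(3)] homogeneous_var[of gen_degree "GenP A"]
      by (intro homogeneous_mult) auto
    then have "homogeneous gen_degree n (path_elem \<alpha> * pp A * path_elem_star \<beta>)" using h(4) by simp
    moreover have "path_elem \<alpha> * pp A * path_elem_star \<beta> \<in> free_carrier (lpa_gens G)"
      using path_elem_homogeneous[OF h(1)] path_elem_homogeneous[OF h(3)] pp_carrier[OF h(2)]
      by (intro free_algebra_mult)
    ultimately show ?thesis unfolding U_def lpa_class_eq by blast
  qed
  then have "lpa_component G n \<subseteq> U"
    unfolding lpa_component_def linear_span_def Q[symmetric] using U by (intro Inter_lower) blast
  then show ?thesis using assms unfolding U_def lpa_class_eq by blast
qed

text \<open>The normal form is found in the image of \<open>\<phi>\<close> and lifted summand by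
  summand to an element \<open>y\<close> whose class stays in the given subspace. Equal values under
  \<open>\<phi>\<close> mean equal classes.\<close>

lemma homogeneous_lpa_component:
  fixes x :: "('v, 'e, 'k::field) lpa_free"
  assumes "x \<in> free_carrier (lpa_gens G)" "homogeneous gen_degree n x"
  shows "lpa_class G x \<in> lpa_component G n"
proof -
  interpret LQ: free_quotient "lpa_gens G" "lpa_ideal G :: ('v, 'e, 'k) lpa_free set" by (rule lpa_quotient)
  have Q: "LQ.Q = leavitt_path_algebra G" by (simp add: leavitt_path_algebra_def)
  obtain \<phi> where "lpa_embedding G \<phi> (lpa_ideal G :: ('v, 'e, 'k) lpa_free set)" using lpa_embedding_ideal by blast
  then interpret lpa_embedding G \<phi> "lpa_ideal G" .
  have cl_eq: "LQ.cl y = LQ.cl z" if "\<phi> y = \<phi> z" "y \<in> free_carrier (lpa_gens G)"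
    "z \<in> free_carrier (lpa_gens G)" for y z
    using that \<phi>_zero_iff[OF free_algebra_diff[OF that(2,3)]] by (simp add: LQ.cl_eq_iff \<phi>_diff)
  have "LQ.cl x \<in> U"
    if U: "linear_subspace LQ.Q U" and gens: "{lpa_class G (path_elem \<alpha> * pp A * path_elem_star \<beta>) | \<alpha> A \<beta>.
        finite_path G \<alpha> \<and> A \<in> gen_verts G \<and> finite_path G \<beta> \<and>
        int (path_length \<alpha>) - int (path_length \<beta>) = n} \<subseteq> U" for U
  proof -
    interpret additive_subgroup U LQ.Q using U by (simp add: linear_subspace_def)
    have zero: "LQ.cl 0 \<in> U" using zero_closed by (simp add: LQ.zero_Q)
    obtain y where y: "y \<in> free_carrier (lpa_gens G)" "\<phi> x = \<phi> y" "LQ.cl y \<in> U"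
    proof -
      have "\<exists>y\<in>free_carrier (lpa_gens G). \<phi> x = \<phi> y \<and> LQ.cl y \<in> U"
        using homogeneous_in_mspan[OF assms]
      proof (induction rule: mspan_induct)
        case zero
        then show ?case using \<open>LQ.cl 0 \<in> U\<close> free_algebra_zero \<phi>_zero by metis
      next
        case (step \<alpha> A \<beta> z c)
        then obtain y where y: "y \<in> free_carrier (lpa_gens G)" "z = \<phi> y" "LQ.cl y \<in> U" by blast
        show ?case
        proof (cases "(\<alpha> = [] \<or> edge_path G \<alpha>) \<and> (\<beta> = [] \<or> edge_path G \<beta>)")
          case True
          let ?m = "path_elem (path_of A \<alpha>) * pp A * path_elem_star (path_of A \<beta>) :: ('v, 'e, 'k) lpa_free"
          have fp: "finite_path G (path_of A \<alpha>)" "finite_path G (path_of A \<beta>)"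
            "int (path_length (path_of A \<alpha>)) - int (path_length (path_of A \<beta>)) = n"
            using True step by (auto simp: path_of_def)
          then have mU: "LQ.cl ?m \<in> U" using gens step(2) unfolding lpa_class_eq by blast
          have mc: "?m \<in> free_carrier (lpa_gens G)"
            using path_elem_homogeneous[OF fp(1)] path_elem_homogeneous[OF fp(2)] pp_carrier[OF step(2)]
            by (intro free_algebra_mult)
          have "c \<odot>\<^bsub>LQ.Q\<^esub> LQ.cl ?m \<in> U" using U mU by (simp add: linear_subspace_def)
          then have "LQ.cl (single 0 c * ?m) \<in> U" using LQ.smult_Q[OF mc] by simp
          from a_closed[OF this y(3)] have "LQ.cl (single 0 c * ?m + y) \<in> U"
            using LQ.add_Q[OF free_algebra_scale[OF mc] y(1)] by simp
          moreover have "\<phi> (single 0 c * ?m + y) = endo_scale c * mon \<alpha> A \<beta> + z"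
            by (simp only: \<phi>_add \<phi>_scale mon_path_elem[OF step(2)] y(2))
          ultimately show ?thesis using free_algebra_add[OF free_algebra_scale[OF mc] y(1)] by metis
        next
          case False
          \<comment> \<open>The spanning set of the component uses genuine paths only; the other
            monomials are zero and may be dropped.\<close>
          then have "mon \<alpha> A \<beta> = 0" using step sp_non_path[of \<alpha>] tp_non_path[of \<beta>] by (auto simp: mon_def)
          then show ?thesis using y by auto
        qed
      qed
      then show thesis using that by blast
    qed
    then show ?thesis using cl_eq[OF y(2) assms(1) y(1)] by simp
  qed
  then show ?thesis unfolding lpa_component_def linear_span_def Q[symmetric] lpa_class_eq by blast
qed

text \<open>Components are taken in the preimage of the ideal, where words define them, and their
  classes give the required decomposition.\<close>

lemma condition_K_graded:
  fixes P :: "('v, 'e, 'k::field) lpa_free set set"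
  assumes K: "condition_K G" and P: "two_sided_ideal (leavitt_path_algebra G) P"
  shows "graded_ideal (leavitt_path_algebra G) (lpa_component G) P"
proof -
  interpret LQ: free_quotient "lpa_gens G" "lpa_ideal G :: ('v, 'e, 'k) lpa_free set" by (rule lpa_quotient)
  have Q: "LQ.Q = leavitt_path_algebra G" by (simp add: leavitt_path_algebra_def)
  note pull = LQ.pull_ideal[OF P[folded Q] lpa_local_unit]
  have rel: "lpa_relators G \<subseteq> LQ.pull P" using pull(2) lpa_relators_subset by blast
  have "\<exists>N f. finite N \<and> (\<forall>n\<in>N. f n \<in> P \<inter> lpa_component G n) \<and> Y = finsum LQ.Q f N" if Y: "Y \<in> P" for Y
  proof -
    obtain x where x: "Y = LQ.cl x" "x \<in> LQ.pull P" using Y pull(3) by (metis imageE)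
    have xc: "x \<in> free_carrier (lpa_gens G)" using free_idealD(1)[OF pull(1) x(2)] .
    define M where "M = word_degree gen_degree ` keys x"
    have "LQ.cl (component gen_degree n x) \<in> P \<inter> lpa_component G n" for n
      using ideal_homogeneous[OF K pull(1) rel x(2), of n]
        homogeneous_lpa_component[OF component_carrier[OF xc] homogeneous_component]
      by (auto simp: LQ.pull_def lpa_class_eq)
    moreover have "finsum LQ.Q (\<lambda>n. LQ.cl (component gen_degree n x)) M = Y"
      using LQ.finsum_Q[of M "\<lambda>n. component gen_degree n x"] component_carrier[OF xc] x(1)
      by (simp add: M_def sum_components)
    moreover have "finite M" by (simp add: M_def)
    ultimately show ?thesis by (intro exI[of _ M] exI[of _ "\<lambda>n. LQ.cl (component gen_degree n x)"]) simp
  qed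
  then show ?thesis using P unfolding graded_ideal_def Q by blast
qed

lemma not_condition_K_nongraded_prime:
  assumes "\<not> condition_K G"
  shows "\<exists>P :: ('v, 'e, 'k::field) lpa_free set set. prime_two_sided_ideal (leavitt_path_algebra G) P \<and>
    \<not> graded_ideal (leavitt_path_algebra G) (lpa_component G) P"
proof -
  obtain v es where v: "v \<in> verts G" "closed_path_at G v es"
    and "\<not> (\<exists>es fs. es \<noteq> fs \<and> first_return_path_at G v es \<and> first_return_path_at G v fs)"
    using assms by (auto simp: condition_K_def)
  then obtain c where c: "first_return_path_at G v c" and unique: "\<And>fs. first_return_path_at G v fs \<Longrightarrow> fs = c"
    using first_return_exists by metis
  have closed: "closed_path_at G v c" using c by (simp add: first_return_path_at_def)
  then have c': "src G (hd c) = v" "c \<noteq> []" "set c \<subseteq> edges G"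
    using edge_path_nonempty[of G c] edge_path_edges[of G c] by (auto simp: closed_path_at_def)
  define \<zeta> where "\<zeta> = (\<lambda>n. c ! (n mod length c))"
  interpret R: tail_representation G \<zeta> by unfold_locales
  have \<zeta>: "\<zeta> \<in> R.X" unfolding tail_class_def
    using cycle_infinite_path[OF closed] by (auto simp: \<zeta>_def[symmetric])
  have \<zeta>0: "src G (\<zeta> 0) = v" using c' by (simp add: \<zeta>_def hd_conv_nth)
  have only: "\<xi> = \<zeta>" if "\<xi> \<in> R.X" "src G (\<xi> 0) = v" for \<xi>
    using unique_first_return_tail[OF c unique] that unfolding \<zeta>_def by blast
  have vg: "{v} \<in> gen_verts G" using v(1) by (rule gen_verts.vertex)
  define Z :: "('v, 'e, 'k) lpa_free set" where "Z = R.annihilator"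
  have Z: "free_ideal (lpa_gens G) Z" unfolding Z_def by (rule R.free_ideal_annihilator)
  have "lpa_relators G \<subseteq> Z"
    unfolding Z_def R.annihilator_def using R.relators_annihilate relator_carrier_homogeneous(1) by blast
  then have NZ: "lpa_ideal G \<subseteq> Z" by (rule lpa_ideal_minimal[OF Z])
  interpret LQ: free_quotient "lpa_gens G" "lpa_ideal G :: ('v, 'e, 'k) lpa_free set" by (rule lpa_quotient)
  have Q: "LQ.Q = leavitt_path_algebra G" by (simp add: leavitt_path_algebra_def)
  define P where "P = LQ.cl ` Z"
  have P: "two_sided_ideal LQ.Q P" and mem: "\<And>x. x \<in> free_carrier (lpa_gens G) \<Longrightarrow> LQ.cl x \<in> P \<longleftrightarrow> x \<in> Z"
    unfolding P_def using LQ.image_ideal[OF Z NZ] by auto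
  have pv: "pp {v} \<notin> Z"
  proof -
    have "action R.act (pp {v}) (\<lambda>_. 1 :: 'k) \<zeta> = 1" using \<zeta> \<zeta>0 by (simp add: action_var)
    then show ?thesis using \<zeta> unfolding Z_def R.annihilator_def by force
  qed
  have prime: "prime_two_sided_ideal LQ.Q P"
    unfolding prime_two_sided_ideal_def
  proof (intro conjI allI impI P)
    show "P \<noteq> carrier LQ.Q" using mem pv pp_carrier[OF vg] by (auto simp: LQ.carrier_Q)
    fix I J assume I: "two_sided_ideal LQ.Q I" and J: "two_sided_ideal LQ.Q J" and IJ: "ideal_prod LQ.Q I J \<subseteq> P"
    show "I \<subseteq> P \<or> J \<subseteq> P"
    proof (rule ccontr)
      assume "\<not> ?thesis"
      then obtain x y where xy: "x \<in> I" "x \<notin> P" "y \<in> J" "y \<notin> P" by blast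
      note pI = LQ.pull_ideal[OF I lpa_local_unit] and pJ = LQ.pull_ideal[OF J lpa_local_unit]
      obtain f where f: "f \<in> LQ.pull I" "x = LQ.cl f" using xy(1) pI(3) by (metis imageE)
      obtain g where g: "g \<in> LQ.pull J" "y = LQ.cl g" using xy(3) pJ(3) by (metis imageE)
      have fg: "f \<in> LQ.pull I" "LQ.cl f \<notin> P" "g \<in> LQ.pull J" "LQ.cl g \<notin> P" using f g xy by simp_all
      then have car: "f \<in> free_carrier (lpa_gens G)" "g \<in> free_carrier (lpa_gens G)"
        by (auto simp: LQ.pull_def)
      then obtain t where t: "t \<in> free_carrier (lpa_gens G)" "f * (t * g) \<notin> Z"
        using R.annihilator_prime[of f g] fg mem unfolding Z_def by blast
      \<comment> \<open>The separating element \<open>t\<close> can be inserted between the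
        representatives, because \<open>t * g\<close> still represents an element of
        \<open>J\<close>.\<close>
      have "t * g \<in> LQ.pull J" using free_idealD(5)[OF pJ(1) fg(3) t(1)] .
      then have "LQ.cl f \<otimes>\<^bsub>LQ.Q\<^esub> LQ.cl (t * g) \<in> P"
        using IJ fg(1) ideal_prod.prod[of "LQ.cl f" I "LQ.cl (t * g)" J LQ.Q] by (auto simp: LQ.pull_def)
      then have "f * (t * g) \<in> Z"
        using LQ.mult_Q[OF car(1)] mem car t free_algebra_mult by metis
      then show False using t by simp
    qed
  qed
  have "\<not> graded_ideal LQ.Q (lpa_component G) P"
  proof
    assume gr: "graded_ideal LQ.Q (lpa_component G) P"
    define sc :: "('v, 'e, 'k) lpa_free" where "sc = single (FWord (map GenS c)) 1"
    have scc: "sc \<in> free_carrier (lpa_gens G)"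
      unfolding sc_def using c' by (intro free_algebra_single) (auto simp: lpa_gens_def)
    have sch: "homogeneous gen_degree (int (length c)) sc"
      by (simp add: sc_def homogeneous_def o_def sum_list_triv)
    have ph: "homogeneous gen_degree 0 (pp {v} :: ('v, 'e, 'k) lpa_free)"
      using homogeneous_var[of gen_degree "GenP {v}"] by simp
    have "action R.act (pp {v} - sc) \<psi> \<xi> = 0" if \<xi>: "\<xi> \<in> R.X" for \<psi> and \<xi>
    proof (cases "src G (\<xi> 0) = v")
      case True
      then have "\<xi> = \<zeta>" using only \<xi> by blast
      moreover have "word_act R.act (map GenS c) \<zeta> = Some \<zeta>"
        using R.word_act_strip[OF \<zeta>, of c] by (auto simp: \<zeta>_def)
      ultimately show ?thesis using \<zeta> \<zeta>0 by (simp add: action_diff action_var sc_def action_single)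
    next
      case False
      then have "\<xi> 0 \<noteq> c ! 0" using c' by (auto simp: hd_conv_nth)
      then have "word_act R.act (map GenS c) \<xi> = None"
        using R.word_act_strip[OF \<xi>, of c] c' by auto
      then show ?thesis using False by (simp add: action_diff action_var sc_def action_single)
    qed
    then have yZ: "pp {v} - sc \<in> Z"
      unfolding Z_def R.annihilator_def using pp_carrier[OF vg] scc by (auto intro: free_algebra_diff)
    then have yP: "LQ.cl (pp {v} - sc) \<in> P" by (simp add: P_def)
    from gr have "\<forall>X\<in>P. \<exists>N f. finite N \<and> (\<forall>n\<in>N. f n \<in> P \<inter> lpa_component G n) \<and> X = finsum LQ.Q f N"
      unfolding graded_ideal_def by (rule conjunct2)
    from bspec[OF this yP] obtain M f where M: "finite M \<and> (\<forall>n\<in>M. f n \<in> P \<inter> lpa_component G n) \<and>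
        LQ.cl (pp {v} - sc) = finsum LQ.Q f M"
      by (elim exE)
    have fM: "f n \<in> P" "f n \<in> lpa_component G n" if "n \<in> M" for n using M that by auto
    have "\<exists>x. x \<in> free_carrier (lpa_gens G) \<and> homogeneous gen_degree n x \<and> f n = LQ.cl x" if "n \<in> M" for n
      using lpa_component_homogeneous[OF fM(2)[OF that]] unfolding lpa_class_eq Bex_def conj_assoc .
    then obtain h where h: "\<And>n. n \<in> M \<Longrightarrow> h n \<in> free_carrier (lpa_gens G)"
      "\<And>n. n \<in> M \<Longrightarrow> homogeneous gen_degree n (h n)" "\<And>n. n \<in> M \<Longrightarrow> f n = LQ.cl (h n)" by metis
    have hZ: "h n \<in> Z" if "n \<in> M" for n using mem[OF h(1)[OF that]] fM(1)[OF that] h(3)[OF that] by simp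
    interpret Qg: abelian_group LQ.Q by (rule LQ.abelian_group_Q)
    have "finsum LQ.Q f M = finsum LQ.Q (\<lambda>n. LQ.cl (h n)) M"
      by (rule Qg.finsum_cong') (use h in \<open>auto simp: LQ.carrier_Q\<close>)
    then have "LQ.cl (pp {v} - sc) = LQ.cl (sum h M)" using M LQ.finsum_Q[of M h] h(1) by simp
    then have "pp {v} - sc - sum h M \<in> lpa_ideal G" by (simp add: LQ.cl_eq_iff)
    \<comment> \<open>The representatives \<open>pp {v} - sc\<close> and \<open>sum h M\<close>
      agree only modulo the relations. As this ideal is graded, their components of degree 0 agree
      modulo it as well.\<close>
    moreover have "lpa_ideal G \<subseteq> homogeneous_core (lpa_gens G) gen_degree (lpa_ideal G :: ('v, 'e, 'k) lpa_free set)"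
      by (rule lpa_ideal_minimal[OF homogeneous_core_ideal lpa_relators_core])
        (auto intro: free_ideal_lpa_ideal lpa_relators_subset[THEN subsetD])
    ultimately have "component gen_degree 0 (pp {v} - sc - sum h M) \<in> Z"
      using NZ by (auto simp: homogeneous_core_def)
    moreover have diff: "component gen_degree 0 (x - y) = component gen_degree 0 x - component gen_degree 0 y"
      for x y :: "('v, 'e, 'k) lpa_free"
      using component_add[of gen_degree 0 "x - y" y] by simp
    \<comment> \<open>\<open>c\<close> is nonempty, so \<open>sc\<close> has positive degree and
      only \<open>pp {v}\<close> remains in degree 0.\<close>
    moreover have "component gen_degree 0 sc = 0" using component_homogeneous[OF sch] c'(2) by simp
    moreover have "component gen_degree 0 (pp {v}) = (pp {v} :: ('v, 'e, 'k) lpa_free)"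
      using component_homogeneous[OF ph] by simp
    ultimately have 1: "pp {v} - component gen_degree 0 (sum h M) \<in> Z" by simp
    have "component gen_degree 0 (sum h M') \<in> Z" if "M' \<subseteq> M" for M'
      using finite_subset[OF that conjunct1[OF M]] that
    proof (induction rule: finite_induct)
      case (insert n M')
      then have "component gen_degree 0 (h n) \<in> Z"
        using component_homogeneous[OF h(2)] hZ free_idealD(2)[OF Z] by auto
      then show ?case using insert free_idealD(3)[OF Z] by (simp add: component_add)
    qed (simp add: component_zero free_idealD(2)[OF Z])
    then have "component gen_degree 0 (sum h M) \<in> Z" by blast
    from free_idealD(3)[OF Z 1 this] have "pp {v} \<in> Z" by simp
    then show False using pv by simp
  qed
  then show ?thesis using prime unfolding Q by blast
qed

end

theorem corollary3p8:
  fixes G :: "('v, 'e) pre_ultragraph"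
  assumes "ultragraph G"
  shows "condition_K G \<longleftrightarrow>
    (\<forall>P. prime_two_sided_ideal
            (leavitt_path_algebra G :: ('k::field, ('v, 'e, 'k) lpa_free set) module) P \<longrightarrow>
          graded_ideal (leavitt_path_algebra G) (lpa_component G) P)"
proof -
  interpret ultragraph G by (rule assms)
  show ?thesis
    using condition_K_graded not_condition_K_nongraded_prime[where ?'k = 'k]
    unfolding prime_two_sided_ideal_def by blast
qed

end
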